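(* Let $X$ be a separable real Banach space, let $\eta$ be a centered, nondegenerate Gaussian measure on $X$, and let $H$ and $\mathscr{J}:H\to X$ be the associated Hilbert space and linear map (see context). Let $K_1,\dots,K_N\subset X^*$ be nonempty, convex and weak* compact, $K=K_1\times\cdots\times K_N$, and let $F_1,\dots,F_N:K\to\mathbb{R}$ be weak* continuous. Suppose that (a) for each $\mu\in K$ and $j=1,\dots,N$ the function $K_j\ni\nu_j\mapsto F_j(\nu_j,\mu_{-j})$ is convex; and (b) $F_1,\dots,F_N$ is monotone, i.e. $\sum_{j=1}^N\langle\mu_j-\nu_j,x_j-y_j\rangle\ge 0$ whenever $\mu,\nu\in K$, $x_j\in\partial_{\mu_j}F_j(\mu)$ and $y_j\in\partial_{\mu_j}F_j(\nu)$ for $j=1,\dots,N$. Let $\mathcal{D}=\{\mu\in K:\ \mathscr{J}^{-1}(\partial_{\mu_j}F_j(\mu))\neq\emptyset\ \text{for every } j=1,\dots,N\}$ and let $\mu^0\in\mathcal{D}$. Then there is a unique absolutely continuous $\xi:[0,\infty)\to H^N$ with $\xi(t)\in\mathcal{D}$ for each $t\ge 0$ and $$\begin{cases}\mathscr{J}\dot\xi_j(t)+\partial_{\mu_j}F_j(\xi(t))\ni 0 & \text{for a.e. } t\ge 0,\\ \xi_j(0)=\mu^0_j\end{cases}$$ for each $j=1,\dots,N$. Moreover, $\xi$ is Lipschitz continuous and $$\frac1t\int_0^t\xi(s)\,ds$$ converges weak* to a Nash equilibrium of $F_1,\dots,F_N$ as $t\to\infty$.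
   Context: $X^*$ is the continuous dual of $X$ and $\langle\mu,x\rangle=\mu(x)$ for $\mu\in X^*$, $x\in X$. For $\mu\in K$ and $\nu_j\in K_j$, $(\nu_j,\mu_{-j})$ denotes the tuple obtained from $\mu=(\mu_1,\dots,\mu_N)$ by replacing $\mu_j$ with $\nu_j$. A centered, nondegenerate Gaussian measure on $X$ is a Borel probability measure $\eta$ on $X$ whose pushforward under every $\mu\in X^*\setminus\{0\}$ is a Gaussian measure on $\mathbb{R}$ with mean $0$ and positive variance. Such $\eta$ satisfies $\int_X\|x\|^2d\eta(x)<\infty$, so $X^*\subset L^2(X,\eta)$; two elements of $X^*$ that agree $\eta$-a.e. are equal. $H$ is the closure of $X^*$ in $L^2(X,\eta)$, with inner product $(\mu,\nu)=\int_X\mu(x)\nu(x)\,d\eta(x)$; an element of $H$ agreeing $\eta$-a.e. with an element of $X^*$ is identified with that element, so that $K\subset H^N$. $H^N$ carries the inner product $(\mu,\nu)=\sum_{j=1}^N(\mu_j,\nu_j)$. The linear map $\mathscr{J}:H\to X$ is the Bochner integral $\mathscr{J}\xi=\int_X x\,\xi(x)\,d\eta(x)$; it satisfies $(\mu,\nu)=\langle\mu,\mathscr{J}\nu\rangle$ for $\mu,\nu\in X^*$. For $\mu\in K$, $$\partial_{\mu_j}F_j(\mu)=\{x\in X: F_j(\nu_j,\mu_{-j})\ge F_j(\mu)+\langle\nu_j-\mu_j,x\rangle\ \text{for all }\nu_j\in K_j\}.$$ The inclusion $\mathscr{J}\dot\xi_j(t)+\partial_{\mu_j}F_j(\xi(t))\ni0$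 means $-\mathscr{J}\dot\xi_j(t)\in\partial_{\mu_j}F_j(\xi(t))$. $\mu\in K$ is a Nash equilibrium of $F_1,\dots,F_N$ if $F_j(\mu)\le F_j(\nu_j,\mu_{-j})$ for all $\nu_j\in K_j$ and $j=1,\dots,N$. *)

theory Defs
  imports "HOL-Probability.Probability"
begin

section \<open>Dual space and Gaussian measures\<close>

text \<open>The dual $X^*$ is the type of bounded linear maps to the reals. For scalar-valued maps the
  strong operator topology (pointwise convergence on $X$) is the weak* topology.\<close>

abbreviation weak_star :: "('a::real_normed_vector \<Rightarrow>\<^sub>L real) topology" where
  "weak_star \<equiv> strong_operator_topology"

abbreviation weak_star_tuples :: "('n \<Rightarrow> 'a::real_normed_vector \<Rightarrow>\<^sub>L real) topology" where
  "weak_star_tuples \<equiv> product_topology (\<lambda>_. weak_star) UNIV"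

definition centered_nondegenerate_gaussian :: "'a::real_normed_vector measure \<Rightarrow> bool" where
  "centered_nondegenerate_gaussian \<eta> \<longleftrightarrow>
     prob_space \<eta> \<and> sets \<eta> = sets borel \<and>
     (\<forall>\<mu> :: 'a \<Rightarrow>\<^sub>L real. \<mu> \<noteq> 0 \<longrightarrow>
        (\<exists>\<sigma>>0. distributed \<eta> lborel (blinfun_apply \<mu>) (normal_density 0 \<sigma>)))"

section \<open>The Hilbert spaces $H$ and $H^N$ and the map $J$\<close>

text \<open>Elements of $L^2(X,\eta)$ are represented by square-integrable functions, equality in $L^2$
  being equality almost everywhere. Tuples are functions on a finite index type. The norms below
  are only meaningful on square-integrable functions.\<close>

definition L2_functions :: "'a measure \<Rightarrow> ('a \<Rightarrow> real) set" where
  "L2_functions \<eta> = {f \<in> borel_measurable \<eta>. integrable \<eta> (\<lambda>x. (f x)\<^sup>2)}"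

definition H_inner :: "'a measure \<Rightarrow> ('a \<Rightarrow> real) \<Rightarrow> ('a \<Rightarrow> real) \<Rightarrow> real" where
  "H_inner \<eta> f g = (\<integral>x. f x * g x \<partial>\<eta>)"

definition H_norm :: "'a measure \<Rightarrow> ('a \<Rightarrow> real) \<Rightarrow> real" where
  "H_norm \<eta> f = sqrt (H_inner \<eta> f f)"

definition H_space :: "'a::real_normed_vector measure \<Rightarrow> ('a \<Rightarrow> real) set" where
  "H_space \<eta> =
     {f \<in> L2_functions \<eta>. \<forall>\<epsilon>>0. \<exists>\<mu> :: 'a \<Rightarrow>\<^sub>L real. H_norm \<eta> (\<lambda>x. f x - \<mu> x) < \<epsilon>}"

definition HN_inner ::
  "'a measure \<Rightarrow> ('n::finite \<Rightarrow> 'a \<Rightarrow> real) \<Rightarrow> ('n \<Rightarrow> 'a \<Rightarrow> real) \<Rightarrow> real" where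
  "HN_inner \<eta> u v = (\<Sum>j\<in>UNIV. H_inner \<eta> (u j) (v j))"

definition HN_norm :: "'a measure \<Rightarrow> ('n::finite \<Rightarrow> 'a \<Rightarrow> real) \<Rightarrow> real" where
  "HN_norm \<eta> u = sqrt (HN_inner \<eta> u u)"

definition HN_dist :: "'a measure \<Rightarrow> ('n::finite \<Rightarrow> 'a \<Rightarrow> real) \<Rightarrow> ('n \<Rightarrow> 'a \<Rightarrow> real) \<Rightarrow> real" where
  "HN_dist \<eta> u v = HN_norm \<eta> (\<lambda>j x. u j x - v j x)"

definition HN_of :: "('n \<Rightarrow> 'a::real_normed_vector \<Rightarrow>\<^sub>L real) \<Rightarrow> 'n \<Rightarrow> 'a \<Rightarrow> real" where
  "HN_of \<mu> = (\<lambda>j. blinfun_apply (\<mu> j))"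

definition J_map ::
  "'a::{banach, second_countable_topology} measure \<Rightarrow> ('a \<Rightarrow> real) \<Rightarrow> 'a" where
  "J_map \<eta> f = (\<integral>x. f x *\<^sub>R x \<partial>\<eta>)"

section \<open>Calculus of curves in $H^N$\<close>

definition HN_has_derivative_at ::
  "'a::real_normed_vector measure \<Rightarrow> (real \<Rightarrow> 'n::finite \<Rightarrow> 'a \<Rightarrow> real) \<Rightarrow>
     ('n \<Rightarrow> 'a \<Rightarrow> real) \<Rightarrow> real \<Rightarrow> bool" where
  "HN_has_derivative_at \<eta> f v t \<longleftrightarrow>
     (\<forall>j. v j \<in> H_space \<eta>) \<and>
     ((\<lambda>s. HN_dist \<eta> (\<lambda>j x. (f s j x - f t j x) / (s - t)) v) \<longlongrightarrow> 0) (at t within {0..})"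

definition HN_absolutely_continuous_on ::
  "'a measure \<Rightarrow> real set \<Rightarrow> (real \<Rightarrow> 'n::finite \<Rightarrow> 'a \<Rightarrow> real) \<Rightarrow> bool" where
  "HN_absolutely_continuous_on \<eta> S f \<longleftrightarrow>
     (\<forall>\<epsilon>>0. \<exists>\<delta>>0. \<forall>\<I>. finite \<I> \<and> (\<forall>(a, b)\<in>\<I>. a \<le> b \<and> {a..b} \<subseteq> S) \<and>
        disjoint_family_on (\<lambda>(a, b). {a<..<b}) \<I> \<and> (\<Sum>(a, b)\<in>\<I>. b - a) < \<delta> \<longrightarrow>
        (\<Sum>(a, b)\<in>\<I>. HN_dist \<eta> (f a) (f b)) < \<epsilon>)"

definition HN_lipschitz_on ::
  "'a measure \<Rightarrow> real set \<Rightarrow> (real \<Rightarrow> 'n::finite \<Rightarrow> 'a \<Rightarrow> real) \<Rightarrow> bool" where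
  "HN_lipschitz_on \<eta> S f \<longleftrightarrow>
     (\<exists>L\<ge>0. \<forall>s\<in>S. \<forall>t\<in>S. HN_dist \<eta> (f s) (f t) \<le> L * \<bar>s - t\<bar>)"

text \<open>This is the library's \<open>has_integral\<close> on a compact interval with the norm of $H^N$
  in place of a type-class norm; for continuous curves it is the Riemann and the Bochner
  integral.\<close>

definition HN_has_integral ::
  "'a::real_normed_vector measure \<Rightarrow> (real \<Rightarrow> 'n::finite \<Rightarrow> 'a \<Rightarrow> real) \<Rightarrow>
     ('n \<Rightarrow> 'a \<Rightarrow> real) \<Rightarrow> real \<Rightarrow> real \<Rightarrow> bool" where
  "HN_has_integral \<eta> f I a b \<longleftrightarrow>
     (\<forall>j. I j \<in> H_space \<eta>) \<and>
     ((\<lambda>p. HN_dist \<eta> (\<lambda>j x. \<Sum>(s, k)\<in>p. measure lborel k * f s j x) I) \<longlongrightarrow> 0)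
       (division_filter {a..b})"

section \<open>Games\<close>

text \<open>The product set is \<open>Pi UNIV K\<close>, and \<open>\<mu>(j := \<nu>)\<close> is $(\nu_j,\mu_{-j})$.
  The values of \<open>F j\<close> outside \<open>Pi UNIV K\<close> never matter.\<close>

type_synonym ('n, 'a) payoffs = "'n \<Rightarrow> ('n \<Rightarrow> 'a \<Rightarrow>\<^sub>L real) \<Rightarrow> real"

definition partial_subdiff ::
  "('n \<Rightarrow> ('a::real_normed_vector \<Rightarrow>\<^sub>L real) set) \<Rightarrow> ('n, 'a) payoffs \<Rightarrow> 'n \<Rightarrow>
     ('n \<Rightarrow> 'a \<Rightarrow>\<^sub>L real) \<Rightarrow> 'a set" where
  "partial_subdiff K F j \<mu> =
     {x. \<forall>\<nu>\<in>K j. F j (\<mu>(j := \<nu>)) \<ge> F j \<mu> + blinfun_apply (\<nu> - \<mu> j) x}"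

definition monotone_payoffs ::
  "('n::finite \<Rightarrow> ('a::real_normed_vector \<Rightarrow>\<^sub>L real) set) \<Rightarrow> ('n, 'a) payoffs \<Rightarrow> bool" where
  "monotone_payoffs K F \<longleftrightarrow>
     (\<forall>\<mu>\<in>Pi UNIV K. \<forall>\<nu>\<in>Pi UNIV K. \<forall>x y.
        (\<forall>j. x j \<in> partial_subdiff K F j \<mu>) \<and> (\<forall>j. y j \<in> partial_subdiff K F j \<nu>) \<longrightarrow>
        (\<Sum>j\<in>UNIV. blinfun_apply (\<mu> j - \<nu> j) (x j - y j)) \<ge> 0)"

definition nash_equilibrium ::
  "('n \<Rightarrow> ('a::real_normed_vector \<Rightarrow>\<^sub>L real) set) \<Rightarrow> ('n, 'a) payoffs \<Rightarrow>
     ('n \<Rightarrow> 'a \<Rightarrow>\<^sub>L real) \<Rightarrow> bool" where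
  "nash_equilibrium K F \<mu> \<longleftrightarrow>
     \<mu> \<in> Pi UNIV K \<and> (\<forall>j. \<forall>\<nu>\<in>K j. F j \<mu> \<le> F j (\<mu>(j := \<nu>)))"

definition flow_domain ::
  "'a::{banach, second_countable_topology} measure \<Rightarrow> ('n \<Rightarrow> ('a \<Rightarrow>\<^sub>L real) set) \<Rightarrow>
     ('n, 'a) payoffs \<Rightarrow> ('n \<Rightarrow> 'a \<Rightarrow>\<^sub>L real) set" where
  "flow_domain \<eta> K F =
     {\<mu> \<in> Pi UNIV K. \<forall>j. {h \<in> H_space \<eta>. J_map \<eta> h \<in> partial_subdiff K F j \<mu>} \<noteq> {}}"

text \<open>Since the values of a solution lie in \<open>flow_domain \<eta> K F\<close>, a curve is a function into
  tuples of functionals, regarded as a curve in $H^N$ through \<open>HN_of\<close>; only its values at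
  times \<open>t \<ge> 0\<close> matter. Absolute continuity on the half-line is required on every
  compact subinterval.\<close>

definition flow_solution ::
  "'a::{banach, second_countable_topology} measure \<Rightarrow> ('n::finite \<Rightarrow> ('a \<Rightarrow>\<^sub>L real) set) \<Rightarrow>
     ('n, 'a) payoffs \<Rightarrow> ('n \<Rightarrow> 'a \<Rightarrow>\<^sub>L real) \<Rightarrow> (real \<Rightarrow> 'n \<Rightarrow> 'a \<Rightarrow>\<^sub>L real) \<Rightarrow> bool" where
  "flow_solution \<eta> K F \<mu>0 \<xi> \<longleftrightarrow>
     (\<forall>T\<ge>0. HN_absolutely_continuous_on \<eta> {0..T} (\<lambda>t. HN_of (\<xi> t))) \<and>
     (\<forall>t\<ge>0. \<xi> t \<in> flow_domain \<eta> K F) \<and>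
     (\<forall>j. (AE t in lborel. t \<ge> 0 \<longrightarrow>
             (\<exists>v. HN_has_derivative_at \<eta> (\<lambda>t. HN_of (\<xi> t)) v t \<and>
                  - J_map \<eta> (v j) \<in> partial_subdiff K F j (\<xi> t))) \<and>
          \<xi> 0 j = \<mu>0 j)"

end

theory Submission
  imports Defs "HOL-Library.Diagonal_Subsequence" "HOL-Library.Function_Algebras"
begin

text \<open>By Fernique's tail argument $\int \|x\|^2\,d\eta < \infty$, and therefore the weak* topology and
  the $H^N$ norm induce the same topology on the weak* compact set $K$. Hence $K$ is norm compact in
  $H^N$, which has two consequences. First, Ky Fan's inequality yields, for every $z \in K$ and
  $\tau > 0$, a Nash equilibrium $R_\tau z$ of the game with payoffs
  $F_j + \frac{1}{2\tau}\|\cdot - z_j\|^2$; these are the resolvents of the monotone operator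
  $\mathscr{J}^{-1}\partial F$. Second, the implicit Euler curves $R_{1/k}^{\lfloor kt \rfloor}\mu^0$
  converge along a subsequence to a Lipschitz curve $\xi$.

  With $A_\tau = (1 - R_\tau)/\tau$ and $|A\mu| = \sup_\tau \|A_\tau\mu\|$, the energy inequality
  for $\xi$ gives $\|\xi(t) - \xi(s)\| \le |A\xi(s)|\,(t-s)$ for $s \le t$, and $|A\xi(s)|$ decreases
  in $s$. At each of its continuity points, so for all but countably many $s$, the difference
  quotients of $\xi$ converge in norm to $-\lim_{\tau\to 0} A_\tau\xi(s)$. No differentiation theorem
  for Lipschitz curves is needed. Monotonicity gives uniqueness, and the time averages
  converge by Opial's argument: the distance of $\xi(t)$ to every equilibrium decreases, so no
  two cluster points of the averages can differ.\<close>

section \<open>Real functions\<close>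

text \<open>The difficulty is that the curve is at first only a limit of Euler curves: nothing is
  known about its derivative, and the Yosida approximations A_\<tau> belong to the operator at
  resolvent points, not at points of the curve. So monotonicity is kept in integrated form: each
  inequality tests the curve against a fixed pair (R_\<tau> z, A_\<tau> z) over a short interval,
  with an error quadratic in its length. Such errors disappear under subdivision, and after division
  by the length they still tend to 0. The abstract part runs in an incomplete inner product space,
  that of tuples of functionals with the L2 pairing; limits of points exist there because K is
  compact. The limit of the A_\<tau> may leave the space of functionals, and there Riesz-Fischer
  enters. The equilibrium problem behind the resolvent has in general no common potential that could
  be minimised, hence Ky Fan. Fernique's argument rests on the invariance of \<eta> x \<eta> under a
  rotation, hence on Cramer-Wold, hence on a supply of continuous functionals.\<close>

lemma nonincreasing_of_quadratic_bound:
  fixes \<phi> :: "real \<Rightarrow> real"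
  assumes ab: "a \<le> b"
    and bnd: "\<And>s t. a \<le> s \<Longrightarrow> s \<le> t \<Longrightarrow> t \<le> b \<Longrightarrow> \<phi> t - \<phi> s \<le> C * (t - s)\<^sup>2"
  shows "\<phi> b \<le> \<phi> a"
proof -
  \<comment> \<open>Over n + 1 equal pieces the quadratic errors add up to a quantity of order 1/(n
    + 1). Applied to the energy of a curve, this replaces the integration of a differential
    inequality.\<close>
  have *: "\<phi> b - \<phi> a \<le> C * (b - a)\<^sup>2 * inverse (real (Suc n))" for n
  proof -
    define d where "d = (b - a) / Suc n"
    have d0: "d \<ge> 0" using ab by (simp add: d_def)
    have "(\<Sum>i<Suc n. \<phi> (a + real (Suc i) * d) - \<phi> (a + real i * d)) \<le> (\<Sum>i<Suc n. C * d\<^sup>2)"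
    proof (rule sum_mono)
      fix i assume "i \<in> {..<Suc n}"
      then have "real (Suc i) * d \<le> real (Suc n) * d" by (intro mult_right_mono d0) auto
      also have "\<dots> = b - a" by (simp add: d_def)
      finally have "a + real (Suc i) * d \<le> b" by simp
      moreover have "a + real (Suc i) * d - (a + real i * d) = d" by (simp add: algebra_simps)
      ultimately show "\<phi> (a + real (Suc i) * d) - \<phi> (a + real i * d) \<le> C * d\<^sup>2"
        using bnd[of "a + real i * d" "a + real (Suc i) * d"] d0 by (simp add: algebra_simps)
    qed
    moreover have "(\<Sum>i<Suc n. \<phi> (a + real (Suc i) * d) - \<phi> (a + real i * d)) = \<phi> (a + real (Suc n) * d) - \<phi> (a + real 0 * d)"
      by (rule sum_lessThan_telescope)
    moreover have "a + real (Suc n) * d = b" by (simp add: d_def)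
    ultimately show ?thesis by (simp add: d_def power2_eq_square divide_simps)
  qed
  have "(\<lambda>n. C * (b - a)\<^sup>2 * inverse (real (Suc n))) \<longlonglongrightarrow> C * (b - a)\<^sup>2 * 0"
    by (intro tendsto_intros LIMSEQ_inverse_real_of_nat)
  then have "\<phi> b - \<phi> a \<le> C * (b - a)\<^sup>2 * 0"
    by (rule LIMSEQ_le_const) (use * in blast)
  then show ?thesis by simp
qed

lemma tendsto_0_bound:
  fixes f g :: "'b \<Rightarrow> real"
  assumes "(g \<longlongrightarrow> 0) F" "\<And>k. \<bar>f k\<bar> \<le> g k"
  shows "(f \<longlongrightarrow> 0) F"
  by (rule Lim_null_comparison[OF always_eventually assms(1)]) (use assms(2) in simp)

lemma lipschitz_integrable:
  fixes g :: "real \<Rightarrow> real"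
  assumes "\<And>r s. a \<le> r \<Longrightarrow> r \<le> b \<Longrightarrow> a \<le> s \<Longrightarrow> s \<le> b \<Longrightarrow> \<bar>g r - g s\<bar> \<le> L * \<bar>r - s\<bar>"
    and "a \<le> c" "d \<le> b"
  shows "g integrable_on {c..d}"
proof (rule integrable_continuous_real)
  have "(max L 0)-lipschitz_on {c..d} g"
  proof (rule lipschitz_onI)
    fix x y assume "x \<in> {c..d}" "y \<in> {c..d}"
    then have "\<bar>g x - g y\<bar> \<le> L * \<bar>x - y\<bar>" using assms by auto
    also have "\<dots> \<le> max L 0 * \<bar>x - y\<bar>" by (intro mult_right_mono) auto
    finally show "dist (g x) (g y) \<le> max L 0 * dist x y" by (simp add: dist_real_def)
  qed simp
  then show "continuous_on {c..d} g" by (rule lipschitz_on_continuous_on)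
qed

lemma lipschitz_integral_bound:
  fixes g :: "real \<Rightarrow> real"
  assumes lip: "\<And>r s. a \<le> r \<Longrightarrow> r \<le> b \<Longrightarrow> a \<le> s \<Longrightarrow> s \<le> b \<Longrightarrow> \<bar>g r - g s\<bar> \<le> L * \<bar>r - s\<bar>"
    and ac: "a \<le> c" "c \<le> d" "d \<le> b" and "0 \<le> L"
  shows "\<bar>integral {c..d} g - (d - c) * g c\<bar> \<le> L * (d - c)\<^sup>2"
proof -
  have "(g has_integral integral {c..d} g) {c..d}"
    using ac by (intro integrable_integral lipschitz_integrable[OF lip])
  moreover have "((\<lambda>_. g c) has_integral (d - c) * g c) {c..d}"
    using has_integral_const_real[of "g c" c d] ac by simp
  ultimately have "((\<lambda>r. g r - g c) has_integral integral {c..d} g - (d - c) * g c) {c..d}"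
    by (rule has_integral_diff)
  then have "norm (integral {c..d} g - (d - c) * g c) \<le> L * (d - c) * Henstock_Kurzweil_Integration.content {c..d}"
  proof (rule has_integral_bound_real[where S = "{}", rotated 2])
    fix x assume "x \<in> {c..d} - {}"
    then have "\<bar>g x - g c\<bar> \<le> L * \<bar>x - c\<bar>" using lip[of x c] ac by auto
    also have "\<dots> \<le> L * (d - c)" using \<open>x \<in> {c..d} - {}\<close> assms by (intro mult_left_mono) auto
    finally show "norm (g x - g c) \<le> L * (d - c)" by simp
  qed (use assms in auto)
  then show ?thesis using ac by (simp add: power2_eq_square)
qed

text \<open>Each of the n pieces of length h = t/n contributes an error of at most L h^2. Left
  endpoints of a uniform partition are used because the corresponding averages of the curve will be
  convex combinations of its points.\<close>

lemma riemann_sum_error: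
  fixes g :: "real \<Rightarrow> real"
  assumes lip: "\<And>r s. 0 \<le> r \<Longrightarrow> r \<le> t \<Longrightarrow> 0 \<le> s \<Longrightarrow> s \<le> t \<Longrightarrow> \<bar>g r - g s\<bar> \<le> L * \<bar>r - s\<bar>"
    and t: "0 \<le> t" and L: "0 \<le> L" and n: "0 < n"
  shows "\<bar>integral {0..t} g - (t / real n) * (\<Sum>i<n. g (real i * (t / real n)))\<bar> \<le> L * t\<^sup>2 / real n"
proof -
  define h where "h = t / real n"
  have h: "0 \<le> h" "real n * h = t" using t n by (auto simp: h_def)
  have "\<bar>integral {0..real k * h} g - h * (\<Sum>i<k. g (real i * h))\<bar> \<le> real k * (L * h\<^sup>2)" if "k \<le> n" for k
    using that
  proof (induction k)
    case (Suc k)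
    have kn: "real (Suc k) * h \<le> t" unfolding h(2)[symmetric] using Suc.prems h(1) by (intro mult_right_mono) auto
    have d: "real (Suc k) * h - real k * h = h" by (simp add: algebra_simps)
    have k: "0 \<le> real k * h" "real k * h \<le> real (Suc k) * h" using h(1) by (auto intro!: mult_right_mono)
    have "integral {0..real k * h} g + integral {real k * h..real (Suc k) * h} g = integral {0..real (Suc k) * h} g"
      by (intro Henstock_Kurzweil_Integration.integral_combine lipschitz_integrable[OF lip]) (use k kn in auto)
    moreover have "\<bar>integral {real k * h..real (Suc k) * h} g - h * g (real k * h)\<bar> \<le> L * h\<^sup>2"
      using lipschitz_integral_bound[OF lip k kn L] unfolding d by simp
    ultimately show ?case using Suc by (simp add: algebra_simps abs_le_iff)
  qed simp
  from this[of n] have "\<bar>integral {0..t} g - h * (\<Sum>i<n. g (real i * h))\<bar> \<le> real n * (L * h\<^sup>2)" using h by simp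
  also have "real n * (L * h\<^sup>2) = L * t\<^sup>2 / real n" using n by (simp add: h_def power2_eq_square)
  finally show ?thesis by (simp add: h_def)
qed

lemma antimono_tendsto_at_top:
  fixes f :: "real \<Rightarrow> real"
  assumes mono: "\<And>s t. 0 \<le> s \<Longrightarrow> s \<le> t \<Longrightarrow> f t \<le> f s" and bnd: "\<And>t. c \<le> f t"
  shows "\<exists>l. (f \<longlongrightarrow> l) at_top"
proof
  define l where "l = (INF t\<in>{0..}. f t)"
  have bdd: "bdd_below (f ` {0..})" using bnd by (intro bdd_belowI2)
  show "(f \<longlongrightarrow> l) at_top"
  proof (rule order_tendstoI)
    fix a assume "a < l"
    moreover have "l \<le> f t" if "0 \<le> t" for t unfolding l_def using that by (intro cINF_lower bdd) auto
    ultimately show "\<forall>\<^sub>F t in at_top. a < f t"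
      unfolding eventually_at_top_linorder by (meson less_le_trans)
  next
    fix a assume "l < a"
    then obtain s where "0 \<le> s" "f s < a" unfolding l_def
      using cINF_less_iff[OF _ bdd, of a] by auto
    then show "\<forall>\<^sub>F t in at_top. f t < a"
      unfolding eventually_at_top_linorder using mono le_less_trans by blast
  qed
qed

text \<open>\<open>m\<close> is the running average of \<open>g\<close>, given through integrals
  because the mean of the curve will itself be known only through its pairings. The stretch before
  \<open>g\<close> settles is fixed and is diluted by the division by t.\<close>

lemma cesaro_at_top:
  fixes g m :: "real \<Rightarrow> real"
  assumes lim: "(g \<longlongrightarrow> l) at_top"
    and int: "\<And>t. 0 < t \<Longrightarrow> (g has_integral t * m t) {0..t}"
  shows "(m \<longlongrightarrow> l) at_top"
proof (rule tendstoI)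
  fix e :: real assume e: "0 < e"
  obtain N where N: "0 < N" "\<And>t. N \<le> t \<Longrightarrow> \<bar>g t - l\<bar> < e / 2"
  proof -
    obtain N where "\<forall>t\<ge>N. dist (g t) l < e / 2"
      using tendstoD[OF lim, of "e/2"] e by (auto simp: eventually_at_top_linorder)
    then show thesis using that[of "max N 1"] by (auto simp: dist_real_def)
  qed
  define C where "C = \<bar>N * m N - N * l\<bar>"
  show "\<forall>\<^sub>F t in at_top. dist (m t) l < e"
    unfolding eventually_at_top_linorder
  \<comment> \<open>Past the second bound C < e t / 2, which pays for {0..N}; the other half of e t
    pays for {N..t}.\<close>
  proof (intro exI[of _ "max (N + 1) (2 * C / e + 1)"] allI impI)
    fix t assume "max (N + 1) (2 * C / e + 1) \<le> t"
    then have t: "N \<le> t" "N < t" "2 * C / e < t" "0 < t" using N(1) by auto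
    have "((\<lambda>r. g r - l) has_integral t * m t - t * l) {0..t}"
      using has_integral_diff[OF int[OF t(4)] has_integral_const_real[of l 0 t]] t by simp
    moreover have "((\<lambda>r. g r - l) has_integral N * m N - N * l) {0..N}"
      using has_integral_diff[OF int[OF N(1)] has_integral_const_real[of l 0 N]] N by simp
    moreover have "(\<lambda>r. g r - l) integrable_on {N..t}"
      using calculation(1) by (rule integrable_subinterval_real[OF has_integral_integrable]) (use N t in auto)
    ultimately have "N * m N - N * l + integral {N..t} (\<lambda>r. g r - l) = t * m t - t * l"
      using Henstock_Kurzweil_Integration.integral_combine[of 0 N t "\<lambda>r. g r - l"] N t
      by (metis has_integral_integrable integral_unique less_eq_real_def)
    moreover have "norm (integral {N..t} (\<lambda>r. g r - l)) \<le> e / 2 * Henstock_Kurzweil_Integration.content {N..t}"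
      using \<open>(\<lambda>r. g r - l) integrable_on {N..t}\<close> N(2) e
      by (intro has_integral_bound_real[OF _ finite.emptyI integrable_integral]) (auto intro: less_imp_le)
    ultimately have "\<bar>t * m t - t * l\<bar> \<le> C + e / 2 * (t - N)" using t unfolding C_def by simp
    also have "\<dots> \<le> C + e / 2 * t" using e N(1) by simp
    also have "\<dots> < e * t" using t(3) e by (simp add: field_simps)
    also have "\<bar>t * m t - t * l\<bar> = t * \<bar>m t - l\<bar>"
      using t(4) abs_mult[of t "m t - l"] by (simp add: right_diff_distrib)
    finally show "dist (m t) l < e" using t(4) by (simp add: dist_real_def mult.commute)
  qed
qed

lemma le_of_forall_pos:
  fixes a b c :: real
  assumes "\<And>d. 0 < d \<Longrightarrow> a \<le> b + c * d"
  shows "a \<le> b"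
proof -
  have "(\<lambda>n. b + c * inverse (real (Suc n))) \<longlonglongrightarrow> b + c * 0"
    by (intro tendsto_intros LIMSEQ_inverse_real_of_nat)
  then have "a \<le> b + c * 0" by (rule LIMSEQ_le_const) (use assms in auto)
  then show ?thesis by simp
qed

text \<open>A gauge argument in place of integrating the derivative. A tag with a nonpositive
  derivative receives a ball on which the increment is at most \<epsilon> times the length; a tag in
  the exceptional null set receives an open set of small measure, where absolute continuity bounds
  the total increment. Signed increments suffice in the second hypothesis, since only an upper bound
  is sought.\<close>

lemma absolutely_continuous_nonincreasing:
  fixes g :: "real \<Rightarrow> real"
  assumes ab: "a \<le> b"
    and ac: "\<And>\<epsilon>. 0 < \<epsilon> \<Longrightarrow> \<exists>\<delta>>0. \<forall>\<I>. finite \<I> \<and> (\<forall>(l, r)\<in>\<I>. l \<le> r \<and> {l..r} \<subseteq> {a..b}) \<and>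
        disjoint_family_on (\<lambda>(l, r). {l<..<r}) \<I> \<and> (\<Sum>(l, r)\<in>\<I>. r - l) < \<delta> \<longrightarrow>
        (\<Sum>(l, r)\<in>\<I>. g r - g l) < \<epsilon>"
    and deriv: "AE t in lborel. a < t \<and> t < b \<longrightarrow> (\<exists>d\<le>0. (g has_real_derivative d) (at t))"
  shows "g b \<le> g a"
proof (rule field_le_epsilon)
  fix e :: real assume e: "0 < e"
  \<comment> \<open>The good tags will contribute at most \<epsilon> (b - a) and the bad ones at
    most \<epsilon>, together e.\<close>
  define \<epsilon> where "\<epsilon> = e / (b - a + 1)"
  have "\<epsilon> * (b - a + 1) = e" using ab by (simp add: \<epsilon>_def)
  then have eps: "0 < \<epsilon>" "\<epsilon> * (b - a) + \<epsilon> = e" using e ab by (simp add: \<epsilon>_def, simp add: algebra_simps)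
  from ac[OF eps(1)] obtain \<delta> where \<delta>: "0 < \<delta>" and ac': "\<forall>\<I>. finite \<I> \<and> (\<forall>(l, r)\<in>\<I>. l \<le> r \<and> {l..r} \<subseteq> {a..b}) \<and>
        disjoint_family_on (\<lambda>(l, r). {l<..<r}) \<I> \<and> (\<Sum>(l, r)\<in>\<I>. r - l) < \<delta> \<longrightarrow>
        (\<Sum>(l, r)\<in>\<I>. g r - g l) < \<epsilon>"
    by (elim exE conjE) (rule that)
  obtain N0 where N0: "N0 \<in> null_sets lborel" "{t. \<not> (a < t \<and> t < b \<longrightarrow> (\<exists>d\<le>0. (g has_real_derivative d) (at t)))} \<subseteq> N0"
    using deriv unfolding eventually_ae_filter by auto
  \<comment> \<open>The endpoints are treated as bad tags, since nothing is assumed about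
    derivatives there.\<close>
  define N where "N = N0 \<union> {a, b}"
  have N: "N \<in> null_sets lborel" unfolding N_def
    by (intro null_sets.Un N0 finite_imp_null_set_lborel) simp
  have "N \<in> sets borel" using N by auto
  obtain U where U: "open U" "N \<subseteq> U" "emeasure lborel (U - N) < ennreal \<delta>"
    by (rule outer_regular_lborel[OF \<open>N \<in> sets borel\<close>, of \<delta>]) (use \<delta> in auto)
  have "emeasure lborel U \<le> emeasure lborel (U - N) + emeasure lborel N"
    using emeasure_subadditive[of "U - N" lborel N] U \<open>N \<in> sets borel\<close> by (simp add: Un_absorb2)
  then have eU: "emeasure lborel U < ennreal \<delta>" using U(3) N by auto
  have "\<exists>r>0. \<forall>u v. u \<le> t \<and> t \<le> v \<and> {u..v} \<subseteq> ball t r \<longrightarrow> g v - g u \<le> \<epsilon> * (v - u)"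
    if t: "t \<in> {a..b}" "t \<notin> N" for t
  proof -
    have "t \<notin> N0" "a < t" "t < b" using t by (auto simp: N_def)
    then obtain d where d: "d \<le> 0" "(g has_real_derivative d) (at t)" using N0(2) by auto
    then have "(g has_derivative (*) d) (at t)" by (simp add: has_field_derivative_def)
    then obtain r where r: "0 < r" "\<And>y. norm (y - t) < r \<Longrightarrow> norm (g y - g t - d * (y - t)) \<le> \<epsilon> * norm (y - t)"
      using eps(1) unfolding has_derivative_at_alt by blast
    show ?thesis
    proof (intro exI conjI allI impI)
      fix u v assume uv: "u \<le> t \<and> t \<le> v \<and> {u..v} \<subseteq> ball t r"
      then have "u \<in> {u..v}" "v \<in> {u..v}" by auto
      then have "u \<in> ball t r" "v \<in> ball t r" using uv by blast+
      then have "norm (u - t) < r" "norm (v - t) < r" by (auto simp: dist_real_def)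
      then have "\<bar>g u - g t - d * (u - t)\<bar> \<le> \<epsilon> * \<bar>u - t\<bar>" "\<bar>g v - g t - d * (v - t)\<bar> \<le> \<epsilon> * \<bar>v - t\<bar>"
        using r(2) by auto
      then have "g t - g u \<le> \<epsilon> * (t - u) + d * (t - u)" "g v - g t \<le> \<epsilon> * (v - t) + d * (v - t)"
        using uv by (auto simp: abs_le_iff algebra_simps)
      moreover have "d * (t - u) \<le> 0" "d * (v - t) \<le> 0" using uv d by (auto intro: mult_nonpos_nonneg)
      ultimately show "g v - g u \<le> \<epsilon> * (v - u)" by (simp add: algebra_simps)
    qed (rule r)
  qed
  then obtain r where r: "\<And>t. t \<in> {a..b} \<Longrightarrow> t \<notin> N \<Longrightarrow> 0 < r t"
    "\<And>t u v. t \<in> {a..b} \<Longrightarrow> t \<notin> N \<Longrightarrow> u \<le> t \<Longrightarrow> t \<le> v \<Longrightarrow> {u..v} \<subseteq> ball t (r t) \<Longrightarrow> g v - g u \<le> \<epsilon> * (v - u)"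
    by metis
  define \<gamma> where "\<gamma> t = (if t \<in> N then U else if t \<in> {a..b} then ball t (r t) else UNIV)" for t
  have "gauge \<gamma>" unfolding gauge_def \<gamma>_def using U r(1) by auto
  then obtain p where p: "p tagged_division_of {a..b}" "\<gamma> fine p" by (rule fine_division_exists_real)
  have fin: "finite p" using p(1) by (rule tagged_division_of_finite)
  have mem: "\<exists>l h. l \<le> h \<and> k = {l..h} \<and> l \<le> t \<and> t \<le> h \<and> {l..h} \<subseteq> {a..b} \<and> {l..h} \<subseteq> \<gamma> t" if tk: "(t, k) \<in> p" for t k
  proof -
    have "t \<in> k" "k \<subseteq> {a..b}" "k \<subseteq> \<gamma> t" using tagged_division_ofD(2,3)[OF p(1) tk] fineD[OF p(2) tk] by auto
    moreover obtain l h where "k = cbox l h" using tagged_division_ofD(4)[OF p(1) tk] by blast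
    ultimately show ?thesis by (intro exI[of _ l] exI[of _ h]) auto
  qed
  \<comment> \<open>\<open>p1\<close> holds the good tags, \<open>p2\<close> the bad tags on proper
    intervals, \<open>p3\<close> the bad tags on one-point intervals. The last contribute 0 and are
    split off because \<open>p2\<close> must be turned into a set of endpoint pairs without
    collisions.\<close>
  define p1 where "p1 = {z \<in> p. fst z \<notin> N}"
  define p2 where "p2 = {z \<in> p. fst z \<in> N \<and> Inf (snd z) < Sup (snd z)}"
  define p3 where "p3 = {z \<in> p. fst z \<in> N \<and> \<not> Inf (snd z) < Sup (snd z)}"
  have split: "p = p1 \<union> (p2 \<union> p3)" "p1 \<inter> (p2 \<union> p3) = {}" "p2 \<inter> p3 = {}" by (auto simp: p1_def p2_def p3_def)
  have fins: "finite p1" "finite p2" "finite p3" using fin by (auto simp: p1_def p2_def p3_def)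
  let ?D = "\<lambda>z. g (Sup (snd z)) - g (Inf (snd z))"
  have total: "(\<Sum>z\<in>p. f (Sup (snd z)) - f (Inf (snd z))) = f b - f a" for f :: "real \<Rightarrow> real"
    using additive_tagged_division_1[OF ab p(1), of f] by (simp add: case_prod_unfold)
  have "sum ?D (p1 \<union> (p2 \<union> p3)) = sum ?D p1 + (sum ?D p2 + sum ?D p3)"
    using split(2,3) fins by (simp only: sum.union_disjoint finite_UnI simp_thms)
  then have "sum ?D p = sum ?D p1 + (sum ?D p2 + sum ?D p3)"
    by (simp only: split(1)[symmetric])
  moreover have "sum ?D p3 = 0"
  proof (rule sum.neutral, rule ballI)
    fix z assume z: "z \<in> p3"
    then obtain l h where "l \<le> h" "snd z = {l..h}" using mem[of "fst z" "snd z"] by (auto simp: p3_def)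
    then show "?D z = 0" using z by (auto simp: p3_def)
  qed
  moreover have "sum ?D p1 \<le> \<epsilon> * (b - a)"
  proof -
    have "sum ?D p1 \<le> (\<Sum>z\<in>p1. \<epsilon> * (Sup (snd z) - Inf (snd z)))"
    proof (rule sum_mono)
      fix z assume z: "z \<in> p1"
      obtain l h where lh: "l \<le> h" "snd z = {l..h}" "l \<le> fst z" "fst z \<le> h" "{l..h} \<subseteq> {a..b}" "{l..h} \<subseteq> \<gamma> (fst z)"
        using mem[of "fst z" "snd z"] z by (auto simp: p1_def)
      have "fst z \<in> {a..b}" "fst z \<notin> N" using lh z by (auto simp: p1_def)
      then show "?D z \<le> \<epsilon> * (Sup (snd z) - Inf (snd z))" using r(2)[of "fst z" l h] lh by (simp add: \<gamma>_def)
    qed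
    also have "\<dots> \<le> (\<Sum>z\<in>p. \<epsilon> * (Sup (snd z) - Inf (snd z)))"
    proof (rule sum_mono2[OF fin])
      show "p1 \<subseteq> p" by (auto simp: p1_def)
      fix z assume "z \<in> p - p1"
      then obtain l h where "l \<le> h" "snd z = {l..h}" using mem[of "fst z" "snd z"] by auto
      then show "0 \<le> \<epsilon> * (Sup (snd z) - Inf (snd z))" using eps by simp
    qed
    also have "\<dots> = \<epsilon> * (b - a)" using total[of "\<lambda>x. x"] by (simp add: sum_distrib_left[symmetric])
    finally show ?thesis .
  qed
  moreover have "sum ?D p2 < \<epsilon>"
  proof -
    define \<iota> where "\<iota> z = (Inf (snd z), Sup (snd z))" for z :: "real \<times> real set"
    have p2: "\<exists>l h. l < h \<and> snd z = {l..h} \<and> \<iota> z = (l, h) \<and> {l..h} \<subseteq> {a..b} \<and> {l..h} \<subseteq> U" if z: "z \<in> p2" for z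
    proof -
      obtain l h where lh: "l \<le> h" "snd z = {l..h}" "{l..h} \<subseteq> {a..b}" "{l..h} \<subseteq> \<gamma> (fst z)"
        using mem[of "fst z" "snd z"] z by (auto simp: p2_def)
      then show ?thesis using z by (intro exI[of _ l] exI[of _ h]) (auto simp: p2_def \<iota>_def \<gamma>_def)
    qed
    have disj: "{fst (\<iota> z)<..<snd (\<iota> z)} \<inter> {fst (\<iota> w)<..<snd (\<iota> w)} = {}" if zw: "z \<in> p2" "w \<in> p2" "z \<noteq> w" for z w
    proof -
      have "interior (snd z) \<inter> interior (snd w) = {}"
        using tagged_division_ofD(5)[OF p(1), of "fst z" "snd z" "fst w" "snd w"] zw by (auto simp: p2_def)
      then show ?thesis using p2[OF zw(1)] p2[OF zw(2)] by (auto simp: interior_atLeastAtMost_real)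
    qed
    have inj: "inj_on \<iota> p2"
    proof (rule inj_onI, rule ccontr)
      fix z w assume zw: "z \<in> p2" "w \<in> p2" "\<iota> z = \<iota> w" "z \<noteq> w"
      obtain l h where "l < h" "\<iota> z = (l, h)" using p2[OF zw(1)] by blast
      moreover have "(l + h) / 2 \<in> {l<..<h}" using \<open>l < h\<close> by simp
      ultimately show False using disj[OF zw(1,2,4)] zw(3) by auto
    qed
    have "ennreal (\<Sum>(l, r)\<in>\<iota> ` p2. r - l) = (\<Sum>z\<in>p2. ennreal (snd (\<iota> z) - fst (\<iota> z)))"
      unfolding sum.reindex[OF inj] using p2 by (subst sum_ennreal) (force simp: case_prod_unfold)+
    also have "\<dots> = (\<Sum>z\<in>p2. emeasure lborel {fst (\<iota> z)<..<snd (\<iota> z)})"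
      using p2 by (intro sum.cong) (force simp: emeasure_lborel_Ioo)+
    also have "\<dots> = emeasure lborel (\<Union>z\<in>p2. {fst (\<iota> z)<..<snd (\<iota> z)})"
      by (rule sum_emeasure) (use disj fins in \<open>auto simp: disjoint_family_on_def\<close>)
    also have "\<dots> \<le> emeasure lborel U"
    proof (rule emeasure_mono)
      show "(\<Union>z\<in>p2. {fst (\<iota> z)<..<snd (\<iota> z)}) \<subseteq> U" using p2 by fastforce
    qed (use U in simp)
    also note eU
    finally have len: "(\<Sum>(l, r)\<in>\<iota> ` p2. r - l) < \<delta>"
      using \<delta> by (meson ennreal_leI leD not_le_imp_less)
    have "(\<Sum>(l, r)\<in>\<iota> ` p2. g r - g l) < \<epsilon>"
    proof (rule ac'[THEN spec, THEN mp], intro conjI)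
      show "(\<Sum>(l, r)\<in>\<iota> ` p2. r - l) < \<delta>" by (rule len)
      show "\<forall>(l, r)\<in>\<iota> ` p2. l \<le> r \<and> {l..r} \<subseteq> {a..b}" using p2 by fastforce
      show "disjoint_family_on (\<lambda>(l, r). {l<..<r}) (\<iota> ` p2)"
        using disj by (auto simp: disjoint_family_on_def case_prod_unfold)
    qed (use fins in simp)
    then show ?thesis unfolding sum.reindex[OF inj] by (simp add: case_prod_unfold \<iota>_def)
  qed
  ultimately show "g b \<le> g a + e" using total[of g] eps(2) by simp
qed

section \<open>Inner products on real vector spaces\<close>

text \<open>The inner product is a parameter and not a type class instance: on tuples of functionals
  it depends on the measure. Completeness is not among the axioms, as the functionals are in general
  not closed in L2.\<close>

locale pre_hilbert =
  fixes ip :: "'v::real_vector \<Rightarrow> 'v \<Rightarrow> real"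
  assumes ip_commute: "ip x y = ip y x"
    and ip_add_left: "ip (x + y) z = ip x z + ip y z"
    and ip_scaleR_left: "ip (r *\<^sub>R x) y = r * ip x y"
    and ip_self_nonneg: "0 \<le> ip x x"
    and ip_self_eq_0: "ip x x = 0 \<Longrightarrow> x = 0"
begin

definition nrm :: "'v \<Rightarrow> real" where "nrm x = sqrt (ip x x)"

lemma ip_add_right: "ip z (x + y) = ip z x + ip z y"
  by (simp add: ip_commute[of z] ip_add_left)
lemma ip_scaleR_right: "ip y (r *\<^sub>R x) = r * ip y x"
  by (simp add: ip_commute[of y] ip_scaleR_left)
lemma ip_minus_left: "ip (- x) y = - ip x y"
  using ip_scaleR_left[of "-1" x y] by simp
lemma ip_minus_right: "ip y (- x) = - ip y x"
  by (simp add: ip_commute[of y] ip_minus_left)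
lemma ip_diff_left: "ip (x - y) z = ip x z - ip y z"
  using ip_add_left[of x "- y" z] by (simp add: ip_minus_left)
lemma ip_diff_right: "ip z (x - y) = ip z x - ip z y"
  by (simp add: ip_commute[of z] ip_diff_left)
lemma ip_zero_left [simp]: "ip 0 x = 0"
  using ip_scaleR_left[of 0 0 x] by simp
lemma ip_zero_right [simp]: "ip x 0 = 0"
  by (simp add: ip_commute[of x])
lemma ip_sum_left: "ip (sum f A) y = (\<Sum>i\<in>A. ip (f i) y)"
  by (induction A rule: infinite_finite_induct) (auto simp: ip_add_left)

lemmas ip_simps = ip_add_left ip_add_right ip_scaleR_left ip_scaleR_right ip_minus_left
  ip_minus_right ip_diff_left ip_diff_right

lemma nrm_nonneg [simp]: "0 \<le> nrm x"
  by (simp add: nrm_def ip_self_nonneg)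
lemma nrm_sq: "(nrm x)\<^sup>2 = ip x x"
  by (simp add: nrm_def ip_self_nonneg)
lemma nrm_zero [simp]: "nrm 0 = 0"
  by (simp add: nrm_def)
lemma nrm_eq_0: "nrm x = 0 \<longleftrightarrow> x = 0"
  using ip_self_eq_0[of x] by (auto simp: nrm_def)
lemma nrm_minus [simp]: "nrm (- x) = nrm x"
  by (simp add: nrm_def ip_simps)
lemma nrm_minus_commute: "nrm (x - y) = nrm (y - x)"
  using nrm_minus[of "x - y"] by simp
lemma nrm_scaleR: "nrm (r *\<^sub>R x) = \<bar>r\<bar> * nrm x"
proof -
  have "ip (r *\<^sub>R x) (r *\<^sub>R x) = r\<^sup>2 * ip x x" by (simp add: ip_simps power2_eq_square)
  then show ?thesis by (simp add: nrm_def real_sqrt_mult)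
qed

lemma ip_le_nrm: "ip x y \<le> nrm x * nrm y"
proof -
  \<comment> \<open>This vector avoids a division by \<open>nrm x\<close> or \<open>nrm y\<close>;
    expanding its square yields the claim multiplied by \<open>nrm x * nrm y\<close>.\<close>
  have "0 \<le> ip (nrm y *\<^sub>R x - nrm x *\<^sub>R y) (nrm y *\<^sub>R x - nrm x *\<^sub>R y)" by (rule ip_self_nonneg)
  also have "\<dots> = 2 * (nrm x * nrm y) * (nrm x * nrm y) - 2 * (nrm x * nrm y) * ip x y"
    unfolding ip_simps
    by (simp add: nrm_sq[of x, symmetric] nrm_sq[of y, symmetric] ip_commute[of y x] power2_eq_square algebra_simps)
  finally have *: "(nrm x * nrm y) * ip x y \<le> (nrm x * nrm y) * (nrm x * nrm y)" by simp
  show ?thesis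
  proof (cases "nrm x * nrm y = 0")
    case True
    then have "x = 0 \<or> y = 0" by (simp add: nrm_eq_0)
    then show ?thesis by auto
  next
    case False
    then have "nrm x * nrm y > 0" by (metis nrm_nonneg less_eq_real_def zero_le_mult_iff)
    then show ?thesis using * by (rule mult_left_le_imp_le[rotated])
  qed
qed

lemma abs_ip_le: "\<bar>ip x y\<bar> \<le> nrm x * nrm y"
  using ip_le_nrm[of x y] ip_le_nrm[of "-x" y] by (simp add: ip_simps)

lemma nrm_triangle: "nrm (x + y) \<le> nrm x + nrm y"
proof (rule power2_le_imp_le)
  show "(nrm (x + y))\<^sup>2 \<le> (nrm x + nrm y)\<^sup>2"
    using ip_le_nrm[of x y] by (simp add: nrm_sq ip_simps power2_sum ip_commute[of y x])
qed simp

lemma nrm_diff_triangle: "nrm (x - z) \<le> nrm (x - y) + nrm (y - z)"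
  using nrm_triangle[of "x - y" "y - z"] by simp

lemma abs_nrm_diff: "\<bar>nrm x - nrm y\<bar> \<le> nrm (x - y)"
  using nrm_triangle[of "x - y" y] nrm_triangle[of "y - x" x] nrm_minus_commute[of x y] by simp

lemma tendsto_ip:
  assumes "((\<lambda>k. nrm (f k - a)) \<longlongrightarrow> 0) F" "((\<lambda>k. nrm (g k - b)) \<longlongrightarrow> 0) F"
  shows "((\<lambda>k. ip (f k) (g k)) \<longlongrightarrow> ip a b) F"
proof -
  have "((\<lambda>k. nrm (f k - a) * nrm (g k - b) + nrm (f k - a) * nrm b + nrm a * nrm (g k - b)) \<longlongrightarrow> 0 * 0 + 0 * nrm b + nrm a * 0) F"
    by (intro tendsto_intros assms)
  then have lim: "((\<lambda>k. nrm (f k - a) * nrm (g k - b) + nrm (f k - a) * nrm b + nrm a * nrm (g k - b)) \<longlongrightarrow> 0) F" by simp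
  have "((\<lambda>k. ip (f k) (g k) - ip a b) \<longlongrightarrow> 0) F"
  proof (rule tendsto_0_bound[OF lim])
    fix k
    have "ip (f k) (g k) - ip a b = ip (f k - a) (g k - b) + ip (f k - a) b + ip a (g k - b)"
      by (simp add: ip_simps)
    then show "\<bar>ip (f k) (g k) - ip a b\<bar> \<le> nrm (f k - a) * nrm (g k - b) + nrm (f k - a) * nrm b + nrm a * nrm (g k - b)"
      using abs_ip_le[of "f k - a" "g k - b"] abs_ip_le[of "f k - a" b] abs_ip_le[of a "g k - b"] by simp
  qed
  then show ?thesis by (simp add: LIM_zero_iff)
qed

lemma tendsto_nrm:
  assumes "((\<lambda>k. nrm (f k - a)) \<longlongrightarrow> 0) F"
  shows "((\<lambda>k. nrm (f k)) \<longlongrightarrow> nrm a) F"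
  unfolding nrm_def by (intro tendsto_intros tendsto_ip assms)

lemma tendsto_nrm_diff:
  assumes "((\<lambda>k. nrm (f k - a)) \<longlongrightarrow> 0) F" "((\<lambda>k. nrm (g k - b)) \<longlongrightarrow> 0) F"
  shows "((\<lambda>k. nrm (f k - g k - (a - b))) \<longlongrightarrow> 0) F"
proof -
  have "((\<lambda>k. nrm (f k - a) + nrm (g k - b)) \<longlongrightarrow> 0 + 0) F" by (intro tendsto_intros assms)
  then have lim: "((\<lambda>k. nrm (f k - a) + nrm (g k - b)) \<longlongrightarrow> 0) F" by simp
  show ?thesis
  proof (rule tendsto_0_bound[OF lim])
    fix k
    have "f k - g k - (a - b) = (f k - a) + (b - g k)" by simp
    then have "nrm (f k - g k - (a - b)) \<le> nrm (f k - a) + nrm (g k - b)"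
      using nrm_triangle[of "f k - a" "b - g k"] nrm_minus_commute[of b "g k"] by metis
    then show "\<bar>nrm (f k - g k - (a - b))\<bar> \<le> nrm (f k - a) + nrm (g k - b)" by simp
  qed
qed

end

section \<open>The evolution equation of a family of resolvents\<close>

text \<open>The operator itself does not appear. The pair of R \<tau> z and (z - R \<tau> z) /
  \<tau> stands for a point of its graph, and \<open>R_monotone\<close> relates any two such points,
  for any two parameters. \<open>u0_bound\<close> is what an element of norm at most
  \<open>M\<close> in the operator at \<open>u0\<close> provides; \<open>M\<close> becomes the
  Lipschitz constant.\<close>

locale evolution = pre_hilbert +
  fixes K :: "'a set" and R :: "real \<Rightarrow> 'a \<Rightarrow> 'a" and u0 :: 'a and M :: real
  assumes K_seq_compact:
      "range \<sigma> \<subseteq> K \<Longrightarrow> \<exists>l\<in>K. \<exists>r::nat\<Rightarrow>nat. strict_mono r \<and> (\<lambda>n. nrm (\<sigma> (r n) - l)) \<longlonglongrightarrow> 0"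
    and K_convex: "convex K"
    and R_in: "0 < \<tau> \<Longrightarrow> z \<in> K \<Longrightarrow> R \<tau> z \<in> K"
    and R_monotone: "0 < \<tau> \<Longrightarrow> 0 < \<mu> \<Longrightarrow> z \<in> K \<Longrightarrow> y \<in> K \<Longrightarrow>
      0 \<le> ip ((1/\<tau>) *\<^sub>R (z - R \<tau> z) - (1/\<mu>) *\<^sub>R (y - R \<mu> y)) (R \<tau> z - R \<mu> y)"
    and u0_in: "u0 \<in> K"
    and u0_bound: "0 < \<tau> \<Longrightarrow> nrm (u0 - R \<tau> u0) \<le> \<tau> * M"
begin

text \<open>The Yosida approximation. \<open>A \<tau> z\<close> acts as a value of the operator at
  \<open>R \<tau> z\<close>, not at \<open>z\<close>.\<close>

definition A :: "real \<Rightarrow> 'a \<Rightarrow> 'a" where "A \<tau> z = (1/\<tau>) *\<^sub>R (z - R \<tau> z)"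

lemma R_eq: "0 < \<tau> \<Longrightarrow> R \<tau> z = z - \<tau> *\<^sub>R A \<tau> z"
  by (simp add: A_def)

lemma A_monotone:
  "0 < \<tau> \<Longrightarrow> 0 < \<mu> \<Longrightarrow> z \<in> K \<Longrightarrow> y \<in> K \<Longrightarrow> 0 \<le> ip (A \<tau> z - A \<mu> y) (R \<tau> z - R \<mu> y)"
  using R_monotone by (simp add: A_def)

lemma M_nonneg: "0 \<le> M"
  using order_trans[OF nrm_nonneg u0_bound[of 1]] by simp

lemma R_nonexpansive:
  assumes "0 < \<tau>" "z \<in> K" "y \<in> K"
  shows "nrm (R \<tau> z - R \<tau> y) \<le> nrm (z - y)"
proof -
  let ?d = "R \<tau> z - R \<tau> y"
  have "0 \<le> \<tau> * ip (A \<tau> z - A \<tau> y) ?d" using A_monotone[of \<tau> \<tau> z y] assms by simp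
  also have "\<dots> = ip (\<tau> *\<^sub>R (A \<tau> z - A \<tau> y)) ?d" by (simp only: ip_scaleR_left)
  also have "\<tau> *\<^sub>R (A \<tau> z - A \<tau> y) = (z - y) - ?d" using assms by (simp add: R_eq scaleR_diff_right)
  finally have "(nrm ?d)\<^sup>2 \<le> ip (z - y) ?d" by (simp add: nrm_sq ip_diff_left[of "z - y"])
  also have "\<dots> \<le> nrm (z - y) * nrm ?d" by (rule ip_le_nrm)
  finally have *: "nrm ?d * nrm ?d \<le> nrm (z - y) * nrm ?d" by (simp add: power2_eq_square)
  show ?thesis
  proof (cases "nrm ?d = 0")
    case False
    then have "nrm ?d > 0" by (metis nrm_nonneg less_eq_real_def)
    then show ?thesis using * by simp
  qed simp
qed

lemma K_cauchy:
  assumes in_K: "range \<sigma> \<subseteq> K" and cauchy: "\<And>e. 0 < e \<Longrightarrow> \<exists>N. \<forall>m\<ge>N. \<forall>n\<ge>N. nrm (\<sigma> m - \<sigma> n) < e"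
  shows "\<exists>l\<in>K. (\<lambda>n. nrm (\<sigma> n - l)) \<longlonglongrightarrow> 0"
proof -
  obtain l r where l: "l \<in> K" "strict_mono r" "(\<lambda>n. nrm (\<sigma> (r n) - l)) \<longlonglongrightarrow> 0"
    using K_seq_compact[OF in_K] by blast
  have "(\<lambda>n. nrm (\<sigma> n - l)) \<longlonglongrightarrow> 0"
  proof (rule LIMSEQ_I)
    fix e :: real assume "0 < e"
    then obtain N where N: "\<forall>m\<ge>N. \<forall>n\<ge>N. nrm (\<sigma> m - \<sigma> n) < e/2" using cauchy[of "e/2"] by auto
    obtain N' where N': "\<forall>n\<ge>N'. nrm (\<sigma> (r n) - l) < e/2"
      using LIMSEQ_D[OF l(3), of "e/2"] \<open>0 < e\<close> by auto
    show "\<exists>N. \<forall>n\<ge>N. norm (nrm (\<sigma> n - l) - 0) < e"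
    proof (intro exI allI impI)
      fix n assume "n \<ge> max N N'"
      moreover have "r n \<ge> n" using l(2) by (simp add: seq_suble)
      ultimately have "nrm (\<sigma> n - \<sigma> (r n)) < e/2" "nrm (\<sigma> (r n) - l) < e/2" using N N' by auto
      then show "norm (nrm (\<sigma> n - l) - 0) < e"
        using nrm_diff_triangle[of "\<sigma> n" l "\<sigma> (r n)"] by simp
    qed
  qed
  with l show ?thesis by blast
qed

subsection \<open>The implicit Euler scheme\<close>

definition euler :: "real \<Rightarrow> nat \<Rightarrow> 'a" where "euler h n = (R h ^^ n) u0"

lemma euler_0 [simp]: "euler h 0 = u0" and euler_Suc: "euler h (Suc n) = R h (euler h n)"
  by (simp_all add: euler_def)

lemma euler_in: "0 < h \<Longrightarrow> euler h n \<in> K"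
  by (induction n) (auto simp: u0_in euler_Suc R_in)

text \<open>One more step applies the nonexpansive \<open>R h\<close> to both points, so increments
  over p steps can only shrink with time.\<close>

lemma euler_shift:
  assumes "0 < h" "n \<le> m" shows "nrm (euler h (m + p) - euler h m) \<le> nrm (euler h (n + p) - euler h n)"
  using assms(2)
proof (induction m rule: dec_induct)
  case (step m)
  have "nrm (euler h (Suc m + p) - euler h (Suc m)) \<le> nrm (euler h (m + p) - euler h m)"
    using assms by (simp add: euler_Suc R_nonexpansive euler_in)
  with step show ?case by linarith
qed simp

lemma euler_lipschitz:
  assumes "0 < h" "n \<le> m" shows "nrm (euler h m - euler h n) \<le> real (m - n) * (h * M)"
  using assms(2)
proof (induction m rule: dec_induct)
  case (step m)
  have "nrm (euler h (0 + 1) - euler h 0) \<le> h * M"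
    using u0_bound[of h] assms by (simp add: euler_Suc nrm_minus_commute)
  with euler_shift[of h 0 m 1] have "nrm (euler h (Suc m) - euler h m) \<le> h * M" using assms by simp
  then show ?case
    using step nrm_diff_triangle[of "euler h (Suc m)" "euler h n" "euler h m"]
    by (simp add: Suc_diff_le algebra_simps)
qed simp

text \<open>The scheme tested against a fixed graph point (v, w). The linear term is frozen at
  \<open>euler h n\<close>; since the scheme moves at speed at most \<open>M\<close>, the freezing
  costs a term quadratic in the elapsed time.\<close>

lemma euler_energy:
  assumes h: "0 < h" and lam: "0 < \<tau>" and z: "z \<in> K" and nm: "n \<le> m"
  defines "v \<equiv> R \<tau> z" and "w \<equiv> A \<tau> z"
  shows "(nrm (euler h m - v))\<^sup>2 / 2 - (nrm (euler h n - v))\<^sup>2 / 2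
    \<le> real (m - n) * h * ip w (v - euler h n) + nrm w * M * (real (m - n) * h)\<^sup>2"
  using nm
proof (induction m rule: dec_induct)
  case (step m)
  let ?a = "euler h (Suc m)" let ?b = "euler h m" let ?k = "real (m - n)"
  have k: "real (Suc m - n) = ?k + 1" using step by (simp add: Suc_diff_le)
  have Ah: "?a - ?b = - (h *\<^sub>R A h ?b)" using h by (simp add: euler_Suc R_eq)
  have "(nrm (?a - v))\<^sup>2 / 2 - (nrm (?b - v))\<^sup>2 / 2 = ip (?a - ?b) (?a - v) - ip (?a - ?b) (?a - ?b) / 2"
    by (simp add: nrm_sq ip_simps ip_commute field_simps)
  also have "\<dots> \<le> ip (?a - ?b) (?a - v)" using ip_self_nonneg[of "?a - ?b"] by simp
  also have "\<dots> = - (h * ip (A h ?b) (?a - v))" by (simp only: Ah ip_scaleR_left ip_minus_left)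
  \<comment> \<open>The scheme is implicit: \<open>A h\<close> at the old point belongs to the
    operator at the new point, so monotonicity pairs it with the new point minus
    \<open>v\<close>.\<close>
  also have "\<dots> \<le> - (h * ip w (?a - v))"
    using A_monotone[OF h lam euler_in[OF h] z, of m] h
    by (simp add: v_def w_def euler_Suc ip_diff_left)
  also have "\<dots> = h * ip w (v - euler h n) + h * ip w (euler h n - ?a)" by (simp add: ip_simps algebra_simps)
  also have "ip w (euler h n - ?a) \<le> nrm w * (real (Suc m - n) * (h * M))"
    using ip_le_nrm[of w "euler h n - ?a"] euler_lipschitz[OF h, of n "Suc m"] step
      mult_left_mono[OF euler_lipschitz[OF h, of n "Suc m"], of "nrm w"]
    by (simp add: nrm_minus_commute[of "euler h n"])
  finally have st: "(nrm (?a - v))\<^sup>2 / 2 - (nrm (?b - v))\<^sup>2 / 2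
     \<le> h * ip w (v - euler h n) + h * (nrm w * ((?k + 1) * (h * M)))" using h k by simp
  \<comment> \<open>The quadratic remainder survives the induction because k^2 + (k + 1) is at most
    (k + 1)^2.\<close>
  have "nrm w * M * h\<^sup>2 * (?k\<^sup>2 + (?k + 1)) \<le> nrm w * M * h\<^sup>2 * (?k + 1)\<^sup>2"
    by (intro mult_left_mono mult_nonneg_nonneg M_nonneg nrm_nonneg) (auto simp: power2_eq_square algebra_simps)
  then have "nrm w * M * (?k * h)\<^sup>2 + h * (nrm w * ((?k + 1) * (h * M))) \<le> nrm w * M * ((?k + 1) * h)\<^sup>2"
    by (simp add: power2_eq_square algebra_simps)
  then show ?case using step.IH st unfolding k by (simp add: algebra_simps)
qed simp

definition hstep :: "nat \<Rightarrow> real" where "hstep k = 1 / real (Suc k)"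
definition tindex :: "nat \<Rightarrow> real \<Rightarrow> nat" where "tindex k t = nat \<lfloor>t * real (Suc k)\<rfloor>"
definition euler_curve :: "nat \<Rightarrow> real \<Rightarrow> 'a" where "euler_curve k t = euler (hstep k) (tindex k t)"

lemma hstep_pos [simp]: "0 < hstep k" by (simp add: hstep_def)

lemma hstep_lim: "hstep \<longlonglongrightarrow> 0"
  unfolding hstep_def using LIMSEQ_inverse_real_of_nat by (simp add: inverse_eq_divide)

lemma tindex_mono: "s \<le> t \<Longrightarrow> tindex k s \<le> tindex k t"
  unfolding tindex_def by (intro nat_mono floor_mono mult_right_mono) auto

lemma tindex_bounds:
  assumes "0 \<le> t" shows "real (tindex k t) * hstep k \<le> t" "t \<le> real (tindex k t) * hstep k + hstep k"
proof -
  have 0: "0 \<le> t * real (Suc k)" using assms by simp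
  then have *: "real (tindex k t) = real_of_int \<lfloor>t * real (Suc k)\<rfloor>" by (simp add: tindex_def)
  have "real (tindex k t) \<le> t * real (Suc k)" "t * real (Suc k) \<le> real (tindex k t) + 1"
    unfolding * by linarith+
  then show "real (tindex k t) * hstep k \<le> t" "t \<le> real (tindex k t) * hstep k + hstep k"
    by (simp_all add: hstep_def divide_simps algebra_simps)
qed

lemma euler_curve_in: "euler_curve k t \<in> K" by (simp add: euler_curve_def euler_in)

lemma tindex_diff:
  assumes "0 \<le> s" "s \<le> t"
  shows "\<bar>real (tindex k t - tindex k s) * hstep k - (t - s)\<bar> \<le> hstep k"
proof -
  have "real (tindex k t - tindex k s) = real (tindex k t) - real (tindex k s)"
    using tindex_mono[OF assms(2)] by simp
  then show ?thesis
    using tindex_bounds[of s k] tindex_bounds[of t k] assms by (simp add: abs_le_iff algebra_simps)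
qed

text \<open>The curve is piecewise constant, so the Lipschitz bound holds only up to one step; the
  excess vanishes with \<open>hstep k\<close>.\<close>

lemma euler_curve_lipschitz:
  assumes "0 \<le> s" "0 \<le> t"
  shows "nrm (euler_curve k t - euler_curve k s) \<le> M * \<bar>t - s\<bar> + M * hstep k"
proof -
  have *: "nrm (euler_curve k t - euler_curve k s) \<le> M * (t - s) + M * hstep k" if "0 \<le> s" "s \<le> t" for s t
  proof -
    have "nrm (euler_curve k t - euler_curve k s) \<le> real (tindex k t - tindex k s) * (hstep k * M)"
      unfolding euler_curve_def by (intro euler_lipschitz tindex_mono that) simp
    also have "\<dots> = M * (real (tindex k t - tindex k s) * hstep k)" by simp
    also have "\<dots> \<le> M * ((t - s) + hstep k)"
      using tindex_diff[OF that, of k] by (intro mult_left_mono M_nonneg) simp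
    finally show ?thesis by (simp add: algebra_simps)
  qed
  show ?thesis
  proof (cases "s \<le> t")
    case True then show ?thesis using *[of s t] assms by simp
  next
    case False then show ?thesis using *[of t s] assms by (simp add: nrm_minus_commute)
  qed
qed

section \<open>Passage to the limit of the Euler curves\<close>

text \<open>By compactness of \<open>K\<close> a diagonal subsequence converges at all nonnegative
  rational times. The Lipschitz bound, uniform up to \<open>M * hstep k\<close>, then makes it
  Cauchy at every other time.\<close>

lemma limit_exists:
  "\<exists>\<rho> \<xi>. strict_mono \<rho> \<and> (\<forall>t\<ge>0. \<xi> t \<in> K \<and> (\<lambda>k. nrm (euler_curve (\<rho> k) t - \<xi> t)) \<longlonglongrightarrow> 0)"
proof -
  \<comment> \<open>Negative rationals are sent to 0, so every index yields an admissible
    time.\<close>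
  define q :: "nat \<Rightarrow> real" where "q n = max 0 (real_of_rat (nat_to_rat_surj n))" for n
  define P where "P n s \<longleftrightarrow> (\<exists>l\<in>K. (\<lambda>k. nrm (euler_curve (s k) (q n) - l)) \<longlonglongrightarrow> 0)" for n and s :: "nat \<Rightarrow> nat"
  interpret subseqs P
  proof
    fix n and s :: "nat \<Rightarrow> nat" assume "strict_mono s"
    obtain l r where "l \<in> K" "strict_mono (r::nat\<Rightarrow>nat)" "(\<lambda>k. nrm (euler_curve (s (r k)) (q n) - l)) \<longlonglongrightarrow> 0"
      using K_seq_compact[of "\<lambda>k. euler_curve (s k) (q n)"] euler_curve_in by blast
    then show "\<exists>r'. strict_mono r' \<and> P n (s \<circ> r')"
      unfolding P_def o_def by blast
  qed
  have PP: "P n (diagseq \<circ> (+) (Suc n))" for n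
  proof (rule diagseq_holds)
    fix r s n assume "strict_mono (r::nat\<Rightarrow>nat)" "P n s"
    then obtain l where l: "l \<in> K" "(\<lambda>k. nrm (euler_curve (s k) (q n) - l)) \<longlonglongrightarrow> 0" unfolding P_def by blast
    have "(\<lambda>k. nrm (euler_curve (s (r k)) (q n) - l)) \<longlonglongrightarrow> 0"
      using LIMSEQ_subseq_LIMSEQ[OF l(2) \<open>strict_mono r\<close>] by (simp only: o_def)
    then show "P n (s \<circ> r)" unfolding P_def o_def using l(1) by blast
  qed
  have Pd: "P n diagseq" for n
  proof -
    obtain l where l: "l \<in> K" "(\<lambda>k. nrm (euler_curve (diagseq (Suc n + k)) (q n) - l)) \<longlonglongrightarrow> 0"
      using PP[of n] unfolding P_def o_def by blast
    then have "(\<lambda>k. nrm (euler_curve (diagseq (k + Suc n)) (q n) - l)) \<longlonglongrightarrow> 0" by (simp add: add.commute)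
    then have "(\<lambda>k. nrm (euler_curve (diagseq k) (q n) - l)) \<longlonglongrightarrow> 0" by (rule LIMSEQ_offset)
    with l show ?thesis by (auto simp: P_def)
  qed
  have "\<exists>l\<in>K. (\<lambda>k. nrm (euler_curve (diagseq k) t - l)) \<longlonglongrightarrow> 0" if t: "0 \<le> t" for t
  proof (rule K_cauchy)
    fix e :: real assume e: "0 < e"
    \<comment> \<open>A displacement d in time costs M d, at most e/6; the step size and the
      distance to the limit at the rational time cost e/6 each. So the curves come within e/2 of
      that limit, and two of them differ by less than e.\<close>
    define d where "d = e / (6 * (M + 1))"
    have d: "d > 0" "M * d \<le> e/6" using e M_nonneg by (auto simp: d_def divide_simps algebra_simps)
    obtain p :: rat where p: "t < real_of_rat p" "real_of_rat p < t + d"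
      using of_rat_dense[of t "t + d"] d by auto
    obtain n where np: "nat_to_rat_surj n = p" using surj_nat_to_rat_surj by (metis surjD)
    then have "q n = real_of_rat p" using p t by (simp add: q_def)
    then have qn: "\<bar>t - q n\<bar> \<le> d" "0 \<le> q n" using p t by (auto simp del: zero_le_of_rat_iff)
    obtain l where l: "l \<in> K" "(\<lambda>k. nrm (euler_curve (diagseq k) (q n) - l)) \<longlonglongrightarrow> 0" using Pd[of n] by (auto simp: P_def)
    obtain N1 where N1: "\<forall>k\<ge>N1. nrm (euler_curve (diagseq k) (q n) - l) < e/6" using LIMSEQ_D[OF l(2), of "e/6"] e by auto
    have "(\<lambda>k. M * hstep (diagseq k)) \<longlonglongrightarrow> M * 0"
      by (intro tendsto_intros LIMSEQ_subseq_LIMSEQ[OF hstep_lim subseq_diagseq, unfolded o_def])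
    then obtain N2 where N2: "\<forall>k\<ge>N2. \<bar>M * hstep (diagseq k)\<bar> < e/6" using LIMSEQ_D[of _ _ "e/6"] e by fastforce
    have close: "nrm (euler_curve (diagseq k) t - l) < e/2" if "k \<ge> max N1 N2" for k
    proof -
      have "nrm (euler_curve (diagseq k) t - euler_curve (diagseq k) (q n)) \<le> M * d + e/6"
        using euler_curve_lipschitz[OF qn(2) t, of "diagseq k"] mult_left_mono[OF qn(1) M_nonneg] N2 that by fastforce
      then show ?thesis using d N1 that nrm_diff_triangle[of "euler_curve (diagseq k) t" l "euler_curve (diagseq k) (q n)"] by fastforce
    qed
    show "\<exists>N. \<forall>m\<ge>N. \<forall>n\<ge>N. nrm (euler_curve (diagseq m) t - euler_curve (diagseq n) t) < e"
    proof (intro exI allI impI)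
      fix m n assume "m \<ge> max N1 N2" "n \<ge> max N1 N2"
      then show "nrm (euler_curve (diagseq m) t - euler_curve (diagseq n) t) < e"
        using close[of m] close[of n] nrm_diff_triangle[of "euler_curve (diagseq m) t" "euler_curve (diagseq n) t" l]
          nrm_minus_commute[of l "euler_curve (diagseq n) t"] by linarith
    qed
  qed (use euler_curve_in in auto)
  then show ?thesis using subseq_diagseq by metis
qed


text \<open>One subsequential limit, fixed by choice and meaningful for t \<ge> 0. Properties of the
  discrete curves reach it by reopening a subsequence with \<open>xi_limit\<close>.\<close>

definition xi :: "real \<Rightarrow> 'a" where
  "xi = (SOME \<xi>. \<exists>\<rho>. strict_mono \<rho> \<and> (\<forall>t\<ge>0. \<xi> t \<in> K \<and> (\<lambda>k. nrm (euler_curve (\<rho> k) t - \<xi> t)) \<longlonglongrightarrow> 0))"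

lemma xi_limit:
  obtains \<rho> :: "nat \<Rightarrow> nat" where "strict_mono \<rho>" "\<And>t. 0 \<le> t \<Longrightarrow> (\<lambda>k. nrm (euler_curve (\<rho> k) t - xi t)) \<longlonglongrightarrow> 0"
    "\<And>t. 0 \<le> t \<Longrightarrow> xi t \<in> K" "(\<lambda>k. hstep (\<rho> k)) \<longlonglongrightarrow> 0"
proof -
  have "\<exists>\<xi> \<rho>. strict_mono \<rho> \<and> (\<forall>t\<ge>0. \<xi> t \<in> K \<and> (\<lambda>k. nrm (euler_curve (\<rho> k) t - \<xi> t)) \<longlonglongrightarrow> 0)"
    using limit_exists by blast
  from someI_ex[OF this] obtain \<rho> where r: "strict_mono \<rho>"
    "\<forall>t\<ge>0. xi t \<in> K \<and> (\<lambda>k. nrm (euler_curve (\<rho> k) t - xi t)) \<longlonglongrightarrow> 0" unfolding xi_def by blast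
  moreover have "(\<lambda>k. hstep (\<rho> k)) \<longlonglongrightarrow> 0"
    using LIMSEQ_subseq_LIMSEQ[OF hstep_lim r(1)] by (simp only: o_def)
  ultimately show thesis using that by blast
qed

lemma xi_in: "0 \<le> t \<Longrightarrow> xi t \<in> K"
  using xi_limit by metis

lemma xi_0: "xi 0 = u0"
proof -
  obtain \<rho> :: "nat \<Rightarrow> nat" where "(\<lambda>k. nrm (euler_curve (\<rho> k) 0 - xi 0)) \<longlonglongrightarrow> 0" using xi_limit by (metis order_refl)
  moreover have "euler_curve k 0 = u0" for k by (simp add: euler_curve_def tindex_def)
  ultimately have "nrm (u0 - xi 0) = 0" by (simp add: LIMSEQ_const_iff)
  then show ?thesis by (simp add: nrm_eq_0)
qed

lemma xi_lipschitz:
  assumes "0 \<le> s" "0 \<le> t" shows "nrm (xi t - xi s) \<le> M * \<bar>t - s\<bar>"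
proof -
  obtain \<rho> where r: "\<And>t. 0 \<le> t \<Longrightarrow> (\<lambda>k. nrm (euler_curve (\<rho> k) t - xi t)) \<longlonglongrightarrow> 0" "(\<lambda>k. hstep (\<rho> k)) \<longlonglongrightarrow> 0"
    using xi_limit by metis
  have 1: "(\<lambda>k. nrm (euler_curve (\<rho> k) t - euler_curve (\<rho> k) s)) \<longlonglongrightarrow> nrm (xi t - xi s)"
    by (intro tendsto_nrm tendsto_nrm_diff r assms)
  have 2: "(\<lambda>k. M * \<bar>t - s\<bar> + M * hstep (\<rho> k)) \<longlonglongrightarrow> M * \<bar>t - s\<bar> + M * 0"
    by (intro tendsto_intros r)
  show ?thesis using LIMSEQ_le[OF 1 2] euler_curve_lipschitz[OF assms] by auto
qed

text \<open>The floor of a sum is the sum of the floors or one more. The mismatch of at most one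
  step occurs at both base times, which accounts for the two extra terms
  \<open>hstep k * M\<close>.\<close>

lemma euler_curve_shift:
  assumes "0 \<le> s" "s \<le> t" "0 \<le> q"
  shows "nrm (euler_curve k (t + q) - euler_curve k t) \<le> nrm (euler_curve k (s + q) - euler_curve k s) + 2 * (hstep k * M)"
proof -
  define p where "p = tindex k q"
  have *: "nrm (euler_curve k (r + q) - euler (hstep k) (tindex k r + p)) \<le> hstep k * M" if "0 \<le> r" for r
  proof -
    have "real (tindex k r + p) * hstep k \<le> real (tindex k (r + q)) * hstep k + hstep k"
      "real (tindex k (r + q)) * hstep k \<le> real (tindex k r + p) * hstep k + 2 * hstep k"
      using tindex_bounds[OF that, of k] tindex_bounds[OF assms(3), of k] tindex_bounds[of "r + q" k] that assms(3)
      unfolding p_def by (auto simp: algebra_simps)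
    have f: "\<lfloor>r * real (Suc k)\<rfloor> + \<lfloor>q * real (Suc k)\<rfloor> \<le> \<lfloor>(r + q) * real (Suc k)\<rfloor>"
      "\<lfloor>(r + q) * real (Suc k)\<rfloor> \<le> \<lfloor>r * real (Suc k)\<rfloor> + \<lfloor>q * real (Suc k)\<rfloor> + 1"
      unfolding distrib_right by linarith+
    have "0 \<le> \<lfloor>r * real (Suc k)\<rfloor>" "0 \<le> \<lfloor>q * real (Suc k)\<rfloor>" using that assms(3) by simp_all
    then have ge: "tindex k r + p \<le> tindex k (r + q)" and le: "tindex k (r + q) - (tindex k r + p) \<le> 1"
      using f unfolding tindex_def p_def by linarith+
    have "nrm (euler_curve k (r + q) - euler (hstep k) (tindex k r + p)) \<le> real (tindex k (r + q) - (tindex k r + p)) * (hstep k * M)"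
      unfolding euler_curve_def by (intro euler_lipschitz ge) simp
    also have "\<dots> \<le> 1 * (hstep k * M)"
      using le M_nonneg hstep_pos[of k] by (intro mult_right_mono mult_nonneg_nonneg) linarith+
    finally show ?thesis by simp
  qed
  have "nrm (euler (hstep k) (tindex k t + p) - euler_curve k t) \<le> nrm (euler (hstep k) (tindex k s + p) - euler_curve k s)"
    unfolding euler_curve_def by (intro euler_shift tindex_mono assms) simp
  then show ?thesis
    using *[of s] *[of t] assms
      nrm_diff_triangle[of "euler_curve k (t + q)" "euler_curve k t" "euler (hstep k) (tindex k t + p)"]
      nrm_diff_triangle[of "euler (hstep k) (tindex k s + p)" "euler_curve k s" "euler_curve k (s + q)"]
      nrm_minus_commute[of "euler_curve k (s + q)" "euler (hstep k) (tindex k s + p)"] by linarith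
qed

lemma xi_shift:
  assumes "0 \<le> s" "s \<le> t" "0 \<le> q"
  shows "nrm (xi (t + q) - xi t) \<le> nrm (xi (s + q) - xi s)"
proof -
  obtain \<rho> where r: "\<And>t. 0 \<le> t \<Longrightarrow> (\<lambda>k. nrm (euler_curve (\<rho> k) t - xi t)) \<longlonglongrightarrow> 0" "(\<lambda>k. hstep (\<rho> k)) \<longlonglongrightarrow> 0"
    using xi_limit by metis
  have 1: "(\<lambda>k. nrm (euler_curve (\<rho> k) (t + q) - euler_curve (\<rho> k) t)) \<longlonglongrightarrow> nrm (xi (t + q) - xi t)"
    by (intro tendsto_nrm tendsto_nrm_diff r) (use assms in auto)
  have 2: "(\<lambda>k. nrm (euler_curve (\<rho> k) (s + q) - euler_curve (\<rho> k) s) + 2 * (hstep (\<rho> k) * M)) \<longlonglongrightarrow> nrm (xi (s + q) - xi s) + 2 * (0 * M)"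
    by (intro tendsto_intros tendsto_nrm tendsto_nrm_diff r) (use assms in auto)
  show ?thesis using LIMSEQ_le[OF 1 2] euler_curve_shift[OF assms] by auto
qed

text \<open>The limit of \<open>euler_energy\<close>, and the last use of the Euler curves. It holds
  for every graph point with an explicit remainder and stands in for the evolution equation until
  the curve is known to be differentiable.\<close>

lemma xi_energy:
  assumes lam: "0 < \<tau>" and z: "z \<in> K" and st: "0 \<le> s" "s \<le> t"
  shows "(nrm (xi t - R \<tau> z))\<^sup>2 / 2 - (nrm (xi s - R \<tau> z))\<^sup>2 / 2
    \<le> (t - s) * ip (A \<tau> z) (R \<tau> z - xi s) + nrm (A \<tau> z) * M * (t - s)\<^sup>2"
proof -
  obtain \<rho> where r: "\<And>t. 0 \<le> t \<Longrightarrow> (\<lambda>k. nrm (euler_curve (\<rho> k) t - xi t)) \<longlonglongrightarrow> 0" "(\<lambda>k. hstep (\<rho> k)) \<longlonglongrightarrow> 0"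
    using xi_limit by metis
  \<comment> \<open>Elapsed time as the scheme measures it, the number of steps times their length;
    it tends to t - s.\<close>
  define d where "d k = real (tindex (\<rho> k) t - tindex (\<rho> k) s) * hstep (\<rho> k)" for k
  have "(\<lambda>k. d k - (t - s)) \<longlonglongrightarrow> 0"
    by (rule tendsto_0_bound[OF r(2)]) (use tindex_diff[OF st] in \<open>simp add: d_def\<close>)
  then have d: "d \<longlonglongrightarrow> t - s" by (simp add: LIM_zero_iff)
  have 1: "(\<lambda>k. (nrm (euler_curve (\<rho> k) t - R \<tau> z))\<^sup>2 / 2 - (nrm (euler_curve (\<rho> k) s - R \<tau> z))\<^sup>2 / 2)
    \<longlonglongrightarrow> (nrm (xi t - R \<tau> z))\<^sup>2 / 2 - (nrm (xi s - R \<tau> z))\<^sup>2 / 2"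
    by (intro tendsto_intros tendsto_nrm tendsto_nrm_diff r) (use st in auto)
  have 2: "(\<lambda>k. d k * ip (A \<tau> z) (R \<tau> z - euler_curve (\<rho> k) s) + nrm (A \<tau> z) * M * (d k)\<^sup>2)
    \<longlonglongrightarrow> (t - s) * ip (A \<tau> z) (R \<tau> z - xi s) + nrm (A \<tau> z) * M * (t - s)\<^sup>2"
    by (intro tendsto_intros tendsto_ip tendsto_nrm_diff r d) (use st in auto)
  show ?thesis
    by (rule LIMSEQ_le[OF 1 2]) (auto simp: euler_curve_def d_def intro!: euler_energy lam z tindex_mono st)
qed

text \<open>The energy inequality with \<open>z = xi s\<close>, so that the resolvent point and the
  starting point differ by exactly \<tau> times \<open>A \<tau> (xi s)\<close>. Expanding the two
  squares leaves the pairing of the increment with that vector; the square of the increment has a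
  favourable sign.\<close>

lemma A_xi_forward:
  assumes lam: "0 < \<tau>" and st: "0 \<le> s" "s < t"
  shows "(t - s) * (nrm (A \<tau> (xi s)))\<^sup>2
     \<le> - ip (xi t - xi s) (A \<tau> (xi s)) + nrm (A \<tau> (xi s)) * M * (t - s)\<^sup>2 / \<tau>"
proof -
  let ?w = "A \<tau> (xi s)" let ?d = "xi t - xi s"
  have R: "R \<tau> (xi s) = xi s - \<tau> *\<^sub>R ?w" using lam by (rule R_eq)
  have e: "xi t - R \<tau> (xi s) = ?d + \<tau> *\<^sub>R ?w" "xi s - R \<tau> (xi s) = \<tau> *\<^sub>R ?w" "R \<tau> (xi s) - xi s = - (\<tau> *\<^sub>R ?w)"
    by (simp_all add: R)
  have "(nrm (?d + \<tau> *\<^sub>R ?w))\<^sup>2 / 2 - (nrm (\<tau> *\<^sub>R ?w))\<^sup>2 / 2 = \<tau> * ip ?d ?w + (nrm ?d)\<^sup>2 / 2"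
    unfolding nrm_sq ip_add_left ip_add_right ip_scaleR_left ip_scaleR_right ip_commute[of ?w ?d] by (simp add: field_simps)
  moreover have "ip ?w (- (\<tau> *\<^sub>R ?w)) = - (\<tau> * (nrm ?w)\<^sup>2)" by (simp add: ip_minus_right ip_scaleR_right nrm_sq)
  ultimately have "\<tau> * ip ?d ?w + (nrm ?d)\<^sup>2 / 2 \<le> - (\<tau> * ((t - s) * (nrm ?w)\<^sup>2)) + nrm ?w * M * (t - s)\<^sup>2"
    using xi_energy[OF lam xi_in[OF st(1)] st(1), of t] st unfolding e by (simp add: mult.left_commute)
  moreover have "\<tau> * (- ip ?d ?w + nrm ?w * M * (t - s)\<^sup>2 / \<tau>) = - (\<tau> * ip ?d ?w) + nrm ?w * M * (t - s)\<^sup>2"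
    using lam by (simp add: right_diff_distrib)
  moreover have "0 \<le> (nrm ?d)\<^sup>2" by simp
  ultimately have "\<tau> * ((t - s) * (nrm ?w)\<^sup>2) \<le> \<tau> * (- ip ?d ?w + nrm ?w * M * (t - s)\<^sup>2 / \<tau>)"
    by linarith
  then show ?thesis using lam by simp
qed

text \<open>Divide \<open>A_xi_forward\<close> by t - s, bound the pairing by Cauchy-Schwarz and let
  t decrease to s: w = \<open>A \<tau> (xi s)\<close> satisfies |w|^2 \<le> L |w|. The forward speed
  of the curve thus dominates every Yosida approximation.\<close>

lemma A_xi_le_quotient:
  assumes lam: "0 < \<tau>" and s: "0 \<le> s" and L: "\<And>d. 0 < d \<Longrightarrow> nrm (xi (s + d) - xi s) \<le> L * d"
  shows "nrm (A \<tau> (xi s)) \<le> L"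
proof -
  let ?w = "A \<tau> (xi s)"
  have L0: "0 \<le> L" using L[of 1] nrm_nonneg[of "xi (s + 1) - xi s"] by linarith
  have "(nrm ?w)\<^sup>2 \<le> L * nrm ?w + (nrm ?w * M / \<tau>) * d" if "0 < d" for d
  proof -
    have "d * (nrm ?w)\<^sup>2 \<le> - ip (xi (s + d) - xi s) ?w + nrm ?w * M * d\<^sup>2 / \<tau>"
      using A_xi_forward[OF lam s, of "s + d"] that by simp
    also have "- ip (xi (s + d) - xi s) ?w \<le> L * d * nrm ?w"
      using abs_ip_le[of "xi (s + d) - xi s" ?w] mult_right_mono[OF L[OF that], of "nrm ?w"] by simp
    finally have "d * (nrm ?w)\<^sup>2 \<le> d * (L * nrm ?w + (nrm ?w * M / \<tau>) * d)"
      by (simp add: power2_eq_square algebra_simps)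
    then show ?thesis using that by simp
  qed
  then have "(nrm ?w)\<^sup>2 \<le> L * nrm ?w" by (rule le_of_forall_pos)
  then show ?thesis using L0
    by (metis mult_right_le_imp_le power2_eq_square less_eq_real_def nrm_nonneg)
qed

lemma A_xi_le_M: "0 < \<tau> \<Longrightarrow> 0 \<le> s \<Longrightarrow> nrm (A \<tau> (xi s)) \<le> M"
proof (rule A_xi_le_quotient)
  fix d :: real assume "0 < d" "0 \<le> s"
  then show "nrm (xi (s + d) - xi s) \<le> M * d" using xi_lipschitz[of s "s + d"] by simp
qed

lemma A_xi_key:
  assumes lam: "0 < \<tau>" and st: "0 \<le> s" "0 \<le> t" "s \<noteq> t"
  shows "ip ((1 / (t - s)) *\<^sub>R (xi t - xi s)) (A \<tau> (xi s)) \<le> - (nrm (A \<tau> (xi s)))\<^sup>2 + 3 * M\<^sup>2 * \<bar>t - s\<bar> / \<tau>"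
proof -
  let ?w = "A \<tau> (xi s)"
  have wM: "nrm ?w * M \<le> M\<^sup>2" using mult_right_mono[OF A_xi_le_M[OF lam st(1)] M_nonneg] by (simp add: power2_eq_square)
  show ?thesis
  proof (cases "s < t")
    case True
    have "(t - s) * (nrm ?w)\<^sup>2 \<le> - ip (xi t - xi s) ?w + nrm ?w * M * (t - s)\<^sup>2 / \<tau>"
      by (rule A_xi_forward) (use lam st True in auto)
    moreover have "nrm ?w * M * (t - s)\<^sup>2 / \<tau> \<le> 3 * M\<^sup>2 * (t - s)\<^sup>2 / \<tau>"
      using wM lam order_trans[OF wM, of "3 * M\<^sup>2"] by (intro divide_right_mono mult_right_mono) auto
    ultimately have "ip (xi t - xi s) ?w \<le> (t - s) * (- (nrm ?w)\<^sup>2 + 3 * M\<^sup>2 * \<bar>t - s\<bar> / \<tau>)"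
      using True by (simp add: power2_eq_square algebra_simps)
    then show ?thesis using True by (simp add: ip_scaleR_left pos_divide_le_eq mult.commute)
  next
    case False
    then have ts: "t < s" using st by simp
    let ?d = "xi s - xi t" let ?e = "s - t"
    have R: "R \<tau> (xi s) = xi s - \<tau> *\<^sub>R ?w" using lam by (rule R_eq)
    have e: "xi t - R \<tau> (xi s) = \<tau> *\<^sub>R ?w - ?d" "xi s - R \<tau> (xi s) = \<tau> *\<^sub>R ?w" "R \<tau> (xi s) - xi t = ?d - \<tau> *\<^sub>R ?w"
      by (simp_all add: R)
    have "(nrm (\<tau> *\<^sub>R ?w))\<^sup>2 / 2 - (nrm (\<tau> *\<^sub>R ?w - ?d))\<^sup>2 / 2 = \<tau> * ip ?d ?w - (nrm ?d)\<^sup>2 / 2"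
      unfolding nrm_sq ip_diff_left[of "\<tau> *\<^sub>R ?w"] ip_diff_right[of _ "\<tau> *\<^sub>R ?w"] ip_scaleR_left ip_scaleR_right ip_commute[of ?w ?d] by (simp add: field_simps)
    moreover have "ip ?w (?d - \<tau> *\<^sub>R ?w) = ip ?d ?w - \<tau> * (nrm ?w)\<^sup>2"
      unfolding ip_diff_right[of _ ?d] by (simp add: ip_scaleR_right nrm_sq ip_commute[of ?w ?d])
    ultimately have *: "\<tau> * ip ?d ?w - (nrm ?d)\<^sup>2 / 2 \<le> ?e * (ip ?d ?w - \<tau> * (nrm ?w)\<^sup>2) + nrm ?w * M * ?e\<^sup>2"
      using xi_energy[OF lam xi_in[OF st(1)] st(2), of s] ts unfolding e by simp
    have d: "nrm ?d \<le> M * ?e" using xi_lipschitz[OF st(2,1)] ts by simp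
    have d2: "(nrm ?d)\<^sup>2 \<le> M\<^sup>2 * ?e\<^sup>2" using power_mono[OF d nrm_nonneg, of 2] by (simp add: power_mult_distrib)
    have "ip ?d ?w \<le> nrm ?d * nrm ?w" by (rule ip_le_nrm)
    also have "\<dots> \<le> (M * ?e) * nrm ?w" by (intro mult_right_mono d nrm_nonneg)
    also have "\<dots> = ?e * (nrm ?w * M)" by simp
    also have "\<dots> \<le> ?e * M\<^sup>2" using wM ts by (intro mult_left_mono) auto
    finally have "?e * ip ?d ?w \<le> ?e * (?e * M\<^sup>2)" using ts by (intro mult_left_mono) auto
    have "nrm ?w * M * ?e\<^sup>2 \<le> M\<^sup>2 * ?e\<^sup>2" by (intro mult_right_mono wM) simp
    have "\<tau> * ip ?d ?w \<le> - (?e * \<tau> * (nrm ?w)\<^sup>2) + 3 * (M\<^sup>2 * ?e\<^sup>2)"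
    proof -
      have "?e * (ip ?d ?w - \<tau> * (nrm ?w)\<^sup>2) = ?e * ip ?d ?w - ?e * \<tau> * (nrm ?w)\<^sup>2" by (simp add: right_diff_distrib)
      moreover have "?e * (?e * M\<^sup>2) = M\<^sup>2 * ?e\<^sup>2" by (simp add: power2_eq_square)
      moreover have "0 \<le> M\<^sup>2 * ?e\<^sup>2" by simp
      ultimately show ?thesis using * d2 \<open>nrm ?w * M * ?e\<^sup>2 \<le> M\<^sup>2 * ?e\<^sup>2\<close> \<open>?e * ip ?d ?w \<le> ?e * (?e * M\<^sup>2)\<close>
        by linarith
    qed
    then have "ip ?d ?w \<le> ?e * (- (nrm ?w)\<^sup>2 + 3 * M\<^sup>2 * ?e / \<tau>)"
      using lam ts by (simp add: field_simps power2_eq_square)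
    moreover have "(1 / (t - s)) *\<^sub>R (xi t - xi s) = (1 / ?e) *\<^sub>R ?d"
    proof -
      have "(1 / ?e) *\<^sub>R ?d = (- (1 / ?e)) *\<^sub>R (- ?d)" unfolding scaleR_minus_left scaleR_minus_right by simp
      also have "- (1 / ?e) = 1 / (t - s)" using ts by (simp add: field_simps)
      also have "- ?d = xi t - xi s" by simp
      finally show ?thesis by simp
    qed
    ultimately show ?thesis using ts by (simp add: ip_scaleR_left pos_divide_le_eq mult.commute)
  qed
qed


text \<open>Monotonicity at one point z with two parameters gives \<tau> |a|^2 + \<mu> |b|^2 \<le>
  (\<tau> + \<mu>) (a, b) for a = \<open>A \<tau> z\<close> and b = \<open>A \<mu> z\<close>, and
  both claims follow. The second turns convergence of the norms into convergence of the
  vectors.\<close>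

lemma A_xi_antimono:
  assumes "0 < \<mu>" "\<mu> \<le> \<tau>" "z \<in> K"
  shows "nrm (A \<tau> z) \<le> nrm (A \<mu> z)"
    and "(nrm (A \<tau> z - A \<mu> z))\<^sup>2 \<le> (nrm (A \<mu> z))\<^sup>2 - (nrm (A \<tau> z))\<^sup>2"
proof -
  let ?a = "A \<tau> z" let ?b = "A \<mu> z"
  have tau: "0 < \<tau>" using assms by simp
  have "R \<tau> z - R \<mu> z = \<mu> *\<^sub>R ?b - \<tau> *\<^sub>R ?a" using assms tau by (simp add: R_eq)
  then have "0 \<le> ip (?a - ?b) (\<mu> *\<^sub>R ?b - \<tau> *\<^sub>R ?a)"
    using A_monotone[OF tau assms(1,3,3)] by simp
  also have "\<dots> = (\<tau> + \<mu>) * ip ?a ?b - \<tau> * (nrm ?a)\<^sup>2 - \<mu> * (nrm ?b)\<^sup>2"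
    by (simp add: ip_simps nrm_sq ip_commute[of ?b ?a] algebra_simps)
  finally have *: "\<tau> * (nrm ?a)\<^sup>2 + \<mu> * (nrm ?b)\<^sup>2 \<le> (\<tau> + \<mu>) * ip ?a ?b" by simp
  also have "\<dots> \<le> (\<tau> + \<mu>) * (nrm ?a * nrm ?b)"
    using ip_le_nrm assms tau by (intro mult_left_mono) auto
  finally have **: "(\<tau> * nrm ?a - \<mu> * nrm ?b) * (nrm ?a - nrm ?b) \<le> 0"
    by (simp add: power2_eq_square algebra_simps)
  show le: "nrm ?a \<le> nrm ?b"
  proof (rule ccontr)
    assume "\<not> ?thesis"
    then have "nrm ?b < nrm ?a" by simp
    moreover have "\<mu> * nrm ?b < \<tau> * nrm ?a"
      using assms tau \<open>nrm ?b < nrm ?a\<close> by (intro mult_le_less_imp_less) auto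
    ultimately have "0 < (\<tau> * nrm ?a - \<mu> * nrm ?b) * (nrm ?a - nrm ?b)" by simp
    with ** show False by simp
  qed
  have "(nrm (?a - ?b))\<^sup>2 = (nrm ?a)\<^sup>2 + (nrm ?b)\<^sup>2 - 2 * ip ?a ?b"
    by (simp add: nrm_sq ip_simps ip_commute[of ?b ?a])
  then have "(\<tau> + \<mu>) * (nrm (?a - ?b))\<^sup>2 = (\<tau> + \<mu>) * (nrm ?a)\<^sup>2 + (\<tau> + \<mu>) * (nrm ?b)\<^sup>2 - 2 * ((\<tau> + \<mu>) * ip ?a ?b)"
    by (simp only:) (simp add: algebra_simps)
  also have "\<dots> \<le> (\<tau> - \<mu>) * ((nrm ?b)\<^sup>2 - (nrm ?a)\<^sup>2)" using * by (simp add: algebra_simps)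
  also have "\<dots> \<le> (\<tau> + \<mu>) * ((nrm ?b)\<^sup>2 - (nrm ?a)\<^sup>2)"
    using assms le by (intro mult_right_mono) (auto intro: power_mono)
  finally show "(nrm (?a - ?b))\<^sup>2 \<le> (nrm ?b)\<^sup>2 - (nrm ?a)\<^sup>2" using assms tau by simp
qed

section \<open>Speed and differentiability of the limit curve\<close>

text \<open>This is |A\<xi>(s)| of the overview. By \<open>A_xi_le_quotient\<close> and
  \<open>xi_le_speed\<close> it is the best constant in a linear bound for the forward increments
  from \<open>xi s\<close>.\<close>

definition speed :: "real \<Rightarrow> real" where "speed s = (SUP \<tau>\<in>{0<..}. nrm (A \<tau> (xi s)))"

lemma speed_upper: "0 < \<tau> \<Longrightarrow> 0 \<le> s \<Longrightarrow> nrm (A \<tau> (xi s)) \<le> speed s"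
  unfolding speed_def by (rule cSUP_upper) (auto intro!: bdd_aboveI2[where M=M] A_xi_le_M)

lemma speed_least: "(\<And>\<tau>. 0 < \<tau> \<Longrightarrow> nrm (A \<tau> (xi s)) \<le> L) \<Longrightarrow> speed s \<le> L"
  unfolding speed_def by (rule cSUP_least) auto

lemma speed_nonneg: "0 \<le> s \<Longrightarrow> 0 \<le> speed s"
  using order_trans[OF nrm_nonneg speed_upper[of 1 s]] by simp

lemma speed_approx:
  assumes "0 \<le> s" "L < speed s"
  obtains \<tau>0 where "0 < \<tau>0" "\<And>\<tau>. 0 < \<tau> \<Longrightarrow> \<tau> \<le> \<tau>0 \<Longrightarrow> L < nrm (A \<tau> (xi s))"
proof -
  obtain \<tau>0 where t: "0 < \<tau>0" "L < nrm (A \<tau>0 (xi s))"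
    using speed_least[of s L] assms(2) by (meson not_le)
  have "L < nrm (A \<tau> (xi s))" if "0 < \<tau>" "\<tau> \<le> \<tau>0" for \<tau>
    using t(2) A_xi_antimono(1)[OF that xi_in[OF assms(1)]] by linarith
  with t(1) that show thesis by blast
qed

text \<open>While the curve stays within L (r - s) of \<open>xi s\<close>, the energy |xi r - v|^2 /
  2 with v = \<open>R \<tau> (xi s)\<close> grows at rate at most a (\<tau> a + L (r - s)), where a
  = \<open>speed s\<close>. Integrate and let \<tau> tend to 0, so that v tends to
  \<open>xi s\<close>.\<close>

lemma xi_speed_improve:
  assumes s: "0 \<le> s" and L: "\<And>t. s \<le> t \<Longrightarrow> nrm (xi t - xi s) \<le> L * (t - s)"
    and t: "s \<le> t"
  shows "(nrm (xi t - xi s))\<^sup>2 \<le> speed s * L * (t - s)\<^sup>2"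
proof -
  let ?a = "speed s"
  have a0: "0 \<le> ?a" by (rule speed_nonneg[OF s])
  have L0: "0 \<le> L" using order_trans[OF nrm_nonneg L[of "s + 1"]] by simp
  have step: "(nrm (xi t - R \<tau> (xi s)))\<^sup>2 / 2 \<le> (\<tau> * ?a)\<^sup>2 / 2 + (t - s) * ?a * (\<tau> * ?a) + ?a * L * (t - s)\<^sup>2 / 2"
    if lam: "0 < \<tau>" for \<tau>
  proof -
    let ?w = "A \<tau> (xi s)" let ?v = "R \<tau> (xi s)"
    have w: "nrm ?w \<le> ?a" by (rule speed_upper[OF lam s])
    have vs: "nrm (?v - xi s) \<le> \<tau> * ?a"
      using w lam by (simp add: R_eq nrm_scaleR)
    \<comment> \<open>The integrated rate is subtracted, so what remains can grow only by errors of
      second order in q - p.\<close>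
    define \<phi> where "\<phi> r = (nrm (xi r - ?v))\<^sup>2 / 2 - ?a * (\<tau> * ?a) * (r - s) - ?a * L * (r - s)\<^sup>2 / 2" for r
    have "\<phi> t \<le> \<phi> s"
    proof (rule nonincreasing_of_quadratic_bound[OF t, where C = "?a * M"])
      fix p q assume pq: "s \<le> p" "p \<le> q" "q \<le> t"
      have "ip ?w (?v - xi p) \<le> nrm ?w * nrm (?v - xi p)" by (rule ip_le_nrm)
      also have "\<dots> \<le> ?a * (\<tau> * ?a + L * (p - s))"
        using nrm_diff_triangle[of ?v "xi p" "xi s"] L[OF pq(1)] vs nrm_minus_commute[of "xi p" "xi s"]
        by (intro mult_mono w a0 nrm_nonneg) auto
      finally have i: "(q - p) * ip ?w (?v - xi p) \<le> (q - p) * (?a * (\<tau> * ?a + L * (p - s)))"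
        using pq by (intro mult_left_mono) auto
      have ii: "nrm ?w * M * (q - p)\<^sup>2 \<le> ?a * M * (q - p)\<^sup>2"
        using M_nonneg by (intro mult_right_mono w) auto
      have iii: "(nrm (xi q - ?v))\<^sup>2 / 2 - (nrm (xi p - ?v))\<^sup>2 / 2 \<le> (q - p) * (?a * (\<tau> * ?a + L * (p - s))) + ?a * M * (q - p)\<^sup>2"
        using xi_energy[OF lam xi_in[OF s], of p q] i ii pq s by linarith
      have iv: "?a * L * (q - s)\<^sup>2 / 2 - ?a * L * (p - s)\<^sup>2 / 2 = ?a * L * (p - s) * (q - p) + ?a * L * (q - p)\<^sup>2 / 2"
        by (simp add: power2_eq_square field_simps)
      have "0 \<le> ?a * L * (q - p)\<^sup>2" using a0 L0 by simp
      then show "\<phi> q - \<phi> p \<le> ?a * M * (q - p)\<^sup>2"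
        using iii iv unfolding \<phi>_def by (simp add: algebra_simps)
    qed
    moreover have "(nrm (xi s - ?v))\<^sup>2 \<le> (\<tau> * ?a)\<^sup>2"
      using vs by (intro power_mono) (auto simp: nrm_minus_commute)
    ultimately show ?thesis by (simp add: \<phi>_def algebra_simps)
  qed
  define \<tau> where "\<tau> n = inverse (real (Suc n))" for n
  have \<tau>0: "\<tau> \<longlonglongrightarrow> 0" unfolding \<tau>_def by (rule LIMSEQ_inverse_real_of_nat)
  have pos: "0 < \<tau> n" for n by (simp add: \<tau>_def)
  have "(\<lambda>n. nrm (R (\<tau> n) (xi s) - xi s)) \<longlonglongrightarrow> 0"
  proof (rule tendsto_0_bound)
    show "(\<lambda>n. \<tau> n * ?a) \<longlonglongrightarrow> 0" using tendsto_mult_left_zero[OF \<tau>0, of ?a] by simp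
    show "\<bar>nrm (R (\<tau> n) (xi s) - xi s)\<bar> \<le> \<tau> n * ?a" for n
      using speed_upper[OF pos s, of n] pos[of n] by (simp add: R_eq nrm_scaleR)
  qed
  then have 1: "(\<lambda>n. (nrm (xi t - R (\<tau> n) (xi s)))\<^sup>2 / 2) \<longlonglongrightarrow> (nrm (xi t - xi s))\<^sup>2 / 2"
    by (intro tendsto_intros tendsto_nrm tendsto_nrm_diff) auto
  have 2: "(\<lambda>n. (\<tau> n * ?a)\<^sup>2 / 2 + (t - s) * ?a * (\<tau> n * ?a) + ?a * L * (t - s)\<^sup>2 / 2)
     \<longlonglongrightarrow> (0 * ?a)\<^sup>2 / 2 + (t - s) * ?a * (0 * ?a) + ?a * L * (t - s)\<^sup>2 / 2"
    by (intro tendsto_intros \<tau>0) auto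
  show ?thesis using LIMSEQ_le[OF 1 2] step pos by auto
qed

text \<open>The optimal constant $L$ in $\|\xi(t) - \xi(s)\| \le L(t - s)$ satisfies $L^2 \le |A\xi(s)|\,L$ by the
  previous lemma.\<close>

lemma xi_le_speed:
  assumes s: "0 \<le> s" and t: "s \<le> t"
  shows "nrm (xi t - xi s) \<le> speed s * (t - s)"
proof -
  define L where "L = (SUP t\<in>{s<..}. nrm (xi t - xi s) / (t - s))"
  have bdd: "bdd_above ((\<lambda>t. nrm (xi t - xi s) / (t - s)) ` {s<..})"
  proof (rule bdd_aboveI2)
    fix t assume "t \<in> {s<..}"
    then show "nrm (xi t - xi s) / (t - s) \<le> M" using xi_lipschitz[OF s, of t] s by (simp add: pos_divide_le_eq)
  qed
  have L: "nrm (xi t - xi s) \<le> L * (t - s)" if "s \<le> t" for t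
  proof (cases "s = t")
    case False
    then have "nrm (xi t - xi s) / (t - s) \<le> L" unfolding L_def using that by (intro cSUP_upper bdd) auto
    then show ?thesis using False that by (simp add: pos_divide_le_eq)
  qed simp
  have L0: "0 \<le> L" using order_trans[OF nrm_nonneg L[of "s + 1"]] by simp
  have "L \<le> sqrt (speed s * L)"
  proof -
    have "nrm (xi t - xi s) / (t - s) \<le> sqrt (speed s * L)" if "s < t" for t
    proof (rule real_le_rsqrt)
      have "(nrm (xi t - xi s))\<^sup>2 \<le> speed s * L * (t - s)\<^sup>2"
        by (rule xi_speed_improve) (use s L that in auto)
      then show "(nrm (xi t - xi s) / (t - s))\<^sup>2 \<le> speed s * L"
        using that by (simp add: power_divide pos_divide_le_eq)
    qed
    moreover have "{s<..} \<noteq> {}" by simp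
    ultimately show ?thesis by (subst L_def) (intro cSUP_least, auto)
  qed
  then have "L\<^sup>2 \<le> (sqrt (speed s * L))\<^sup>2" using L0 by (intro power_mono)
  then have "L * L \<le> speed s * L" using L0 speed_nonneg[OF s] by (simp add: power2_eq_square)
  then have "L \<le> speed s" using L0 speed_nonneg[OF s]
    by (metis less_eq_real_def mult_right_le_imp_le)
  then have "L * (t - s) \<le> speed s * (t - s)" using t by (intro mult_right_mono) auto
  with L[OF t] show ?thesis by linarith
qed

text \<open>Increments over a fixed length shrink with time, so the bound \<open>speed s\<close> for
  increments from s is inherited at t, and there it dominates all Yosida approximations.\<close>

lemma speed_antimono:
  assumes "0 \<le> s" "s \<le> t" shows "speed t \<le> speed s"
proof (rule speed_least, rule A_xi_le_quotient)
  fix d :: real assume "0 < d"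
  then show "nrm (xi (t + d) - xi t) \<le> speed s * d"
    using xi_shift[OF assms, of d] xi_le_speed[OF assms(1), of "s + d"] by simp
qed (use assms in auto)

text \<open>The norms increase to \<open>speed s\<close> as \<tau> decreases, so
  \<open>A_xi_antimono\<close> bounds the squared distances by a gap of squared norms that tends to
  0.\<close>

lemma A_xi_cauchy:
  assumes s: "0 \<le> s" and e: "0 < e"
  shows "\<exists>\<tau>0>0. \<forall>\<tau> \<mu>. 0 < \<tau> \<and> \<tau> < \<tau>0 \<and> 0 < \<mu> \<and> \<mu> < \<tau>0 \<longrightarrow> nrm (A \<tau> (xi s) - A \<mu> (xi s)) < e"
proof -
  have "\<exists>\<tau>0>0. \<forall>\<tau>. 0 < \<tau> \<and> \<tau> \<le> \<tau>0 \<longrightarrow> (speed s)\<^sup>2 - e\<^sup>2 < (nrm (A \<tau> (xi s)))\<^sup>2"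
  \<comment> \<open>The cases are separated so that the square root below is taken of a nonnegative
    number.\<close>
  proof (cases "(speed s)\<^sup>2 - e\<^sup>2 < 0")
    case True
    then have "(speed s)\<^sup>2 - e\<^sup>2 < x\<^sup>2" for x :: real using zero_le_power2[of x] by linarith
    then show ?thesis by (intro exI[of _ 1]) auto
  next
    case False
    let ?L = "sqrt ((speed s)\<^sup>2 - e\<^sup>2)"
    have "?L < speed s" using False e speed_nonneg[OF s] by (intro real_less_lsqrt) auto
    then obtain \<tau>0 where t: "0 < \<tau>0" "\<And>\<tau>. 0 < \<tau> \<Longrightarrow> \<tau> \<le> \<tau>0 \<Longrightarrow> ?L < nrm (A \<tau> (xi s))"
      using speed_approx[OF s] by blast
    have "(speed s)\<^sup>2 - e\<^sup>2 < (nrm (A \<tau> (xi s)))\<^sup>2" if "0 < \<tau>" "\<tau> \<le> \<tau>0" for \<tau>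
      using power_strict_mono[OF t(2)[OF that], of 2] False by simp
    with t(1) show ?thesis by blast
  qed
  then obtain \<tau>0 where t: "0 < \<tau>0" "\<And>\<tau>. 0 < \<tau> \<Longrightarrow> \<tau> \<le> \<tau>0 \<Longrightarrow> (speed s)\<^sup>2 - e\<^sup>2 < (nrm (A \<tau> (xi s)))\<^sup>2"
    by blast
  have *: "nrm (A \<tau> (xi s) - A \<mu> (xi s)) < e" if "0 < \<mu>" "\<mu> \<le> \<tau>" "\<tau> \<le> \<tau>0" for \<tau> \<mu>
  proof -
    have "(nrm (A \<tau> (xi s) - A \<mu> (xi s)))\<^sup>2 \<le> (nrm (A \<mu> (xi s)))\<^sup>2 - (nrm (A \<tau> (xi s)))\<^sup>2"
      by (intro A_xi_antimono that xi_in s)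
    also have "\<dots> < e\<^sup>2"
      using t(2)[of \<tau>] that power_mono[OF speed_upper[OF that(1) s] nrm_nonneg, of 2] by simp
    finally show ?thesis by (rule power2_less_imp_less) (use e in simp)
  qed
  show ?thesis
  proof (intro exI conjI allI impI)
    fix \<tau> \<mu> assume "0 < \<tau> \<and> \<tau> < \<tau>0 \<and> 0 < \<mu> \<and> \<mu> < \<tau>0"
    then show "nrm (A \<tau> (xi s) - A \<mu> (xi s)) < e"
      using *[of \<mu> \<tau>] *[of \<tau> \<mu>] nrm_minus_commute[of "A \<tau> (xi s)"] by (cases "\<mu> \<le> \<tau>") auto
  qed (rule t)
qed

text \<open>Expand the square. The quotient has norm at most the speed at the earlier of the two
  times, and \<open>A_xi_key\<close>, doubled, bounds the cross term by -2 |w|^2 plus the error, w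
  being \<open>A \<tau> (xi s)\<close>.\<close>

lemma xi_quotient:
  assumes lam: "0 < \<tau>" and s: "0 \<le> s" "0 \<le> t" "s \<noteq> t"
  shows "(nrm ((1 / (t - s)) *\<^sub>R (xi t - xi s) + A \<tau> (xi s)))\<^sup>2
     \<le> (speed (min s t))\<^sup>2 - (nrm (A \<tau> (xi s)))\<^sup>2 + 6 * M\<^sup>2 * \<bar>t - s\<bar> / \<tau>"
proof -
  let ?D = "(1 / (t - s)) *\<^sub>R (xi t - xi s)" let ?w = "A \<tau> (xi s)"
  have "nrm (xi t - xi s) \<le> speed (min s t) * \<bar>t - s\<bar>"
    using xi_le_speed[of s t] xi_le_speed[of t s] s nrm_minus_commute[of "xi t" "xi s"]
    by (cases "s \<le> t") (auto simp: min_def)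
  then have "nrm ?D \<le> speed (min s t)" using s by (simp add: nrm_scaleR pos_divide_le_eq)
  then have "(nrm ?D)\<^sup>2 \<le> (speed (min s t))\<^sup>2" by (rule power_mono) simp
  moreover have "(nrm (?D + ?w))\<^sup>2 = (nrm ?D)\<^sup>2 + 2 * ip ?D ?w + (nrm ?w)\<^sup>2"
    unfolding nrm_sq ip_add_left[of ?D] ip_add_right[of _ ?D] by (simp add: ip_commute[of ?w ?D])
  ultimately show ?thesis using A_xi_key[OF lam s] by simp
qed

text \<open>For fixed \<tau> the bound of \<open>xi_quotient\<close> tends to
  \<open>(speed s)\<^sup>2\<close> minus the squared norm of \<open>A \<tau> (xi s)\<close> as t
  tends to s, and this is small for small \<tau>. Continuity of \<open>speed\<close> handles t < s,
  where the earlier time is t. The error carries a factor 1/\<tau>, hence \<tau> is fixed before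
  t.\<close>

theorem xi_derivative:
  assumes s: "0 < s" and cont: "isCont speed s" and e: "0 < e"
  shows "\<exists>\<tau>0>0. \<forall>\<tau>. 0 < \<tau> \<and> \<tau> < \<tau>0 \<longrightarrow>
    (\<forall>\<^sub>F t in at s within {0..}. nrm ((1 / (t - s)) *\<^sub>R (xi t - xi s) + A \<tau> (xi s)) < e)"
proof -
  have s0: "0 \<le> s" using s by simp
  obtain \<tau>1 where t1: "0 < \<tau>1" "\<And>\<tau>. 0 < \<tau> \<Longrightarrow> \<tau> \<le> \<tau>1 \<Longrightarrow> speed s - min 1 (e\<^sup>2 / (3 * (2 * speed s + 1))) < nrm (A \<tau> (xi s))"
    using speed_approx[OF s0, of "speed s - min 1 (e\<^sup>2 / (3 * (2 * speed s + 1)))"] e speed_nonneg[OF s0] by auto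
  \<comment> \<open>The difference of squares is (speed - n) (speed + n) with second factor at most
    2 speed + 1; the summand 1 keeps the denominator positive when the speed is 0.\<close>
  have gap: "(speed s)\<^sup>2 - (nrm (A \<tau> (xi s)))\<^sup>2 < e\<^sup>2 / 3 + e\<^sup>2 / 3" if "0 < \<tau>" "\<tau> < \<tau>1" for \<tau>
  proof -
    let ?n = "nrm (A \<tau> (xi s))" let ?q = "e\<^sup>2 / (3 * (2 * speed s + 1))"
    have "speed s - ?n \<le> ?q" using t1(2)[of \<tau>] that by auto
    moreover have "0 \<le> speed s - ?n" using speed_upper[OF that(1) s0] by simp
    moreover have "speed s + ?n \<le> 2 * speed s + 1" using speed_upper[OF that(1) s0] by simp
    ultimately have "(speed s - ?n) * (speed s + ?n) \<le> ?q * (2 * speed s + 1)"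
      using speed_nonneg[OF s0] by (intro mult_mono) auto
    also have "\<dots> = e\<^sup>2 / 3" using speed_nonneg[OF s0] by (simp add: field_simps)
    also have "\<dots> < e\<^sup>2 / 3 + e\<^sup>2 / 3" using e by simp
    finally show ?thesis by (simp add: power2_eq_square algebra_simps)
  qed
  have "\<forall>\<^sub>F t in at s within {0..}. nrm ((1 / (t - s)) *\<^sub>R (xi t - xi s) + A \<tau> (xi s)) < e"
    if "0 < \<tau>" "\<tau> < \<tau>1" for \<tau>
  proof -
    have "((\<lambda>t. min s t) \<longlongrightarrow> min s s) (at s)" by (intro tendsto_intros)
    then have "((\<lambda>t. speed (min s t)) \<longlongrightarrow> speed s) (at s)"
      by (intro isCont_tendsto_compose[OF cont]) simp
    then have "((\<lambda>t. (speed (min s t))\<^sup>2 - (nrm (A \<tau> (xi s)))\<^sup>2 + 6 * M\<^sup>2 * \<bar>t - s\<bar> / \<tau>)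
        \<longlongrightarrow> (speed s)\<^sup>2 - (nrm (A \<tau> (xi s)))\<^sup>2 + 6 * M\<^sup>2 * \<bar>s - s\<bar> / \<tau>) (at s)"
      using that by (intro tendsto_intros) auto
    then have "((\<lambda>t. (speed (min s t))\<^sup>2 - (nrm (A \<tau> (xi s)))\<^sup>2 + 6 * M\<^sup>2 * \<bar>t - s\<bar> / \<tau>) \<longlongrightarrow> (speed s)\<^sup>2 - (nrm (A \<tau> (xi s)))\<^sup>2) (at s)"
      by simp
    moreover have "(speed s)\<^sup>2 - (nrm (A \<tau> (xi s)))\<^sup>2 < e\<^sup>2" using gap[OF that] zero_le_power2[of e] by linarith
    ultimately have "\<forall>\<^sub>F t in at s. (speed (min s t))\<^sup>2 - (nrm (A \<tau> (xi s)))\<^sup>2 + 6 * M\<^sup>2 * \<bar>t - s\<bar> / \<tau> < e\<^sup>2"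
      by (rule order_tendstoD)
    then have "\<forall>\<^sub>F t in at s within {0..}. (speed (min s t))\<^sup>2 - (nrm (A \<tau> (xi s)))\<^sup>2 + 6 * M\<^sup>2 * \<bar>t - s\<bar> / \<tau> < e\<^sup>2"
      using at_le[of "{0..}" UNIV s] by (auto simp: le_filter_def)
    moreover have "\<forall>\<^sub>F t in at s within {0..}. 0 \<le> t \<and> t \<noteq> s"
      by (auto simp: eventually_at_filter)
    ultimately show ?thesis
    proof eventually_elim
      case (elim t)
      then have "(nrm ((1 / (t - s)) *\<^sub>R (xi t - xi s) + A \<tau> (xi s)))\<^sup>2 < e\<^sup>2"
        using xi_quotient[OF that(1) s0, of t] by linarith
      then show ?case by (rule power2_less_imp_less) (use e in simp)
    qed
  qed
  with t1(1) show ?thesis by blast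
qed

lemma speed_discontinuities: "countable {s. 0 < s \<and> \<not> isCont speed s}"
proof -
  have "mono_on {0<..} (\<lambda>s. - speed s)"
    by (intro mono_onI) (use speed_antimono in auto)
  then have "countable {s\<in>{0<..}. \<not> isCont (\<lambda>s. - speed s) s}"
    by (intro mono_on_ctble_discont_open) auto
  moreover have "isCont speed s" if "isCont (\<lambda>s. - speed s) s" for s
    using continuous_minus[OF that] by simp
  ultimately show ?thesis by (auto elim!: countable_subset[rotated])
qed


subsection \<open>Ergodic means\<close>

lemma xi_ip_lipschitz:
  assumes "0 \<le> r" "0 \<le> s" shows "\<bar>ip (xi r) y - ip (xi s) y\<bar> \<le> M * nrm y * \<bar>r - s\<bar>"
proof -
  have "\<bar>ip (xi r - xi s) y\<bar> \<le> nrm (xi r - xi s) * nrm y" by (rule abs_ip_le)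
  also have "\<dots> \<le> (M * \<bar>r - s\<bar>) * nrm y" by (intro mult_right_mono xi_lipschitz assms nrm_nonneg)
  finally show ?thesis by (simp add: ip_diff_left algebra_simps)
qed

text \<open>The integral is characterised weakly, by its pairings with all y. Left Riemann averages
  are convex combinations of points of \<open>K\<close>; a cluster point exists in \<open>K\<close>
  by compactness, and \<open>riemann_sum_error\<close> identifies its pairings.\<close>

lemma mean_exists:
  assumes t: "0 < t"
  shows "\<exists>m\<in>K. \<forall>y. ((\<lambda>r. ip (xi r) y) has_integral t * ip m y) {0..t}"
proof -
  define S where "S n = (\<Sum>i<Suc n. (1 / real (Suc n)) *\<^sub>R xi (real i * (t / real (Suc n))))" for n
  have "S n \<in> K" for n
    unfolding S_def
  proof (rule convex_sum)
    show "xi (real i * (t / real (Suc n))) \<in> K" for i using t by (intro xi_in) simp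
  qed (use K_convex in auto)
  then obtain m r where m: "m \<in> K" "strict_mono (r :: nat \<Rightarrow> nat)" "(\<lambda>n. nrm (S (r n) - m)) \<longlonglongrightarrow> 0"
    using K_seq_compact[of S] by blast
  have "((\<lambda>r. ip (xi r) y) has_integral t * ip m y) {0..t}" for y
  proof -
    let ?g = "\<lambda>r. ip (xi r) y"
    have lip: "\<bar>?g r - ?g s\<bar> \<le> M * nrm y * \<bar>r - s\<bar>" if "0 \<le> r" "r \<le> t" "0 \<le> s" "s \<le> t" for r s
      using xi_ip_lipschitz that by blast
    have err: "\<bar>integral {0..t} ?g - t * ip (S n) y\<bar> \<le> M * nrm y * t\<^sup>2 * inverse (real (Suc n))" for n
    proof -
      have "t * ip (S n) y = t / real (Suc n) * (\<Sum>i<Suc n. ?g (real i * (t / real (Suc n))))"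
        unfolding S_def ip_sum_left ip_scaleR_left sum_distrib_left by (intro sum.cong) auto
      then show ?thesis using riemann_sum_error[of t ?g "M * nrm y" "Suc n"] lip t M_nonneg
        by (simp add: divide_inverse del: sum.lessThan_Suc of_nat_Suc)
    qed
    have "(\<lambda>n. M * nrm y * t\<^sup>2 * inverse (real (Suc n))) \<longlonglongrightarrow> 0"
      using tendsto_mult_right_zero[OF LIMSEQ_inverse_real_of_nat] by simp
    then have "(\<lambda>n. integral {0..t} ?g - t * ip (S n) y) \<longlonglongrightarrow> 0" by (rule tendsto_0_bound) (rule err)
    then have "(\<lambda>n. integral {0..t} ?g - t * ip (S (r n)) y) \<longlonglongrightarrow> 0"
      using LIMSEQ_subseq_LIMSEQ[OF _ m(2)] by (fastforce simp: o_def)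
    moreover have "(\<lambda>n. integral {0..t} ?g - t * ip (S (r n)) y) \<longlonglongrightarrow> integral {0..t} ?g - t * ip m y"
      by (intro tendsto_intros tendsto_ip m) simp
    ultimately have "integral {0..t} ?g - t * ip m y = 0" by (rule LIMSEQ_unique[symmetric])
    moreover have "?g integrable_on {0..t}"
      by (rule lipschitz_integrable[OF lip]) auto
    ultimately show ?thesis using integrable_integral by fastforce
  qed
  with m(1) show ?thesis by blast
qed

definition mean :: "real \<Rightarrow> 'a" where
  "mean t = (SOME m. m \<in> K \<and> (\<forall>y. ((\<lambda>r. ip (xi r) y) has_integral t * ip m y) {0..t}))"

lemma mean_in: "0 < t \<Longrightarrow> mean t \<in> K"
  and mean_has_integral: "0 < t \<Longrightarrow> ((\<lambda>r. ip (xi r) y) has_integral t * ip (mean t) y) {0..t}"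
proof -
  assume "0 < t"
  then have "\<exists>m. m \<in> K \<and> (\<forall>y. ((\<lambda>r. ip (xi r) y) has_integral t * ip m y) {0..t})"
    using mean_exists by blast
  from someI_ex[OF this] show "mean t \<in> K" "((\<lambda>r. ip (xi r) y) has_integral t * ip (mean t) y) {0..t}"
    unfolding mean_def by blast+
qed

text \<open>The energy inequality integrated over {0..t} against a fixed graph point. The final
  square is dropped, so the left side does not depend on t.\<close>

lemma mean_energy:
  assumes lam: "0 < \<tau>" and z: "z \<in> K" and t: "0 < t"
  shows "- (nrm (u0 - R \<tau> z))\<^sup>2 / 2 \<le> t * ip (A \<tau> z) (R \<tau> z - mean t)"
proof -
  let ?w = "A \<tau> z" let ?v = "R \<tau> z"
  let ?g = "\<lambda>r. ip (xi r) ?w"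
  define c where "c = ip ?w ?v"
  define G where "G r = integral {0..r} ?g" for r
  have lip: "\<bar>?g r - ?g s\<bar> \<le> M * nrm ?w * \<bar>r - s\<bar>" if "0 \<le> r" "r \<le> t" "0 \<le> s" "s \<le> t" for r s
    using xi_ip_lipschitz that by blast
  define \<phi> where "\<phi> r = (nrm (xi r - ?v))\<^sup>2 / 2 - (c * r - G r)" for r
  have "\<phi> t \<le> \<phi> 0"
  \<comment> \<open>Of the two equal remainders, one comes from \<open>xi_energy\<close> and one
    from freezing the integrand of \<open>G\<close> at p.\<close>
  proof (rule nonincreasing_of_quadratic_bound[where \<phi> = \<phi> and C = "nrm ?w * M + M * nrm ?w"])
    fix p q assume pq: "0 \<le> p" "p \<le> q" "q \<le> t"
    have "G p + integral {p..q} ?g = G q"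
      unfolding G_def by (intro Henstock_Kurzweil_Integration.integral_combine lipschitz_integrable[OF lip]) (use pq in auto)
    moreover have "\<bar>integral {p..q} ?g - (q - p) * ?g p\<bar> \<le> M * nrm ?w * (q - p)\<^sup>2"
      by (rule lipschitz_integral_bound[OF lip]) (use pq M_nonneg in auto)
    moreover have "(q - p) * ip ?w (?v - xi p) = c * (q - p) - (q - p) * ?g p"
      unfolding c_def by (simp add: ip_diff_right ip_commute[of ?w "xi p"] algebra_simps)
    ultimately show "\<phi> q - \<phi> p \<le> (nrm ?w * M + M * nrm ?w) * (q - p)\<^sup>2"
      using xi_energy[OF lam z pq(1,2)] unfolding \<phi>_def by (simp add: algebra_simps abs_le_iff)
  qed (use t in auto)
  moreover have "G t = t * ip (mean t) ?w" unfolding G_def by (rule integral_unique[OF mean_has_integral[OF t]])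
  ultimately have "(nrm (xi t - ?v))\<^sup>2 / 2 \<le> (nrm (u0 - ?v))\<^sup>2 / 2 + t * ip ?w (?v - mean t)"
    unfolding \<phi>_def by (simp add: G_def xi_0 c_def ip_diff_right ip_commute[of ?w "mean t"] algebra_simps)
  then show ?thesis using zero_le_power2[of "nrm (xi t - ?v)"] by linarith
qed

text \<open>The zeros of the operator, expressed through resolvents; for the game they are shown to
  be Nash equilibria.\<close>

definition stationary :: "'a set" where "stationary = {q \<in> K. \<forall>\<tau>>0. R \<tau> q = q}"

text \<open>Take z = \<sigma> in \<open>mean_energy\<close> and divide by the time: in the limit 0
  \<le> (w, R \<tau> \<sigma> - \<sigma>) = -\<tau> |w|^2 with w = \<open>A \<tau> \<sigma>\<close>,
  which forces w = 0.\<close>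

lemma mean_cluster:
  assumes \<sigma>: "\<sigma> \<in> K" and tn: "filterlim tn at_top sequentially" and lim: "(\<lambda>n. nrm (mean (tn n) - \<sigma>)) \<longlonglongrightarrow> 0"
  shows "\<sigma> \<in> stationary"
proof -
  have "R \<tau> \<sigma> = \<sigma>" if lam: "0 < \<tau>" for \<tau>
  proof -
    let ?w = "A \<tau> \<sigma>" let ?v = "R \<tau> \<sigma>"
    have pos: "\<forall>\<^sub>F n in sequentially. 0 < tn n" using tn by (simp add: filterlim_at_top_dense)
    have 1: "(\<lambda>n. (- (nrm (u0 - ?v))\<^sup>2 / 2) * inverse (tn n)) \<longlonglongrightarrow> (- (nrm (u0 - ?v))\<^sup>2 / 2) * 0"
      by (intro tendsto_intros tendsto_inverse_0_at_top tn)
    have 2: "(\<lambda>n. ip ?w (?v - mean (tn n))) \<longlonglongrightarrow> ip ?w (?v - \<sigma>)"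
      by (intro tendsto_ip tendsto_nrm_diff lim) auto
    have "\<forall>\<^sub>F n in sequentially. (- (nrm (u0 - ?v))\<^sup>2 / 2) * inverse (tn n) \<le> ip ?w (?v - mean (tn n))"
      using pos
    proof eventually_elim
      case (elim n)
      then show ?case using mean_energy[OF lam \<sigma> elim] by (simp add: field_simps)
    qed
    then have "0 \<le> ip ?w (?v - \<sigma>)" using tendsto_le[OF _ 2 1] by simp
    moreover have "?v - \<sigma> = - (\<tau> *\<^sub>R ?w)" using lam by (simp add: R_eq)
    ultimately have "\<tau> * ip ?w ?w \<le> 0" by (simp add: ip_minus_right ip_scaleR_right)
    then have "ip ?w ?w = 0" using lam ip_self_nonneg[of ?w] by (metis mult_le_0_iff not_le order_antisym)
    then have "?w = 0" by (rule ip_self_eq_0)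
    then show ?thesis using lam by (simp add: R_eq)
  qed
  with \<sigma> show ?thesis by (auto simp: stationary_def)
qed

text \<open>At a stationary q the graph point is (q, 0), and the right side of
  \<open>xi_energy\<close> vanishes.\<close>

lemma xi_fejer:
  assumes q: "q \<in> stationary" and "0 \<le> s" "s \<le> t"
  shows "nrm (xi t - q) \<le> nrm (xi s - q)"
proof -
  have R: "R 1 q = q" "q \<in> K" "A 1 q = 0" using q by (auto simp: stationary_def A_def)
  have "(nrm (xi t - q))\<^sup>2 \<le> (nrm (xi s - q))\<^sup>2" using xi_energy[of 1 q s t] assms R by simp
  then show ?thesis by (rule power2_le_imp_le) simp
qed

lemma mean_cluster_unique:
  assumes p: "p \<in> stationary" "filterlim sn at_top sequentially" "(\<lambda>n. nrm (mean (sn n) - p)) \<longlonglongrightarrow> 0"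
    and q: "q \<in> stationary" "filterlim tn at_top sequentially" "(\<lambda>n. nrm (mean (tn n) - q)) \<longlonglongrightarrow> 0"
  shows "p = q"
proof -
  let ?y = "p - q"
  obtain a where a: "((\<lambda>t. nrm (xi t - p)) \<longlongrightarrow> a) at_top"
    using antimono_tendsto_at_top[of "\<lambda>t. nrm (xi t - p)"] xi_fejer[OF p(1)] nrm_nonneg by metis
  obtain b where b: "((\<lambda>t. nrm (xi t - q)) \<longlongrightarrow> b) at_top"
    using antimono_tendsto_at_top[of "\<lambda>t. nrm (xi t - q)"] xi_fejer[OF q(1)] nrm_nonneg by metis
  \<comment> \<open>Polarisation: the pairing with p - q is a combination of the two squared
    distances, so it converges as they do. Its limit passes to the means and has to equal both (p, p
    - q) and (q, p - q).\<close>
  have eq: "ip (xi t) ?y = (nrm (xi t - q))\<^sup>2 / 2 - (nrm (xi t - p))\<^sup>2 / 2 + (ip p p - ip q q) / 2" for t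
    by (simp add: nrm_sq ip_simps ip_commute[of p "xi t"] ip_commute[of q "xi t"] field_simps)
  define l where "l = b\<^sup>2 / 2 - a\<^sup>2 / 2 + (ip p p - ip q q) / 2"
  have "((\<lambda>t. ip (xi t) ?y) \<longlongrightarrow> l) at_top"
    unfolding eq l_def by (intro tendsto_intros a b) auto
  then have mean: "((\<lambda>t. ip (mean t) ?y) \<longlongrightarrow> l) at_top"
    by (rule cesaro_at_top) (auto intro: mean_has_integral)
  have "ip p ?y = l"
    by (rule LIMSEQ_unique[OF _ filterlim_compose[OF mean p(2)]]) (intro tendsto_ip p, simp)
  moreover have "ip q ?y = l"
    by (rule LIMSEQ_unique[OF _ filterlim_compose[OF mean q(2)]]) (intro tendsto_ip q, simp)
  ultimately have "ip ?y ?y = 0" by (simp add: ip_diff_left)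
  then have "p - q = 0" by (rule ip_self_eq_0)
  then show ?thesis by simp
qed

theorem mean_converges:
  "\<exists>\<sigma>\<in>stationary. ((\<lambda>t. nrm (mean t - \<sigma>)) \<longlongrightarrow> 0) at_top"
proof -
  have sub: "\<exists>\<sigma>\<in>stationary. \<exists>r::nat\<Rightarrow>nat. strict_mono r \<and> (\<lambda>n. nrm (mean (tn (r n)) - \<sigma>)) \<longlonglongrightarrow> 0 \<and> filterlim (\<lambda>n. tn (r n)) at_top sequentially"
    if tn: "\<And>n. real (Suc n) \<le> tn n" for tn
  proof -
    have pos: "0 < tn n" for n using tn[of n] by (meson of_nat_0_less_iff zero_less_Suc less_le_trans)
    have lim: "filterlim tn at_top sequentially"
      by (rule filterlim_at_top_mono[OF filterlim_real_sequentially]) (use tn in \<open>auto intro!: always_eventually order_trans[OF _ tn]\<close>)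
    obtain \<sigma> r where r: "\<sigma> \<in> K" "strict_mono (r :: nat \<Rightarrow> nat)" "(\<lambda>n. nrm (mean (tn (r n)) - \<sigma>)) \<longlonglongrightarrow> 0"
      using K_seq_compact[of "\<lambda>n. mean (tn n)"] mean_in[OF pos] by blast
    have "filterlim (\<lambda>n. tn (r n)) at_top sequentially"
      by (rule filterlim_compose[OF lim filterlim_subseq[OF r(2)]])
    with mean_cluster[OF r(1) this r(3)] r show ?thesis by blast
  qed
  obtain \<sigma> r where \<sigma>: "\<sigma> \<in> stationary" "filterlim (\<lambda>n. real (Suc (r n))) at_top sequentially"
     "(\<lambda>n. nrm (mean (real (Suc (r n))) - \<sigma>)) \<longlonglongrightarrow> 0"
    using sub[of "\<lambda>n. real (Suc n)"] by auto
  have "((\<lambda>t. nrm (mean t - \<sigma>)) \<longlongrightarrow> 0) at_top"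
  proof (rule ccontr)
    assume "\<not> ?thesis"
    then obtain e where e: "0 < e" "\<not> (\<forall>\<^sub>F t in at_top. dist (nrm (mean t - \<sigma>)) 0 < e)"
      unfolding tendsto_iff by blast
    then have "\<exists>t\<ge>real (Suc n). e \<le> nrm (mean t - \<sigma>)" for n
      unfolding eventually_at_top_linorder by (auto simp: not_less)
    then obtain tn where tn: "\<And>n. real (Suc n) \<le> tn n" "\<And>n. e \<le> nrm (mean (tn n) - \<sigma>)" by metis
    obtain \<sigma>' r' where s': "\<sigma>' \<in> stationary" "filterlim (\<lambda>n. tn (r' n)) at_top sequentially"
      "(\<lambda>n. nrm (mean (tn (r' n)) - \<sigma>')) \<longlonglongrightarrow> 0"
      using sub[OF tn(1)] by blast
    have "\<sigma>' = \<sigma>" by (rule mean_cluster_unique[OF s' \<sigma>])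
    then have "e \<le> 0" using LIMSEQ_le_const[OF s'(3), of e] tn(2) by auto
    with e(1) show False by simp
  qed
  with \<sigma>(1) show ?thesis by blast
qed

end

section \<open>Brouwer's fixed point theorem and Ky Fan's inequality\<close>

lemma tendsto_coordinatewise:
  fixes f :: "'a \<Rightarrow> 'i \<Rightarrow> 'b::topological_space"
  shows "(f \<longlongrightarrow> l) F \<longleftrightarrow> (\<forall>i. ((\<lambda>k. f k i) \<longlongrightarrow> l i) F)"
  using limitin_componentwise[of "\<lambda>_. euclidean" UNIV f l F]
  by (simp add: euclidean_product_topology)

text \<open>Points of the n-cube are sequences that vanish from index n on. Thus n is a term and not
  a type, and compactness comes from the product topology.\<close>

definition unit_cube :: "nat \<Rightarrow> (nat \<Rightarrow> real) set" where
  "unit_cube n = {x. \<forall>i. if i < n then 0 \<le> x i \<and> x i \<le> 1 else x i = 0}"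

lemma compact_unit_cube: "compact (unit_cube n)"
proof -
  have "unit_cube n = PiE UNIV (\<lambda>i. if i < n then {0..1} else {0})"
    by (auto simp: unit_cube_def PiE_def Pi_def extensional_def)
  moreover have "compactin (product_topology (\<lambda>_. euclidean) UNIV) (PiE UNIV (\<lambda>i::nat. if i < n then {0..1} else {0::real}))"
    by (subst compactin_PiE) auto
  ultimately show ?thesis by (simp add: euclidean_product_topology)
qed

text \<open>From Kuhn's combinatorial lemma on the grid of mesh 1/p: in one small cell, for every
  coordinate i, some corner is not moved down in direction i and another is not moved up. As p grows
  the corners merge, and continuity gives a fixed point.\<close>

theorem brouwer_unit_cube:
  fixes T :: "(nat \<Rightarrow> real) \<Rightarrow> nat \<Rightarrow> real"
  assumes cont: "\<And>i. i < n \<Longrightarrow> continuous_on (unit_cube n) (\<lambda>x. T x i)"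
    and range: "\<And>x i. x \<in> unit_cube n \<Longrightarrow> i < n \<Longrightarrow> 0 \<le> T x i \<and> T x i \<le> 1"
  obtains z where "z \<in> unit_cube n" "\<And>i. i < n \<Longrightarrow> T z i = z i"
proof -
  define emb :: "nat \<Rightarrow> (nat \<Rightarrow> nat) \<Rightarrow> nat \<Rightarrow> real"
    where "emb p x = (\<lambda>i. if i < n then real (x i) / real p else 0)" for p x
  have emb_in: "emb p x \<in> unit_cube n" if "0 < p" "\<forall>i<n. x i \<le> p" for p x
    using that by (auto simp: emb_def unit_cube_def)
  have step: "\<exists>z. z \<in> unit_cube n \<and> (\<forall>i<n. \<exists>a b. a \<in> unit_cube n \<and> b \<in> unit_cube n \<and>
      (\<forall>j. \<bar>a j - z j\<bar> \<le> 1 / real p) \<and> (\<forall>j. \<bar>b j - z j\<bar> \<le> 1 / real p) \<and>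
      a i \<le> T a i \<and> T b i \<le> b i)" if p: "0 < p" for p
  proof -
    \<comment> \<open>Label 0 means that T does not decrease coordinate i. Kuhn's lemma prescribes 0
      on the face x i = 0 and 1 on the face x i = p; both agree with this meaning because T maps the
      cube to itself.\<close>
    define label where "label x i = (if x i = 0 \<or> (x i \<noteq> p \<and> emb p x i \<le> T (emb p x) i) then 0 else 1::nat)" for x i
    obtain q where q: "\<forall>i<n. q i < p"
      "\<forall>i<n. \<exists>r s. (\<forall>j<n. q j \<le> r j \<and> r j \<le> q j + 1) \<and> (\<forall>j<n. q j \<le> s j \<and> s j \<le> q j + 1) \<and> label r i \<noteq> label s i"
      by (rule kuhn_lemma[of p n label]) (use p in \<open>auto simp: label_def\<close>)
    have lab: "x i = 0 \<or> emb p x i \<le> T (emb p x) i" if "label x i = 0" for x i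
      using that by (auto simp: label_def split: if_splits)
    have lab0: "emb p x i \<le> T (emb p x) i" if "label x i = 0" "i < n" "\<forall>j<n. x j \<le> p" for x i
      using lab[OF that(1)] range[OF emb_in[OF p that(3)] that(2)] by (auto simp: emb_def)
    have lab1: "T (emb p x) i \<le> emb p x i" if "label x i \<noteq> 0" "i < n" "\<forall>j<n. x j \<le> p" for x i
      using that range[OF emb_in[OF p that(3)] that(2)] p by (auto simp: label_def emb_def split: if_splits)
    have near: "\<bar>emb p r j - emb p q j\<bar> \<le> 1 / real p" if "\<forall>j<n. q j \<le> r j \<and> r j \<le> q j + 1" for r j
    proof (cases "j < n")
      case True
      then have "real (r j) - real (q j) \<le> 1" "0 \<le> real (r j) - real (q j)" using that by (force, force)
      then show ?thesis using p True by (simp add: emb_def flip: diff_divide_distrib) (simp add: divide_right_mono)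
    qed (simp add: emb_def)
    show ?thesis
    proof (rule exI[of _ "emb p q"], intro conjI allI impI)
      show "emb p q \<in> unit_cube n" using q(1) by (intro emb_in p) (auto intro: less_imp_le)
      fix i assume i: "i < n"
      obtain r s where rs: "\<forall>j<n. q j \<le> r j \<and> r j \<le> q j + 1" "\<forall>j<n. q j \<le> s j \<and> s j \<le> q j + 1" "label r i \<noteq> label s i"
        using q(2) i by blast
      have le: "\<forall>j<n. r j \<le> p" "\<forall>j<n. s j \<le> p" using rs q(1) by (metis Suc_eq_plus1 Suc_leI order_trans add_le_mono1)+
      have "label r i = 0 \<and> label s i \<noteq> 0 \<or> label s i = 0 \<and> label r i \<noteq> 0"
        using rs(3) by (auto simp: label_def split: if_splits)
      then obtain a b where "label a i = 0" "label b i \<noteq> 0" "a = r \<and> b = s \<or> a = s \<and> b = r" by blast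
      then have ab: "label a i = 0" "label b i \<noteq> 0" and "\<forall>j<n. a j \<le> p" "\<forall>j<n. b j \<le> p" 
        "\<forall>j<n. q j \<le> a j \<and> a j \<le> q j + 1" "\<forall>j<n. q j \<le> b j \<and> b j \<le> q j + 1" using le rs by blast+
      then have "emb p a \<in> unit_cube n" "emb p b \<in> unit_cube n" "emb p a i \<le> T (emb p a) i" "T (emb p b) i \<le> emb p b i"
        "\<forall>j. \<bar>emb p a j - emb p q j\<bar> \<le> 1 / real p" "\<forall>j. \<bar>emb p b j - emb p q j\<bar> \<le> 1 / real p"
        using emb_in[OF p] lab0[OF ab(1) i] lab1[OF ab(2) i] near by simp_all
      then show "\<exists>a b. a \<in> unit_cube n \<and> b \<in> unit_cube n \<and>
        (\<forall>j. \<bar>a j - emb p q j\<bar> \<le> 1 / real p) \<and> (\<forall>j. \<bar>b j - emb p q j\<bar> \<le> 1 / real p) \<and>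
        a i \<le> T a i \<and> T b i \<le> b i"
        by blast
    qed
  qed
  then have "\<forall>k. \<exists>z. z \<in> unit_cube n \<and> (\<forall>i<n. \<exists>a b. a \<in> unit_cube n \<and> b \<in> unit_cube n \<and>
      (\<forall>j. \<bar>a j - z j\<bar> \<le> 1 / real (Suc k)) \<and> (\<forall>j. \<bar>b j - z j\<bar> \<le> 1 / real (Suc k)) \<and>
      a i \<le> T a i \<and> T b i \<le> b i)" by blast
  then obtain z where z: "\<And>k. z k \<in> unit_cube n" "\<And>k i. i < n \<Longrightarrow> \<exists>a b. a \<in> unit_cube n \<and> b \<in> unit_cube n \<and>
      (\<forall>j. \<bar>a j - z k j\<bar> \<le> 1 / real (Suc k)) \<and> (\<forall>j. \<bar>b j - z k j\<bar> \<le> 1 / real (Suc k)) \<and>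
      a i \<le> T a i \<and> T b i \<le> b i" by metis
  obtain l \<rho> where l: "l \<in> unit_cube n" "strict_mono (\<rho> :: nat \<Rightarrow> nat)" "(z \<circ> \<rho>) \<longlonglongrightarrow> l"
    using compact_imp_seq_compact[OF compact_unit_cube] z(1) unfolding seq_compact_def by blast
  have zl: "(\<lambda>k. z (\<rho> k) j) \<longlonglongrightarrow> l j" for j using l(3) by (simp add: tendsto_coordinatewise o_def)
  have eps: "(\<lambda>k. 1 / real (Suc (\<rho> k))) \<longlonglongrightarrow> 0"
    using LIMSEQ_subseq_LIMSEQ[OF LIMSEQ_inverse_real_of_nat l(2)] by (simp add: o_def inverse_eq_divide)
  have close: "c \<longlonglongrightarrow> l" if "\<And>k j. \<bar>c k j - z (\<rho> k) j\<bar> \<le> 1 / real (Suc (\<rho> k))" for c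
    unfolding tendsto_coordinatewise
  proof
    fix j
    have "(\<lambda>k. c k j - z (\<rho> k) j) \<longlonglongrightarrow> 0"
      by (rule Lim_null_comparison[OF always_eventually eps]) (use that in simp)
    from tendsto_add[OF this zl[of j]] show "(\<lambda>k. c k j) \<longlonglongrightarrow> l j" by simp
  qed
  have "T l i = l i" if i: "i < n" for i
  proof -
    define P where "P k a b \<longleftrightarrow> a \<in> unit_cube n \<and> b \<in> unit_cube n \<and>
      (\<forall>j. \<bar>a j - z (\<rho> k) j\<bar> \<le> 1 / real (Suc (\<rho> k))) \<and> (\<forall>j. \<bar>b j - z (\<rho> k) j\<bar> \<le> 1 / real (Suc (\<rho> k))) \<and>
      a i \<le> T a i \<and> T b i \<le> b i" for k a b
    have "\<forall>k. \<exists>a b. P k a b" using z(2)[OF i] unfolding P_def by blast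
    then obtain a b where "\<And>k. P k (a k) (b k)" by metis
    then have ab: "\<And>k. a k \<in> unit_cube n" "\<And>k. b k \<in> unit_cube n"
      "\<And>k j. \<bar>a k j - z (\<rho> k) j\<bar> \<le> 1 / real (Suc (\<rho> k))" "\<And>k j. \<bar>b k j - z (\<rho> k) j\<bar> \<le> 1 / real (Suc (\<rho> k))"
      "\<And>k. a k i \<le> T (a k) i" "\<And>k. T (b k) i \<le> b k i"
      unfolding P_def by blast+
    have al: "a \<longlonglongrightarrow> l" and bl: "b \<longlonglongrightarrow> l" by (intro close ab)+
    have "(\<lambda>k. T (a k) i) \<longlonglongrightarrow> T l i" "(\<lambda>k. T (b k) i) \<longlonglongrightarrow> T l i"
      by (intro continuous_on_tendsto_compose[OF cont[OF i]] al bl l(1) always_eventually allI ab)+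
    moreover have "(\<lambda>k. a k i) \<longlonglongrightarrow> l i" "(\<lambda>k. b k i) \<longlonglongrightarrow> l i"
      using al bl by (simp_all add: tendsto_coordinatewise)
    ultimately have "l i \<le> T l i" "T l i \<le> l i" using LIMSEQ_le ab(5,6) by blast+
    then show ?thesis by simp
  qed
  with l(1) that show thesis by blast
qed

text \<open>If every p had a \<nu> with \<open>\<Phi> p \<nu> < 0\<close>, finitely many \<nu> would
  serve all of \<open>K\<close>. Weighting them by how negative \<open>\<Phi> p \<nu>\<close> is
  defines a map on their convex hull, and at a fixed point p convexity gives
  \<open>\<Phi> p p < 0\<close>. The topology is an explicit argument because the weak* topology of
  tuples is not the one attached to their type.\<close>

theorem ky_fan:
  fixes X :: "'v::real_vector topology" and \<Phi> :: "'v \<Rightarrow> 'v \<Rightarrow> real"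
  assumes compact: "compactin X K" and convex: "convex K" and nonempty: "K \<noteq> {}"
    and lin: "\<And>n \<nu>. continuous_map euclidean X (\<lambda>\<alpha>::nat \<Rightarrow> real. \<Sum>i<n. \<alpha> i *\<^sub>R \<nu> i)"
    and cont: "\<And>\<nu>. \<nu> \<in> K \<Longrightarrow> continuous_map (subtopology X K) euclideanreal (\<lambda>p. \<Phi> p \<nu>)"
    and conv: "\<And>p. p \<in> K \<Longrightarrow> convex_on K (\<Phi> p)"
    and diag: "\<And>p. p \<in> K \<Longrightarrow> 0 \<le> \<Phi> p p"
  shows "\<exists>p\<in>K. \<forall>\<nu>\<in>K. 0 \<le> \<Phi> p \<nu>"
proof (rule ccontr)
  assume neg: "\<not> ?thesis"
  have KX: "K \<subseteq> topspace X" by (rule compactin_subset_topspace[OF compact])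
  define V where "V \<nu> = {p \<in> K. \<Phi> p \<nu> < 0}" for \<nu>
  have "openin (subtopology X K) (V \<nu>)" if "\<nu> \<in> K" for \<nu>
  proof -
    have "openin (subtopology X K) {p \<in> topspace (subtopology X K). \<Phi> p \<nu> \<in> {..<0}}"
      by (rule openin_continuous_map_preimage[OF cont[OF that]]) simp
    then show ?thesis using KX by (simp add: V_def Int_absorb1 inf.absorb2)
  qed
  moreover have "K \<subseteq> \<Union> (V ` K)" using neg by (force simp: V_def not_le)
  moreover have "compactin (subtopology X K) K" using compact by (simp add: compactin_subtopology)
  ultimately obtain \<F> where "finite \<F>" "\<F> \<subseteq> V ` K" "K \<subseteq> \<Union>\<F>"
    unfolding compactin_def by (metis (no_types, lifting) imageE)
  then obtain N where N: "finite N" "N \<subseteq> K" "K \<subseteq> \<Union> (V ` N)"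
    by (metis finite_subset_image)
  define n where "n = card N"
  obtain \<nu> where "bij_betw \<nu> {0..<n} N" using ex_bij_betw_nat_finite[OF N(1)] n_def by blast
  then have \<nu>N: "\<nu> ` {..<n} = N" by (simp add: bij_betw_def atLeast0LessThan)
  have \<nu>K: "\<nu> i \<in> K" if "i < n" for i using \<nu>N N(2) that by blast
  have n0: "0 < n" using nonempty N \<nu>N by (cases n) auto
  define g where "g i p = max 0 (- \<Phi> p (\<nu> i))" for i p
  have gpos: "0 < (\<Sum>i<n. g i p)" if "p \<in> K" for p
  proof -
    have "p \<in> \<Union> (V ` \<nu> ` {..<n})" using N(3) that \<nu>N by blast
    then obtain i where "i < n" "\<Phi> p (\<nu> i) < 0" by (auto simp: V_def)
    then show ?thesis by (intro sum_pos2[of _ i]) (auto simp: g_def)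
  qed
  \<comment> \<open>Brouwer's theorem is at hand on the cube, while weights live on the simplex.
    \<open>r\<close> sends the cube to the simplex and fixes the simplex: a deficit of the sum is
    spread evenly, an excess is divided out.\<close>
  define r where "r \<alpha> i = (\<alpha> i + max 0 (1 - sum \<alpha> {..<n}) / real n) / max 1 (sum \<alpha> {..<n})" for \<alpha> :: "nat \<Rightarrow> real" and i
  define m where "m \<alpha> = (\<Sum>i<n. r \<alpha> i *\<^sub>R \<nu> i)" for \<alpha>
  have coord: "continuous_on S (\<lambda>\<alpha>::nat \<Rightarrow> real. \<alpha> i)" for S i
    by (rule continuous_on_product_then_coordinatewise) (rule continuous_on_id)
  have rcont: "continuous_on S (\<lambda>\<alpha>. r \<alpha> i)" for S i
  proof -
    have "max 1 (sum \<alpha> {..<n}) \<noteq> 0" for \<alpha> :: "nat \<Rightarrow> real" by (simp add: max_def)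
    then show ?thesis unfolding r_def by (intro continuous_intros coord) (auto simp: n0)
  qed
  have rsum: "sum (r \<alpha>) {..<n} = 1" for \<alpha>
  proof -
    have "sum (r \<alpha>) {..<n} = (sum \<alpha> {..<n} + max 0 (1 - sum \<alpha> {..<n})) / max 1 (sum \<alpha> {..<n})"
      unfolding r_def using n0 by (simp add: sum_divide_distrib[symmetric] sum.distrib)
    also have "sum \<alpha> {..<n} + max 0 (1 - sum \<alpha> {..<n}) = max 1 (sum \<alpha> {..<n})" by (simp add: max_def)
    finally show ?thesis by (simp add: max_def)
  qed
  have rnonneg: "0 \<le> r \<alpha> i" if "\<alpha> \<in> unit_cube n" "i < n" for \<alpha> i
    using that unfolding r_def unit_cube_def by (intro divide_nonneg_nonneg add_nonneg_nonneg) auto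
  have mK: "m \<alpha> \<in> K" if "\<alpha> \<in> unit_cube n" for \<alpha>
    unfolding m_def by (rule convex_sum) (use convex rsum rnonneg \<nu>K that in auto)
  have mcont: "continuous_map (top_of_set (unit_cube n)) (subtopology X K) m"
  proof -
    have "continuous_map (top_of_set (unit_cube n)) euclidean r"
      by (simp add: rcont continuous_on_coordinatewise_then_product)
    from continuous_map_compose[OF this lin[of \<nu> n]] have "continuous_map (top_of_set (unit_cube n)) X m"
      by (simp add: m_def[abs_def] o_def)
    then show ?thesis using mK by (auto simp: continuous_map_in_subtopology)
  qed
  have gcont: "continuous_on (unit_cube n) (\<lambda>\<alpha>. g i (m \<alpha>))" if "i < n" for i
  proof -
    have "continuous_on (unit_cube n) (\<lambda>\<alpha>. \<Phi> (m \<alpha>) (\<nu> i))"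
      using continuous_map_compose[OF mcont cont[OF \<nu>K[OF that]]] by (simp add: o_def)
    then show ?thesis unfolding g_def by (intro continuous_intros)
  qed
  define T where "T \<alpha> i = g i (m \<alpha>) / (\<Sum>i<n. g i (m \<alpha>))" for \<alpha> i
  obtain \<alpha> where \<alpha>: "\<alpha> \<in> unit_cube n" "\<And>i. i < n \<Longrightarrow> T \<alpha> i = \<alpha> i"
  proof (rule brouwer_unit_cube[of n T])
    fix i assume i: "i < n"
    show "continuous_on (unit_cube n) (\<lambda>\<alpha>. T \<alpha> i)"
      unfolding T_def using gpos[OF mK] by (intro continuous_intros gcont i) (auto simp: less_le)
  next
    fix i \<alpha> assume \<alpha>: "\<alpha> \<in> unit_cube n" and i: "i < n"
    have "g i (m \<alpha>) \<le> (\<Sum>i<n. g i (m \<alpha>))" using i by (intro member_le_sum) (auto simp: g_def)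
    then show "0 \<le> T \<alpha> i \<and> T \<alpha> i \<le> 1" using gpos[OF mK[OF \<alpha>]] by (auto simp: T_def g_def)
  qed blast
  define p where "p = m \<alpha>"
  have pK: "p \<in> K" using mK[OF \<alpha>(1)] by (simp add: p_def)
  have \<alpha>g: "\<alpha> i = g i p / (\<Sum>i<n. g i p)" if "i < n" for i using \<alpha>(2)[OF that] by (simp add: T_def p_def)
  have \<alpha>sum: "sum \<alpha> {..<n} = 1"
    using gpos[OF pK] by (simp add: \<alpha>g sum_divide_distrib[symmetric])
  then have "r \<alpha> i = \<alpha> i" for i by (simp add: r_def)
  then have p_eq: "p = (\<Sum>i<n. \<alpha> i *\<^sub>R \<nu> i)" by (simp add: p_def m_def)
  have "\<Phi> p p \<le> (\<Sum>i<n. \<alpha> i * \<Phi> p (\<nu> i))"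
    using convex_on_sum[of "{..<n}" K "\<Phi> p" \<alpha> \<nu>] n0 conv[OF pK] \<alpha>sum \<nu>K \<alpha>(1)
    unfolding p_eq[symmetric] by (auto simp: unit_cube_def lessThan_empty_iff)
  also have "\<dots> < 0"
  proof -
    have "p \<in> \<Union> (V ` \<nu> ` {..<n})" using N(3) pK \<nu>N by blast
    then obtain i where i: "i < n" "\<Phi> p (\<nu> i) < 0" by (auto simp: V_def)
    have "(\<Sum>i<n. \<alpha> i * \<Phi> p (\<nu> i)) < (\<Sum>i<n. 0)"
    proof (rule sum_strict_mono_ex1)
      show "\<forall>i\<in>{..<n}. \<alpha> i * \<Phi> p (\<nu> i) \<le> 0"
        using gpos[OF pK] by (auto simp: \<alpha>g g_def max_def mult_le_0_iff divide_le_0_iff)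
      show "\<exists>i\<in>{..<n}. \<alpha> i * \<Phi> p (\<nu> i) < 0"
      proof
        have "0 < \<alpha> i" using gpos[OF pK] i by (simp add: \<alpha>g) (simp add: g_def divide_neg_pos)
        then show "\<alpha> i * \<Phi> p (\<nu> i) < 0" using i by (intro mult_pos_neg)
      qed (use i in simp)
    qed simp
    then show ?thesis by simp
  qed
  finally show False using diag[OF pK] by simp
qed

section \<open>Norming functionals and the Cramer--Wold theorem\<close>

definition sublinear :: "('a::real_vector \<Rightarrow> real) \<Rightarrow> bool" where
  "sublinear p \<longleftrightarrow> (\<forall>x y. p (x + y) \<le> p x + p y) \<and> (\<forall>r\<ge>0. \<forall>x. p (r *\<^sub>R x) = r * p x)"

lemma sublinear_0: "sublinear p \<Longrightarrow> p 0 = 0"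
  unfolding sublinear_def by (metis mult_zero_left order_refl scaleR_zero_left)

lemma sublinear_minus: "sublinear p \<Longrightarrow> - p (- x) \<le> p x"
  using sublinear_0[of p] unfolding sublinear_def
  by (metis add.commute add.right_inverse minus_le_iff le_minus_iff diff_ge_0_iff_ge diff_minus_eq_add)

text \<open>A minimal sublinear functional coincides with all of its descents, and
  \<open>sublinear_descent p z (- z) \<le> - p z\<close> then makes it linear.\<close>

definition sublinear_descent :: "('a::real_vector \<Rightarrow> real) \<Rightarrow> 'a \<Rightarrow> 'a \<Rightarrow> real" where
  "sublinear_descent p z y = (INF t\<in>{0..}. p (y + t *\<^sub>R z) - t * p z)"

lemma sublinear_descent_bdd:
  assumes "sublinear p" shows "bdd_below ((\<lambda>t. p (y + t *\<^sub>R z) - t * p z) ` {0..})"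
proof (rule bdd_belowI2)
  fix t :: real assume "t \<in> {0..}"
  then have "t * p z = p (t *\<^sub>R z)" using assms by (simp add: sublinear_def)
  also have "\<dots> = p ((y + t *\<^sub>R z) + - y)" by simp
  also have "\<dots> \<le> p (y + t *\<^sub>R z) + p (- y)" using assms unfolding sublinear_def by blast
  finally show "- p (- y) \<le> p (y + t *\<^sub>R z) - t * p z" by simp
qed

lemma sublinear_descent_le:
  assumes "sublinear p" "0 \<le> t" shows "sublinear_descent p z y \<le> p (y + t *\<^sub>R z) - t * p z"
  unfolding sublinear_descent_def by (rule cINF_lower[OF sublinear_descent_bdd]) (use assms in auto)

lemma sublinear_descent_approx:
  assumes "0 < e" obtains t where "0 \<le> t" "p (y + t *\<^sub>R z) - t * p z < sublinear_descent p z y + e"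
proof -
  have "\<exists>a\<in>(\<lambda>t. p (y + t *\<^sub>R z) - t * p z) ` {0..}. a < sublinear_descent p z y + e"
    unfolding sublinear_descent_def by (rule cInf_lessD) (use assms in auto)
  then show thesis using that by auto
qed

lemma sublinear_descent:
  assumes p: "sublinear p" shows "sublinear (sublinear_descent p z)"
  unfolding sublinear_def
proof (intro conjI allI impI)
  let ?q = "sublinear_descent p z"
  show "?q (x + y) \<le> ?q x + ?q y" for x y
  proof (rule field_le_epsilon)
    fix e :: real assume "0 < e"
    then have e: "0 < e / 2" by simp
    obtain s where s: "0 \<le> s" "p (x + s *\<^sub>R z) - s * p z < ?q x + e / 2" by (rule sublinear_descent_approx[OF e])
    obtain t where t: "0 \<le> t" "p (y + t *\<^sub>R z) - t * p z < ?q y + e / 2" by (rule sublinear_descent_approx[OF e])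
    have "?q (x + y) \<le> p ((x + y) + (s + t) *\<^sub>R z) - (s + t) * p z"
      by (rule sublinear_descent_le[OF p]) (use s t in simp)
    also have "(x + y) + (s + t) *\<^sub>R z = (x + s *\<^sub>R z) + (y + t *\<^sub>R z)" by (simp add: scaleR_add_left)
    also have "p \<dots> \<le> p (x + s *\<^sub>R z) + p (y + t *\<^sub>R z)" using p unfolding sublinear_def by blast
    finally show "?q (x + y) \<le> ?q x + ?q y + e" using s t by (simp add: algebra_simps)
  qed
  have le: "?q (r *\<^sub>R x) \<le> r * ?q x" if r: "0 < r" for r x
  proof (rule field_le_epsilon)
    fix e :: real assume "0 < e"
    then have e: "0 < e / r" using r by simp
    obtain s where s: "0 \<le> s" "p (x + s *\<^sub>R z) - s * p z < ?q x + e / r" by (rule sublinear_descent_approx[OF e])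
    have "?q (r *\<^sub>R x) \<le> p (r *\<^sub>R x + (r * s) *\<^sub>R z) - (r * s) * p z"
      by (rule sublinear_descent_le[OF p]) (use r s in simp)
    also have "r *\<^sub>R x + (r * s) *\<^sub>R z = r *\<^sub>R (x + s *\<^sub>R z)" by (simp add: scaleR_add_right)
    also have "p \<dots> = r * p (x + s *\<^sub>R z)" using p r by (simp add: sublinear_def)
    finally have "?q (r *\<^sub>R x) \<le> r * (p (x + s *\<^sub>R z) - s * p z)" by (simp add: algebra_simps)
    also have "\<dots> \<le> r * (?q x + e / r)" using r s by (intro mult_left_mono) auto
    finally show "?q (r *\<^sub>R x) \<le> r * ?q x + e" using r by (simp add: algebra_simps)
  qed
  fix r :: real and x assume "0 \<le> r"
  show "?q (r *\<^sub>R x) = r * ?q x"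
  proof (cases "r = 0")
    case True
    have "p (t *\<^sub>R z) - t * p z = 0" if "0 \<le> t" for t using p that by (simp add: sublinear_def)
    then have "?q 0 = (INF t\<in>{0::real..}. 0)" unfolding sublinear_descent_def by (intro INF_cong) auto
    then show ?thesis using True by simp
  next
    case False
    then have r: "0 < r" using \<open>0 \<le> r\<close> by simp
    have "?q (inverse r *\<^sub>R (r *\<^sub>R x)) \<le> inverse r * ?q (r *\<^sub>R x)" by (rule le) (use r in simp)
    then have "r * ?q x \<le> ?q (r *\<^sub>R x)" using r by (simp add: field_simps)
    with le[OF r] show ?thesis by (simp add: antisym)
  qed
qed

lemma sublinear_descent_neg:
  assumes "sublinear p" shows "sublinear_descent p z (- z) \<le> - p z"
  using sublinear_descent_le[OF assms, of 1 z "- z"] sublinear_0[OF assms] by simp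

lemma sublinear_descent_below:
  assumes "sublinear p" shows "sublinear_descent p z y \<le> p y"
  using sublinear_descent_le[OF assms, of 0 z y] by simp

text \<open>Zorn's lemma for the reversed pointwise order. A nonempty chain is bounded by its
  infimum, which is finite since every member is at least - p0 (- y) at y.\<close>

lemma minimal_sublinear:
  assumes p0: "sublinear p0"
  obtains p where "sublinear p" "\<And>y. p y \<le> p0 y" "\<And>q. sublinear q \<Longrightarrow> (\<And>y. q y \<le> p y) \<Longrightarrow> q = p"
proof -
  define A where "A = {p. sublinear p \<and> (\<forall>y. p y \<le> p0 y)}"
  define P where "P p q \<longleftrightarrow> (\<forall>y. q y \<le> p y)" for p q :: "'a \<Rightarrow> real"
  have "\<exists>m\<in>A. \<forall>a\<in>A. P m a \<longrightarrow> a = m"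
  proof (rule predicate_Zorn)
    show "partial_order_on A (relation_of P A)"
      by (auto simp: partial_order_on_def preorder_on_def refl_on_def trans_def antisym_def relation_of_def P_def
          intro: order_trans antisym intro!: ext)
  next
    fix C assume "C \<in> Chains (relation_of P A)"
    then have C: "C \<subseteq> A" "\<And>p q. p \<in> C \<Longrightarrow> q \<in> C \<Longrightarrow> P p q \<or> P q p"
      by (auto simp: Chains_def relation_of_def)
    show "\<exists>u\<in>A. \<forall>a\<in>C. P a u"
    proof (cases "C = {}")
      case True
      then show ?thesis using p0 by (intro bexI[of _ p0]) (auto simp: A_def)
    next
      case False
      define u where "u y = (INF p\<in>C. p y)" for y
      have sub: "sublinear p" "p y \<le> p0 y" if "p \<in> C" for p y using C(1) that by (auto simp: A_def)
      have bdd: "bdd_below ((\<lambda>p. p y) ` C)" for y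
      proof (rule bdd_belowI2)
        fix p assume "p \<in> C"
        then show "- p0 (- y) \<le> p y" using sub(2)[of p "- y"] sublinear_minus[OF sub(1), of p y] by simp
      qed
      have lower: "u y \<le> p y" if "p \<in> C" for p y unfolding u_def by (rule cINF_lower[OF bdd that])
      have approx: "\<exists>p\<in>C. p y < u y + e" if "0 < e" for y e
        using cInf_lessD[of "(\<lambda>p. p y) ` C" "u y + e"] False that by (auto simp: u_def)
      have "sublinear u" unfolding sublinear_def
      proof (intro conjI allI impI)
        show "u (x + y) \<le> u x + u y" for x y
        proof (rule field_le_epsilon)
          fix e :: real assume "0 < e"
          then obtain p q where pq: "p \<in> C" "p x < u x + e / 2" "q \<in> C" "q y < u y + e / 2"
            using approx[of "e/2" x] approx[of "e/2" y] by auto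
          \<comment> \<open>For subadditivity of the infimum the near-minimisers at x and at y must
            be replaced by one functional; the smaller of the two in the chain serves.\<close>
          obtain r where "r \<in> C" "r x \<le> p x" "r y \<le> q y"
            using C(2)[OF pq(1,3)] pq(1,3) unfolding P_def by blast
          moreover have "r (x + y) \<le> r x + r y" using sub(1)[OF \<open>r \<in> C\<close>] unfolding sublinear_def by blast
          ultimately show "u (x + y) \<le> u x + u y + e" using lower[OF \<open>r \<in> C\<close>, of "x + y"] pq by linarith
        qed
        have le: "u (r *\<^sub>R x) \<le> r * u x" if "0 < r" for r x
        proof (rule field_le_epsilon)
          fix e :: real assume "0 < e"
          then have "0 < e / r" using that by simp
          from approx[OF this, of x] obtain p where p: "p \<in> C" "p x < u x + e / r" by blast
          have "u (r *\<^sub>R x) \<le> r * p x" using lower[OF p(1), of "r *\<^sub>R x"] sub(1)[OF p(1)] that by (simp add: sublinear_def)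
          also have "\<dots> \<le> r * (u x + e / r)" using p that by (intro mult_left_mono) auto
          finally show "u (r *\<^sub>R x) \<le> r * u x + e" using that by (simp add: algebra_simps)
        qed
        fix r :: real and x assume "0 \<le> r"
        show "u (r *\<^sub>R x) = r * u x"
        proof (cases "r = 0")
          case True
          have "u 0 = (INF p\<in>C. 0)" unfolding u_def by (intro INF_cong) (auto simp: sublinear_0 sub)
          then show ?thesis using True False by simp
        next
          case False
          then have r: "0 < r" using \<open>0 \<le> r\<close> by simp
          have "u (inverse r *\<^sub>R (r *\<^sub>R x)) \<le> inverse r * u (r *\<^sub>R x)" by (rule le) (use r in simp)
          then have "r * u x \<le> u (r *\<^sub>R x)" using r by (simp add: field_simps)
          with le[OF r] show ?thesis by (simp add: antisym)
        qed
      qed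
      moreover have "u y \<le> p0 y" for y using False lower sub by (meson all_not_in_conv order_trans)
      ultimately show ?thesis using lower by (intro bexI[of _ u]) (auto simp: A_def P_def)
    qed
  qed
  then obtain m where m: "m \<in> A" "\<And>a. a \<in> A \<Longrightarrow> P m a \<Longrightarrow> a = m" by blast
  show thesis
  proof
    show "sublinear m" "m y \<le> p0 y" for y using m(1) by (auto simp: A_def)
    fix q assume "sublinear q" "\<And>y. q y \<le> m y"
    moreover from this have "q \<in> A" using m(1) by (auto simp: A_def intro: order_trans)
    ultimately show "q = m" using m(2) by (auto simp: P_def)
  qed
qed

text \<open>Minimality makes \<open>p\<close> linear. Starting below the descent of the norm at
  \<open>x\<close>, and not merely below the norm, adds p (- x) \<le> - norm x and so p x = norm
  x.\<close>

theorem norming_functional: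
  fixes x :: "'a::real_normed_vector"
  obtains f :: "'a \<Rightarrow>\<^sub>L real" where "norm f \<le> 1" "f x = norm x"
proof -
  have n: "sublinear (norm :: 'a \<Rightarrow> real)" by (simp add: sublinear_def norm_triangle_ineq)
  obtain p where p: "sublinear p" "\<And>y. p y \<le> sublinear_descent norm x y"
    and min: "\<And>q. sublinear q \<Longrightarrow> (\<And>y. q y \<le> p y) \<Longrightarrow> q = p"
    using minimal_sublinear[OF sublinear_descent[OF n, of x]] by blast
  have le_norm: "p y \<le> norm y" for y using p(2) sublinear_descent_below[OF n] by (rule order_trans)
  have neg: "p (- z) = - p z" for z
  proof -
    have "sublinear_descent p z = p"
      by (rule min) (auto simp: sublinear_descent p sublinear_descent_below)
    then show ?thesis using sublinear_descent_neg[OF p(1), of z] sublinear_minus[OF p(1), of z] by simp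
  qed
  have "bounded_linear p"
  proof (rule bounded_linear_intro[where K = 1])
    fix y z
    have "p y \<le> p (y + z) + p (- z)" using p(1) unfolding sublinear_def by (metis add.assoc add.right_inverse add.right_neutral)
    moreover have "p (y + z) \<le> p y + p z" using p(1) unfolding sublinear_def by blast
    ultimately show "p (y + z) = p y + p z" by (simp add: neg)
  next
    fix r y
    show "p (r *\<^sub>R y) = r *\<^sub>R p y"
    proof (cases "0 \<le> r")
      case False
      then have "p (- (r *\<^sub>R y)) = - r * p y" using p(1)[unfolded sublinear_def, THEN conjunct2, rule_format, of "- r" y] by simp
      then show ?thesis using neg[of "r *\<^sub>R y"] by simp
    qed (use p(1) in \<open>simp add: sublinear_def\<close>)
  next
    fix y show "norm (p y) \<le> norm y * 1" using le_norm[of y] le_norm[of "- y"] neg[of y] by auto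
  qed
  then have app: "blinfun_apply (Blinfun p) = p" by (rule bounded_linear_Blinfun_apply)
  show thesis
  proof
    show "norm (Blinfun p) \<le> 1"
    proof (rule norm_blinfun_bound)
      show "norm (blinfun_apply (Blinfun p) y) \<le> 1 * norm y" for y
        using le_norm[of y] le_norm[of "- y"] neg[of y] by (simp add: app)
    qed simp
    have "p (- x) \<le> - norm x" using p(2)[of "- x"] sublinear_descent_neg[OF n, of x] by linarith
    then show "blinfun_apply (Blinfun p) x = norm x" using le_norm[of x] by (simp add: app neg)
  qed
qed

section \<open>Cylinder sets and uniqueness of Fourier transforms\<close>

text \<open>Functionals are adjoined one at a time, so that the uniqueness proof can go by
  induction. The family is closed under intersection and generates the Borel sets, as Dynkin's
  argument requires.\<close>

inductive_set cylinders :: "'a::real_normed_vector set set" where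
  UNIV: "UNIV \<in> cylinders"
| Int: "S \<in> cylinders \<Longrightarrow> B \<in> sets borel \<Longrightarrow> S \<inter> blinfun_apply (f :: 'a \<Rightarrow>\<^sub>L real) -` B \<in> cylinders"

lemma measurable_blinfun_apply [measurable]:
  "blinfun_apply (f :: 'a::real_normed_vector \<Rightarrow>\<^sub>L real) \<in> borel_measurable borel"
  by (intro borel_measurable_continuous_onI linear_continuous_on blinfun.bounded_linear_right)

lemma cylinders_borel: "S \<in> cylinders \<Longrightarrow> S \<in> sets borel"
proof (induction rule: cylinders.induct)
  case (Int S B f)
  have "blinfun_apply f -` B \<inter> space borel \<in> sets borel"
    by (rule measurable_sets[OF measurable_blinfun_apply Int(2)])
  with Int show ?case by auto
qed simp

lemma Int_stable_cylinders: "Int_stable cylinders"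
proof (rule Int_stableI)
  fix a b :: "'a set" assume "a \<in> cylinders" "b \<in> cylinders"
  from this(2,1) show "a \<inter> b \<in> cylinders"
    by (induction rule: cylinders.induct) (auto simp: Int_assoc[symmetric] intro: cylinders.intros)
qed

text \<open>A closed ball is cut out by the countably many half-spaces that belong to norming
  functionals of a dense set, translated to its centre; an open set is a countable union of closed
  balls with centres in the dense set and rational radii. Separability enters twice.\<close>

lemma sets_borel_eq_cylinders:
  "sets (borel :: 'a::{real_normed_vector, second_countable_topology} measure) = sigma_sets UNIV cylinders"
proof
  show "sigma_sets UNIV cylinders \<subseteq> sets (borel :: 'a measure)"
    using sets.sigma_sets_subset[of cylinders "borel :: 'a measure"] cylinders_borel by auto
  interpret sigma_algebra "UNIV :: 'a set" "sigma_sets UNIV cylinders"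
    by (rule sigma_algebra_sigma_sets) auto
  obtain D :: "'a set" where D: "countable D" "\<And>X. open X \<Longrightarrow> X \<noteq> {} \<Longrightarrow> \<exists>d\<in>D. d \<in> X"
    using countable_dense_exists by blast
  define g :: "'a \<Rightarrow> 'a \<Rightarrow>\<^sub>L real" where "g d = (SOME f. norm f \<le> 1 \<and> blinfun_apply f d = norm d)" for d
  have g: "norm (g d) \<le> 1" "blinfun_apply (g d) d = norm d" for d
  proof -
    have "\<exists>f::'a \<Rightarrow>\<^sub>L real. norm f \<le> 1 \<and> blinfun_apply f d = norm d" using norming_functional[of d] by metis
    from someI_ex[OF this] show "norm (g d) \<le> 1" "blinfun_apply (g d) d = norm d" unfolding g_def by auto
  qed
  have gle: "blinfun_apply (g d) y \<le> norm y" for d y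
  proof -
    have "blinfun_apply (g d) y \<le> norm (g d) * norm y" using norm_blinfun[of "g d" y] by simp
    also have "\<dots> \<le> 1 * norm y" by (intro mult_right_mono g) simp
    finally show ?thesis by simp
  qed
  have cball_eq: "cball c r = (\<Inter>d\<in>D. UNIV \<inter> blinfun_apply (g d) -` {.. r + blinfun_apply (g d) c})" for c r
  proof (intro set_eqI iffI)
    fix y assume "y \<in> cball c r"
    then have "norm (y - c) \<le> r" by (simp add: dist_norm norm_minus_commute)
    then have "blinfun_apply (g d) (y - c) \<le> r" for d using gle[of d "y - c"] by linarith
    then show "y \<in> (\<Inter>d\<in>D. UNIV \<inter> blinfun_apply (g d) -` {.. r + blinfun_apply (g d) c})"
      by (simp add: blinfun.diff_right algebra_simps)
  next
    fix y assume y: "y \<in> (\<Inter>d\<in>D. UNIV \<inter> blinfun_apply (g d) -` {.. r + blinfun_apply (g d) c})"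
    \<comment> \<open>Norming functionals are used only at points d of the dense set; d is chosen
      within e/2 of y - c, and the replacement is paid for twice.\<close>
    have "norm (y - c) \<le> r + e" if e: "0 < e" for e
    proof -
      have "ball (y - c) (e / 2) \<noteq> {}" using e by simp
      then obtain d where d: "d \<in> D" "d \<in> ball (y - c) (e / 2)" using D(2)[OF open_ball] by blast
      have "norm (y - c) \<le> norm d + norm (y - c - d)" by norm
      also have "norm d = blinfun_apply (g d) (y - c) + blinfun_apply (g d) (d - (y - c))"
        by (simp add: g blinfun.diff_right)
      also have "blinfun_apply (g d) (y - c) \<le> r" using y d(1) by (auto simp: blinfun.diff_right)
      also have "blinfun_apply (g d) (d - (y - c)) \<le> norm (d - (y - c))" by (rule gle)
      finally show ?thesis using d(2) by (simp add: dist_norm norm_minus_commute)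
    qed
    then have "norm (y - c) \<le> r" by (rule field_le_epsilon)
    then show "y \<in> cball c r" by (simp add: dist_norm norm_minus_commute)
  qed
  have cball: "cball c r \<in> sigma_sets UNIV cylinders" for c :: 'a and r
    unfolding cball_eq
  proof (rule countable_INT')
    show "D \<noteq> {}" using D(2)[of UNIV] by auto
    have "UNIV \<inter> blinfun_apply (g d) -` {..r + blinfun_apply (g d) c} \<in> sigma_sets UNIV cylinders" for d
      by (intro sigma_sets.Basic cylinders.Int cylinders.UNIV) simp
    then show "(\<lambda>d. UNIV \<inter> blinfun_apply (g d) -` {..r + blinfun_apply (g d) c}) ` D \<subseteq> sigma_sets UNIV cylinders"
      by (rule image_subsetI)
  qed (rule D(1))
  show "sets (borel :: 'a measure) \<subseteq> sigma_sets UNIV cylinders"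
    unfolding borel_def
  proof (subst sets_measure_of, simp, rule sigma_sets_subset, rule subsetI)
    fix U :: "'a set" assume "U \<in> {S. open S}"
    then have U: "open U" by simp
    let ?I = "{(d, r). d \<in> D \<and> r \<in> \<rat> \<and> cball d r \<subseteq> U}"
    have "U = (\<Union>(d, r)\<in>?I. cball d r)"
    proof (intro set_eqI iffI)
      fix y assume "y \<in> U"
      then obtain e where e: "0 < e" "cball y e \<subseteq> U" using U open_contains_cball by blast
      obtain q where q: "q \<in> \<rat>" "e / 3 < q" "q < e / 2" using Rats_dense_in_real[of "e/3" "e/2"] e by auto
      have "ball y (e / 3) \<noteq> {}" using e by simp
      then obtain d where d: "d \<in> D" "d \<in> ball y (e / 3)" using D(2)[OF open_ball] by blast
      have "cball d q \<subseteq> cball y e"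
      proof
        fix w assume "w \<in> cball d q"
        then show "w \<in> cball y e" using d(2) q e dist_triangle[of y w d] by simp
      qed
      then have "(d, q) \<in> ?I" using d q e by auto
      moreover have "y \<in> cball d q" using d(2) q by (simp add: dist_commute)
      ultimately show "y \<in> (\<Union>(d, r)\<in>?I. cball d r)" by blast
    qed auto
    moreover have "countable ?I"
      by (rule countable_subset[of _ "D \<times> \<rat>"]) (auto intro: D(1) countable_rat)
    ultimately show "U \<in> sigma_sets UNIV cylinders"
      using countable_UN'[of ?I "\<lambda>(d, r). cball d r"] cball by (metis (no_types, lifting) case_prod_unfold image_subsetI)
  qed
qed


text \<open>After division by the total mass m of the weight, the pushforwards under
  \<open>f\<close> of the two weighted measures are probability laws with equal characteristic
  functions, and Levy's uniqueness theorem applies.\<close>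

lemma weighted_char_eq:
  fixes M N :: "'a measure" and w f :: "'a \<Rightarrow> real"
  assumes "finite_measure M" "finite_measure N" and sets: "sets N = sets M"
    and w[measurable]: "w \<in> borel_measurable M" and w0: "\<And>x. 0 \<le> w x" and wc: "\<And>x. w x \<le> c"
    and f[measurable]: "f \<in> borel_measurable M"
    and char: "\<And>s::real. (\<integral>x. w x *\<^sub>R iexp (s * f x) \<partial>M) = (\<integral>x. w x *\<^sub>R iexp (s * f x) \<partial>N)"
    and B: "B \<in> sets borel"
  shows "(\<integral>x. w x * indicator B (f x) \<partial>M) = (\<integral>x. w x * indicator B (f x) \<partial>N)"
proof -
  define m where "m = (\<integral>x. w x \<partial>M)"
  have mN: "(\<integral>x. w x \<partial>N) = m"
  proof -
    have "complex_of_real (\<integral>x. w x \<partial>M) = complex_of_real (\<integral>x. w x \<partial>N)"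
      using char[of 0] by (simp add: scaleR_conv_of_real)
    then show ?thesis by (simp add: m_def)
  qed
  have int: "integrable L w" "w \<in> borel_measurable L" "f \<in> borel_measurable L" "finite_measure L" if "L = M \<or> L = N" for L
  proof -
    show fin: "finite_measure L" using that assms by blast
    have sL: "sets L = sets M" using that sets by auto
    show wL: "w \<in> borel_measurable L" "f \<in> borel_measurable L"
      using w f by (simp_all add: measurable_cong_sets[OF sL refl])
    show "integrable L w"
      by (rule finite_measure.integrable_const_bound[OF fin, where B = c]) (use w0 wc wL in auto)
  qed
  show ?thesis
  \<comment> \<open>With mass 0 there is nothing to normalise: the weight vanishes almost everywhere
    and both sides are 0.\<close>
  proof (cases "m = 0")
    case True
    have "(\<integral>x. w x * indicator B (f x) \<partial>L) = 0" if L: "L = M \<or> L = N" for L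
    proof -
      have "(\<integral>x. w x \<partial>L) = 0" using L mN True m_def by auto
      then have "AE x in L. w x = 0"
        using integral_nonneg_eq_0_iff_AE[OF int(1)[OF L]] w0 by auto
      then show ?thesis by (intro integral_eq_zero_AE) auto
    qed
    then show ?thesis by auto
  next
    case False
    have "0 \<le> m" unfolding m_def using w0 by (intro Bochner_Integration.integral_nonneg) auto
    then have m: "0 < m" using False by simp
    define D where "D L = distr (density L (\<lambda>x. w x / m)) borel f" for L
    have D: "real_distribution (D L)" "char (D L) = (\<lambda>s. (1 / m) *\<^sub>R (\<integral>x. w x *\<^sub>R iexp (s * f x) \<partial>L))"
      "measure (D L) B = (1 / m) * (\<integral>x. w x * indicator B (f x) \<partial>L)"
      if L: "L = M \<or> L = N" for L
    proof -
      note [measurable] = int(2,3)[OF L]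
      have mL: "(\<integral>x. w x \<partial>L) = m" using L mN m_def by auto
      have "prob_space (density L (\<lambda>x. w x / m))"
      proof (rule prob_spaceI)
        have "emeasure (density L (\<lambda>x. w x / m)) (space (density L (\<lambda>x. w x / m))) = (\<integral>\<^sup>+x. ennreal (w x / m) \<partial>L)"
          by (simp add: emeasure_density)
        also have "\<dots> = ennreal (\<integral>x. w x / m \<partial>L)"
          using int(1)[OF L] w0 m by (intro nn_integral_eq_integral) auto
        also have "(\<integral>x. w x / m \<partial>L) = 1" using mL m by simp
        finally show "emeasure (density L (\<lambda>x. w x / m)) (space (density L (\<lambda>x. w x / m))) = 1" by simp
      qed
      then interpret P: prob_space "density L (\<lambda>x. w x / m)" .
      have fm: "f \<in> borel_measurable (density L (\<lambda>x. w x / m))" by simp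
      show rd: "real_distribution (D L)"
        unfolding D_def real_distribution_def real_distribution_axioms_def using P.prob_space_distr[OF fm] by simp
      show "char (D L) = (\<lambda>s. (1 / m) *\<^sub>R (\<integral>x. w x *\<^sub>R iexp (s * f x) \<partial>L))"
      proof
        fix s
        have "char (D L) s = (\<integral>x. iexp (s * f x) \<partial>density L (\<lambda>x. w x / m))"
          unfolding char_def D_def by (subst integral_distr) auto
        also have "\<dots> = (\<integral>x. (w x / m) *\<^sub>R iexp (s * f x) \<partial>L)"
          using w0 m by (subst integral_density) auto
        also have "\<dots> = (\<integral>x. (1 / m) *\<^sub>R (w x *\<^sub>R iexp (s * f x)) \<partial>L)" by simp
        also have "\<dots> = (1 / m) *\<^sub>R (\<integral>x. w x *\<^sub>R iexp (s * f x) \<partial>L)" by (rule integral_scaleR_right)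
        finally show "char (D L) s = \<dots>" .
      qed
      interpret R: real_distribution "D L" by (rule rd)
      have "measure (D L) B = (\<integral>x. indicator B x \<partial>D L)" using B by simp
      also have "\<dots> = (\<integral>x. indicator B (f x) \<partial>density L (\<lambda>x. w x / m))"
        unfolding D_def using B by (subst integral_distr) auto
      also have "\<dots> = (\<integral>x. (w x / m) *\<^sub>R indicator B (f x) \<partial>L)"
        using w0 m B by (subst integral_density) auto
      also have "\<dots> = (\<integral>x. (1 / m) * (w x * indicator B (f x)) \<partial>L)" by simp
      also have "\<dots> = (1 / m) * (\<integral>x. w x * indicator B (f x) \<partial>L)" by (rule integral_mult_right_zero)
      finally show "measure (D L) B = (1 / m) * (\<integral>x. w x * indicator B (f x) \<partial>L)" .
    qed
    have "D M = D N" by (rule Levy_uniqueness) (use D char in auto)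
    then have "(1 / m) * (\<integral>x. w x * indicator B (f x) \<partial>M) = (1 / m) * (\<integral>x. w x * indicator B (f x) \<partial>N)"
      by (simp only: D(3)[OF disjI1[OF refl], symmetric] D(3)[OF disjI2[OF refl], symmetric] \<open>D M = D N\<close>)
    then show ?thesis using m by simp
  qed
qed

text \<open>The conditions defining a cylinder are adjoined one at a time: $1 + \cos f$ and $1 + \sin f$ are
  nonnegative, so Levy's uniqueness theorem applies to the correspondingly weighted measures.\<close>

lemma cylinder_char_eq:
  fixes M N :: "'a::{real_normed_vector, second_countable_topology} measure"
  assumes "finite_measure M" "finite_measure N" and sM: "sets M = sets borel" and sN: "sets N = sets borel"
    and char: "\<And>f :: 'a \<Rightarrow>\<^sub>L real. (\<integral>x. iexp (f x) \<partial>M) = (\<integral>x. iexp (f x) \<partial>N)"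
    and S: "S \<in> cylinders"
  shows "(\<integral>x. indicat_real S x *\<^sub>R iexp (blinfun_apply f x) \<partial>M) = (\<integral>x. indicat_real S x *\<^sub>R iexp (blinfun_apply f x) \<partial>N)"
  using S
proof (induction arbitrary: f rule: cylinders.induct)
  case UNIV
  then show ?case using char[of f] by simp
next
  case (Int S B g)
  have Sb[measurable]: "S \<in> sets borel" by (rule cylinders_borel[OF Int(1)])
  have sets: "sets N = sets M" using sM sN by simp
  have meas: "borel_measurable L = borel_measurable borel" "finite_measure L" "sets L = sets borel"
    if "L = M \<or> L = N" for L :: "'a measure"
    using that assms by (auto intro: measurable_cong_sets)
  have int: "integrable L (\<lambda>x. indicat_real S x *\<^sub>R iexp (blinfun_apply h x))" if "L = M \<or> L = N" for L h
    by (rule finite_measure.integrable_const_bound[OF meas(2)[OF that], where B = 1])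
       (auto simp: meas[OF that] indicator_def)
  \<comment> \<open>\<open>a\<close> will be 0, cos f or sin f. Each is a combination of
    exponentials of f and -f, so a factor with the exponential of s g leaves exponentials of s g, s
    g + f and s g - f, to which the induction hypothesis applies.\<close>
  have weighted: "(\<integral>x. (indicat_real S x * (1 + a x)) * indicator B (blinfun_apply g x) \<partial>M)
     = (\<integral>x. (indicat_real S x * (1 + a x)) * indicator B (blinfun_apply g x) \<partial>N)"
    if a[measurable]: "a \<in> borel_measurable borel" and abs: "\<And>x. \<bar>a x\<bar> \<le> 1"
      and lin: "\<And>x. complex_of_real (a x) = z * iexp (blinfun_apply f x) + z' * iexp (- blinfun_apply f x)" for a z z'
  proof (rule weighted_char_eq[where c = 2])
    show "(\<lambda>x. indicat_real S x * (1 + a x)) \<in> borel_measurable M" by (simp add: meas)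
    show "blinfun_apply g \<in> borel_measurable M" by (simp add: meas)
    show "0 \<le> indicat_real S x * (1 + a x)" for x using abs[of x] by (auto simp: indicator_def abs_le_iff)
    show "indicat_real S x * (1 + a x) \<le> 2" for x using abs[of x] by (auto simp: indicator_def abs_le_iff)
    fix s :: real
    have eq: "(indicat_real S x * (1 + a x)) *\<^sub>R iexp (s * blinfun_apply g x) =
      indicat_real S x *\<^sub>R iexp (blinfun_apply (s *\<^sub>R g) x)
      + z * (indicat_real S x *\<^sub>R iexp (blinfun_apply (s *\<^sub>R g + f) x))
      + z' * (indicat_real S x *\<^sub>R iexp (blinfun_apply (s *\<^sub>R g - f) x))" for x
      using lin[of x]
      by (simp add: scaleR_conv_of_real blinfun.add_left blinfun.diff_left blinfun.scaleR_left exp_add distrib_left right_diff_distrib algebra_simps exp_diff exp_minus divide_inverse)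
    have I: "(\<integral>x. (indicat_real S x * (1 + a x)) *\<^sub>R iexp (s * blinfun_apply g x) \<partial>L) =
      (\<integral>x. indicat_real S x *\<^sub>R iexp (blinfun_apply (s *\<^sub>R g) x) \<partial>L)
      + z * (\<integral>x. indicat_real S x *\<^sub>R iexp (blinfun_apply (s *\<^sub>R g + f) x) \<partial>L)
      + z' * (\<integral>x. indicat_real S x *\<^sub>R iexp (blinfun_apply (s *\<^sub>R g - f) x) \<partial>L)" if "L = M \<or> L = N" for L
    proof -
      note i = int[OF that, of "s *\<^sub>R g"] int[OF that, of "s *\<^sub>R g + f"] int[OF that, of "s *\<^sub>R g - f"]
      have "has_bochner_integral L (\<lambda>x. (indicat_real S x * (1 + a x)) *\<^sub>R iexp (s * blinfun_apply g x))
        ((\<integral>x. indicat_real S x *\<^sub>R iexp (blinfun_apply (s *\<^sub>R g) x) \<partial>L)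
      + z * (\<integral>x. indicat_real S x *\<^sub>R iexp (blinfun_apply (s *\<^sub>R g + f) x) \<partial>L)
      + z' * (\<integral>x. indicat_real S x *\<^sub>R iexp (blinfun_apply (s *\<^sub>R g - f) x) \<partial>L))"
        unfolding eq
        by (intro has_bochner_integral_add has_bochner_integral_mult_right has_bochner_integral_integrable i)
      then show ?thesis by (rule has_bochner_integral_integral_eq)
    qed
    show "(\<integral>x. (indicat_real S x * (1 + a x)) *\<^sub>R iexp (s * blinfun_apply g x) \<partial>M)
      = (\<integral>x. (indicat_real S x * (1 + a x)) *\<^sub>R iexp (s * blinfun_apply g x) \<partial>N)"
      by (simp only: I simp_thms Int.IH)
  qed (use assms sets Int in auto)
  let ?S = "S \<inter> blinfun_apply g -` B"
  have [measurable]: "?S \<in> sets borel" by (intro cylinders_borel cylinders.Int Int)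
  have intS: "integrable L (\<lambda>x. indicat_real ?S x * a x)"
    if L: "L = M \<or> L = N" and [measurable]: "a \<in> borel_measurable borel" and abs: "\<And>x. \<bar>a x\<bar> \<le> 1" for L a
  proof (rule finite_measure.integrable_const_bound[OF meas(2)[OF L], where B = 1])
    show "(\<lambda>x. indicat_real ?S x * a x) \<in> borel_measurable L" unfolding meas(1)[OF L] by measurable
  qed (use abs in \<open>auto simp: indicator_def\<close>)
  \<comment> \<open>The case \<open>a = 0\<close> of \<open>weighted\<close> is subtracted to remove
    the 1 that made the weight nonnegative.\<close>
  have real: "(\<integral>x. indicat_real ?S x * a x \<partial>M) = (\<integral>x. indicat_real ?S x * a x \<partial>N)"
    if a[measurable]: "a \<in> borel_measurable borel" and abs: "\<And>x. \<bar>a x\<bar> \<le> 1"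
      and lin: "\<And>x. complex_of_real (a x) = z * iexp (blinfun_apply f x) + z' * iexp (- blinfun_apply f x)" for a z z'
  proof -
    have I: "(\<integral>x. (indicat_real S x * (1 + a x)) * indicator B (blinfun_apply g x) \<partial>L)
      = (\<integral>x. (indicat_real S x * (1 + 0)) * indicator B (blinfun_apply g x) \<partial>L) + (\<integral>x. indicat_real ?S x * a x \<partial>L)"
      if L: "L = M \<or> L = N" for L
    proof -
      have "(\<integral>x. (indicat_real S x * (1 + a x)) * indicator B (blinfun_apply g x) \<partial>L)
        = (\<integral>x. indicat_real ?S x + indicat_real ?S x * a x \<partial>L)"
        by (intro Bochner_Integration.integral_cong) (auto simp: indicator_def)
      also have "\<dots> = (\<integral>x. indicat_real ?S x \<partial>L) + (\<integral>x. indicat_real ?S x * a x \<partial>L)"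
      proof (rule Bochner_Integration.integral_add)
        show "integrable L (indicat_real ?S)"
          by (rule finite_measure.integrable_const_bound[OF meas(2)[OF L], where B = 1]) (auto simp: meas[OF L] indicator_def)
        show "integrable L (\<lambda>x. indicat_real ?S x * a x)" by (rule intS[OF L a abs])
      qed
      also have "(\<integral>x. indicat_real ?S x \<partial>L) = (\<integral>x. (indicat_real S x * (1 + 0)) * indicator B (blinfun_apply g x) \<partial>L)"
        by (intro Bochner_Integration.integral_cong) (auto simp: indicator_def)
      finally show ?thesis .
    qed
    have "(\<integral>x. (indicat_real S x * (1 + 0)) * indicator B (blinfun_apply g x) \<partial>M)
     = (\<integral>x. (indicat_real S x * (1 + 0)) * indicator B (blinfun_apply g x) \<partial>N)"
      using weighted[of "\<lambda>_. 0" 0 0] by simp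
    then show ?thesis using weighted[OF a abs lin] I[of M] I[of N] by simp
  qed
  have c: "(\<integral>x. indicat_real ?S x * cos (blinfun_apply f x) \<partial>M) = (\<integral>x. indicat_real ?S x * cos (blinfun_apply f x) \<partial>N)"
    by (rule real[of "\<lambda>x. cos (blinfun_apply f x)" "1/2" "1/2"]) (auto simp: cos_of_real[symmetric] cos_exp_eq field_simps)
  have s: "(\<integral>x. indicat_real ?S x * sin (blinfun_apply f x) \<partial>M) = (\<integral>x. indicat_real ?S x * sin (blinfun_apply f x) \<partial>N)"
    by (rule real[of "\<lambda>x. sin (blinfun_apply f x)" "- \<i> / 2" "\<i> / 2"]) (auto simp: sin_of_real[symmetric] sin_exp_eq field_simps)
  have split: "(\<integral>x. indicat_real ?S x *\<^sub>R iexp (blinfun_apply f x) \<partial>L) =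
    complex_of_real (\<integral>x. indicat_real ?S x * cos (blinfun_apply f x) \<partial>L) + \<i> * complex_of_real (\<integral>x. indicat_real ?S x * sin (blinfun_apply f x) \<partial>L)"
    if L: "L = M \<or> L = N" for L
  proof -
    have "has_bochner_integral L (\<lambda>x. complex_of_real (indicat_real ?S x * cos (blinfun_apply f x)) + \<i> * complex_of_real (indicat_real ?S x * sin (blinfun_apply f x)))
      (complex_of_real (\<integral>x. indicat_real ?S x * cos (blinfun_apply f x) \<partial>L) + \<i> * complex_of_real (\<integral>x. indicat_real ?S x * sin (blinfun_apply f x) \<partial>L))"
      by (intro has_bochner_integral_add has_bochner_integral_mult_right has_bochner_integral_of_real has_bochner_integral_integrable
          intS L) auto
    then show ?thesis
      by (subst (asm) has_bochner_integral_iff) (simp add: scaleR_conv_of_real cis_conv_exp[symmetric] cis.ctr complex_eq_iff[symmetric] exp_Euler cos_of_real sin_of_real algebra_simps)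
  qed
  show ?case by (simp only: split simp_thms c s)
qed

theorem cramer_wold:
  fixes M N :: "'a::{real_normed_vector, second_countable_topology} measure"
  assumes fin: "finite_measure M" "finite_measure N" and sM: "sets M = sets borel" and sN: "sets N = sets borel"
    and char: "\<And>f :: 'a \<Rightarrow>\<^sub>L real. (\<integral>x. iexp (f x) \<partial>M) = (\<integral>x. iexp (f x) \<partial>N)"
  shows "M = N"
proof (rule measure_eqI_generator_eq[where E = cylinders and \<Omega> = UNIV and A = "\<lambda>_. UNIV"])
  interpret M: finite_measure M by (rule fin)
  interpret N: finite_measure N by (rule fin)
  show "emeasure M S = emeasure N S" if "S \<in> cylinders" for S
  proof -
    have S: "S \<in> sets M" "S \<in> sets N" using cylinders_borel[OF that] sM sN by auto
    have "complex_of_real (\<integral>x. indicat_real S x \<partial>M) = complex_of_real (\<integral>x. indicat_real S x \<partial>N)"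
      using cylinder_char_eq[OF assms that, of 0] by (simp add: scaleR_conv_of_real)
    then have "measure M S = measure N S" using S by simp
    then show ?thesis by (simp add: M.emeasure_eq_measure N.emeasure_eq_measure)
  qed
  show "emeasure M UNIV \<noteq> \<infinity>" by simp
qed (auto simp: Int_stable_cylinders sM sN sets_borel_eq_cylinders intro: cylinders.UNIV)

section \<open>Gaussian measures\<close>

locale gaussian_measure =
  fixes \<eta> :: "'a::{banach, second_countable_topology} measure"
  assumes gaussian: "centered_nondegenerate_gaussian \<eta>"
begin

sublocale prob_space \<eta>
  using gaussian by (simp add: centered_nondegenerate_gaussian_def)

lemma sets_eq [simp, measurable_cong]: "sets \<eta> = sets borel"
  using gaussian by (simp add: centered_nondegenerate_gaussian_def)

lemma space_eq [simp]: "space \<eta> = UNIV"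
  using sets_eq_imp_space_eq[OF sets_eq] by simp

lemma prob_UNIV [simp]: "prob UNIV = 1"
  using prob_space by simp

lemma functional_distributed:
  fixes f :: "'a \<Rightarrow>\<^sub>L real"
  assumes "f \<noteq> 0"
  obtains \<sigma> where "0 < \<sigma>" "distributed \<eta> lborel (blinfun_apply f) (normal_density 0 \<sigma>)"
  using gaussian assms unfolding centered_nondegenerate_gaussian_def by blast

text \<open>Stated through the second moment and not through \<sigma>, so that \<open>f = 0\<close>,
  which has no density, is included.\<close>

lemma functional_moments:
  fixes f :: "'a \<Rightarrow>\<^sub>L real"
  shows functional_integrable_sq: "integrable \<eta> (\<lambda>x. (f x)\<^sup>2)"
    and functional_second_moment_pos: "f \<noteq> 0 \<Longrightarrow> 0 < (\<integral>x. (f x)\<^sup>2 \<partial>\<eta>)"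
    and functional_char: "(\<integral>x. iexp (f x) \<partial>\<eta>) = complex_of_real (exp (- (\<integral>x. (f x)\<^sup>2 \<partial>\<eta>) / 2))"
proof -
  have *: "integrable \<eta> (\<lambda>x. (f x)\<^sup>2) \<and> (f \<noteq> 0 \<longrightarrow> 0 < (\<integral>x. (f x)\<^sup>2 \<partial>\<eta>)) \<and>
     (\<integral>x. iexp (f x) \<partial>\<eta>) = complex_of_real (exp (- (\<integral>x. (f x)\<^sup>2 \<partial>\<eta>) / 2))"
  proof (cases "f = 0")
    case True
    then show ?thesis by simp
  next
    case False
    obtain \<sigma> where s: "0 < \<sigma>" and D: "distributed \<eta> lborel (blinfun_apply f) (normal_density 0 \<sigma>)"
      by (rule functional_distributed[OF False])
    have int: "integrable \<eta> (\<lambda>x. (f x)\<^sup>2)"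
      using distributed_integrable[OF D, of "\<lambda>x. x\<^sup>2"] integrable_normal_moment[OF s, of 0 2] by simp
    have "(\<integral>x. (f x)\<^sup>2 \<partial>\<eta>) = (\<integral>x. normal_density 0 \<sigma> x * (x - 0)^(2 * 1) \<partial>lborel)"
      using distributed_integral[OF D, of "\<lambda>x. x\<^sup>2"] by simp
    also have "\<dots> = \<sigma>\<^sup>2"
      using integral_normal_moment_even[OF s, of 0 1] by (simp add: fact_numeral)
    finally have v: "(\<integral>x. (f x)\<^sup>2 \<partial>\<eta>) = \<sigma>\<^sup>2" .
    have "distributed \<eta> lborel (\<lambda>x. f x / \<sigma>) std_normal_density"
      using D normal_standard_normal_convert[OF s, of "blinfun_apply f" 0] by simp
    then have d: "distr \<eta> borel (\<lambda>x. f x / \<sigma>) = std_normal_distribution"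
      using distributed_distr_eq_density[of \<eta> lborel] distr_cong[OF refl, of borel lborel] by (metis sets_lborel)
    have "char std_normal_distribution \<sigma> = (\<integral>x. iexp (f x) \<partial>\<eta>)"
      unfolding d[symmetric] char_def using s by (subst integral_distr) auto
    then have "(\<integral>x. iexp (f x) \<partial>\<eta>) = complex_of_real (exp (- \<sigma>\<^sup>2 / 2))"
      by (simp add: char_std_normal_distribution)
    with int v s show ?thesis by simp
  qed
  then show "integrable \<eta> (\<lambda>x. (f x)\<^sup>2)" "f \<noteq> 0 \<Longrightarrow> 0 < (\<integral>x. (f x)\<^sup>2 \<partial>\<eta>)"
    "(\<integral>x. iexp (f x) \<partial>\<eta>) = complex_of_real (exp (- (\<integral>x. (f x)\<^sup>2 \<partial>\<eta>) / 2))" by blast+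
qed

lemma pair_char:
  fixes f g :: "'a \<Rightarrow>\<^sub>L real"
  shows "(\<integral>z. iexp (f (fst z) + g (snd z)) \<partial>(\<eta> \<Otimes>\<^sub>M \<eta>))
    = complex_of_real (exp (- ((\<integral>x. (f x)\<^sup>2 \<partial>\<eta>) + (\<integral>x. (g x)\<^sup>2 \<partial>\<eta>)) / 2))"
proof -
  interpret P: pair_prob_space \<eta> \<eta> ..
  have "integrable (\<eta> \<Otimes>\<^sub>M \<eta>) (\<lambda>z. iexp (f (fst z) + g (snd z)))"
    by (rule P.integrable_const_bound[where B = 1]) auto
  from P.integral_fst'[OF this]
  have "(\<integral>z. iexp (f (fst z) + g (snd z)) \<partial>(\<eta> \<Otimes>\<^sub>M \<eta>)) = (\<integral>x. (\<integral>y. iexp (f x + g y) \<partial>\<eta>) \<partial>\<eta>)" by simp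
  also have "\<dots> = (\<integral>x. iexp (f x) * (\<integral>y. iexp (g y) \<partial>\<eta>) \<partial>\<eta>)"
    by (simp add: distrib_left exp_add)
  also have "\<dots> = (\<integral>x. iexp (f x) \<partial>\<eta>) * (\<integral>y. iexp (g y) \<partial>\<eta>)" by simp
  also have "\<dots> = complex_of_real (exp (- ((\<integral>x. (f x)\<^sup>2 \<partial>\<eta>) + (\<integral>x. (g x)\<^sup>2 \<partial>\<eta>)) / 2))"
    unfolding functional_char of_real_mult[symmetric] exp_add[symmetric] by (simp add: field_simps)
  finally show ?thesis .
qed

text \<open>Rotation of X x X by 45 degrees.\<close>

definition rotation :: "'a \<times> 'a \<Rightarrow> 'a \<times> 'a" where
  "rotation z = ((1 / sqrt 2) *\<^sub>R (fst z - snd z), (1 / sqrt 2) *\<^sub>R (fst z + snd z))"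

lemma sets_pair [simp]: "sets (\<eta> \<Otimes>\<^sub>M \<eta>) = sets borel"
proof -
  have "sets (\<eta> \<Otimes>\<^sub>M \<eta>) = sets (borel \<Otimes>\<^sub>M borel)" by (rule sets_pair_measure_cong[OF sets_eq sets_eq])
  also have "\<dots> = sets borel" by (simp only: borel_prod)
  finally show ?thesis .
qed

lemma rotation_measurable [measurable]: "rotation \<in> borel_measurable (\<eta> \<Otimes>\<^sub>M \<eta>)"
proof -
  have "rotation \<in> borel_measurable borel"
    unfolding rotation_def by (intro borel_measurable_continuous_onI continuous_intros)
  then show ?thesis by (simp add: measurable_cong_sets[OF sets_pair refl])
qed

text \<open>The Fourier transform of \<open>\<eta> \<Otimes>\<^sub>M \<eta>\<close> at (f, g)
  depends only on the sum of the second moments of f and g. The rotation acts on the pair (f, g) by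
  its transpose, which preserves the function f^2 + g^2 on X. Cramer-Wold then identifies the
  measures.\<close>

lemma rotation_invariance: "distr (\<eta> \<Otimes>\<^sub>M \<eta>) borel rotation = \<eta> \<Otimes>\<^sub>M \<eta>"
proof (rule cramer_wold)
  interpret P: pair_prob_space \<eta> \<eta> ..
  interpret D: prob_space "distr (\<eta> \<Otimes>\<^sub>M \<eta>) borel rotation" by (rule P.prob_space_distr) simp
  show "finite_measure (\<eta> \<Otimes>\<^sub>M \<eta>)" "finite_measure (distr (\<eta> \<Otimes>\<^sub>M \<eta>) borel rotation)" by unfold_locales
  fix L :: "('a \<times> 'a) \<Rightarrow>\<^sub>L real"
  define f where "f = L o\<^sub>L Blinfun (\<lambda>x::'a. (x, 0::'a))"
  define g where "g = L o\<^sub>L Blinfun (\<lambda>x::'a. (0::'a, x))"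
  have fg: "f x = L (x, 0)" "g x = L (0, x)" for x
    unfolding f_def g_def blinfun_apply_blinfun_compose
    by (subst bounded_linear_Blinfun_apply; auto intro!: bounded_linear_Pair bounded_linear_zero bounded_linear_ident)+
  have L: "L z = f (fst z) + g (snd z)" for z
    unfolding fg blinfun.add_right[symmetric] by simp
  let ?f = "(1 / sqrt 2) *\<^sub>R (f + g)" and ?g = "(1 / sqrt 2) *\<^sub>R (g - f)"
  have Lr: "L (rotation z) = ?f (fst z) + ?g (snd z)" for z
    unfolding L rotation_def
    by (simp add: blinfun.add_left blinfun.add_right blinfun.diff_left blinfun.diff_right blinfun.scaleR_left blinfun.scaleR_right) (simp add: field_simps)
  have "(\<integral>x. (?f x)\<^sup>2 \<partial>\<eta>) + (\<integral>x. (?g x)\<^sup>2 \<partial>\<eta>) = (\<integral>x. (?f x)\<^sup>2 + (?g x)\<^sup>2 \<partial>\<eta>)"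
    by (rule Bochner_Integration.integral_add[symmetric]) (rule functional_integrable_sq)+
  also have "\<dots> = (\<integral>x. (f x)\<^sup>2 + (g x)\<^sup>2 \<partial>\<eta>)"
    by (intro Bochner_Integration.integral_cong)
       (auto simp: blinfun.add_left blinfun.diff_left blinfun.scaleR_left power_mult_distrib power_divide power2_sum power2_diff field_simps)
  also have "\<dots> = (\<integral>x. (f x)\<^sup>2 \<partial>\<eta>) + (\<integral>x. (g x)\<^sup>2 \<partial>\<eta>)"
    by (rule Bochner_Integration.integral_add) (rule functional_integrable_sq)+
  finally have v: "(\<integral>x. (?f x)\<^sup>2 \<partial>\<eta>) + (\<integral>x. (?g x)\<^sup>2 \<partial>\<eta>) = (\<integral>x. (f x)\<^sup>2 \<partial>\<eta>) + (\<integral>x. (g x)\<^sup>2 \<partial>\<eta>)" .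
  have "(\<integral>x. iexp (L x) \<partial>distr (\<eta> \<Otimes>\<^sub>M \<eta>) borel rotation) = (\<integral>z. iexp (?f (fst z) + ?g (snd z)) \<partial>(\<eta> \<Otimes>\<^sub>M \<eta>))"
    by (subst integral_distr) (auto simp: Lr)
  also have "\<dots> = (\<integral>z. iexp (f (fst z) + g (snd z)) \<partial>(\<eta> \<Otimes>\<^sub>M \<eta>))"
    unfolding pair_char v ..
  finally show "(\<integral>x. iexp (L x) \<partial>distr (\<eta> \<Otimes>\<^sub>M \<eta>) borel rotation) = (\<integral>x. iexp (L x) \<partial>(\<eta> \<Otimes>\<^sub>M \<eta>))"
    unfolding L .
qed (simp_all only: sets_distr sets_pair)

text \<open>Fernique's estimate. The left side is the probability of a rectangle, unchanged by the
  rotation. In the rotated rectangle |x - y| \<le> s sqrt 2 and |x + y| > t sqrt 2; since |x + y|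
  exceeds |x - y| by at most twice the norm of either point, both points are large.\<close>

lemma tail_bound:
  "prob {x. norm x \<le> s} * prob {x. t < norm x} \<le> (prob {x. (t - s) / sqrt 2 < norm x})\<^sup>2"
proof -
  interpret P: pair_prob_space \<eta> \<eta> ..
  let ?A = "{x::'a. norm x \<le> s}" and ?B = "{x::'a. t < norm x}" and ?C = "{x::'a. (t - s) / sqrt 2 < norm x}"
  have [measurable]: "?A \<in> sets borel" "?B \<in> sets borel" "?C \<in> sets borel" by measurable
  have times: "P.prob (A \<times> B) = prob A * prob B" if "A \<in> sets borel" "B \<in> sets borel" for A B
    using emeasure_pair_measure_Times[of A \<eta> B] that
    by (simp add: P.emeasure_eq_measure emeasure_eq_measure ennreal_mult[symmetric])
  have AB: "?A \<times> ?B \<in> sets borel" unfolding borel_prod[symmetric] by (rule pair_measureI) measurable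
  have "prob ?A * prob ?B = P.prob (?A \<times> ?B)" by (simp add: times)
  also have "\<dots> = measure (distr (\<eta> \<Otimes>\<^sub>M \<eta>) borel rotation) (?A \<times> ?B)" by (simp only: rotation_invariance)
  also have "\<dots> = P.prob (rotation -` (?A \<times> ?B) \<inter> space (\<eta> \<Otimes>\<^sub>M \<eta>))"
    by (rule measure_distr) (use AB in auto)
  also have "\<dots> \<le> P.prob (?C \<times> ?C)"
  proof (rule P.finite_measure_mono)
    show "?C \<times> ?C \<in> sets (\<eta> \<Otimes>\<^sub>M \<eta>)" by measurable
    show "rotation -` (?A \<times> ?B) \<inter> space (\<eta> \<Otimes>\<^sub>M \<eta>) \<subseteq> ?C \<times> ?C"
    proof
      fix z assume "z \<in> rotation -` (?A \<times> ?B) \<inter> space (\<eta> \<Otimes>\<^sub>M \<eta>)"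
      then obtain x y where z: "z = (x, y)" and "norm (x - y) / sqrt 2 \<le> s" "t < norm (x + y) / sqrt 2"
        by (cases z) (auto simp: rotation_def)
      then have n: "norm (x - y) \<le> s * sqrt 2" "t * sqrt 2 < norm (x + y)" by (auto simp: field_simps)
      have "norm (x + y) \<le> norm (x - y) + norm (2 *\<^sub>R y)" "norm (x + y) \<le> norm (y - x) + norm (2 *\<^sub>R x)"
        using norm_triangle_ineq[of "x - y" "2 *\<^sub>R y"] norm_triangle_ineq[of "y - x" "2 *\<^sub>R x"]
        by (simp_all add: scaleR_2 add.commute)
      then have "norm (x + y) \<le> norm (x - y) + 2 * norm y" "norm (x + y) \<le> norm (x - y) + 2 * norm x"
        by (simp_all add: norm_minus_commute[of x y])
      with n have "(t - s) * sqrt 2 < 2 * norm y" "(t - s) * sqrt 2 < 2 * norm x" by (auto simp: left_diff_distrib)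
      moreover have "(t - s) / sqrt 2 = (t - s) * sqrt 2 / 2" by (simp add: field_simps)
      ultimately have "(t - s) / sqrt 2 < norm x" "(t - s) / sqrt 2 < norm y" by linarith+
      then show "z \<in> ?C \<times> ?C" by (simp add: z)
    qed
  qed
  also have "\<dots> = (prob ?C)\<^sup>2" by (simp add: times power2_eq_square)
  finally show ?thesis .
qed

theorem integrable_norm_sq: "integrable \<eta> (\<lambda>x. (norm x)\<^sup>2)"
proof -
  have "(\<lambda>n. prob {x. norm x \<le> real n}) \<longlonglongrightarrow> prob (\<Union>n. {x. norm x \<le> real n})"
    by (rule finite_Lim_measure_incseq) (auto simp: incseq_def)
  moreover have "(\<Union>n. {x::'a. norm x \<le> real n}) = space \<eta>" by (auto intro: real_arch_simple)
  ultimately have lim: "(\<lambda>n. prob {x. norm x \<le> real n}) \<longlonglongrightarrow> 1" by (simp add: prob_space del: space_eq)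
  then have "\<forall>\<^sub>F n in sequentially. 3 / 4 < prob {x. norm x \<le> real n}" by (rule order_tendstoD) simp
  then obtain k where k: "\<And>n. k \<le> n \<Longrightarrow> 3 / 4 < prob {x. norm x \<le> real n}" by (auto simp: eventually_sequentially)
  define s where "s = real (Suc k)"
  have s: "0 < s" "3 / 4 < prob {x. norm x \<le> s}" unfolding s_def using k[of "Suc k"] by simp_all
  \<comment> \<open>-d is the fixed point of the recursion that takes r to s + sqrt 2 r, which makes
    its solution explicit.\<close>
  define d where "d = s / (sqrt 2 - 1)"
  have s2: "1 < sqrt 2" by simp
  have d: "0 < d" using s s2 by (simp add: d_def)
  have ds: "s + d = sqrt 2 * d" using s2 by (simp add: d_def field_simps)
  txt \<open>\<open>t\<close> solves $t_0 = s$, $t_{n+1} = s + \sqrt{2}\,t_n$, so that \<open>tail_bound\<close> squares the tails.\<close>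
  define t where "t n = (s + d) * sqrt 2 ^ n - d" for n :: nat
  have t0: "t 0 = s" by (simp add: t_def)
  have tSuc: "(t (Suc n) - s) / sqrt 2 = t n" for n
    using ds by (simp add: t_def field_simps)
  define q where "q n = prob {x. t n < norm x}" for n
  have q0: "q 0 \<le> 1 / 4"
  proof -
    have "{x. s < norm x} = space \<eta> - {x::'a. norm x \<le> s}" by auto
    then have "q 0 = 1 - prob {x. norm x \<le> s}"
      unfolding q_def t0 using prob_compl[of "{x. norm x \<le> s}"] by simp
    then show ?thesis using s by simp
  qed
  \<comment> \<open>Fernique's estimate reads 3/4 q (n + 1) \<le> (q n)^2 \<le> q n / 4, hence the
    ratio 1/3. Since (t n)^2 grows like 2^n, this decay suffices for the second moment.\<close>
  have qn: "q n \<le> 1 / 4 * (1 / 3) ^ n" for n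
  proof (induction n)
    case (Suc n)
    have qs: "q n \<le> 1 / 4" using Suc power_le_one[of "1/3::real" n] by simp
    have "3 / 4 * q (Suc n) \<le> prob {x. norm x \<le> s} * q (Suc n)"
      using s by (intro mult_right_mono) (auto simp: q_def)
    also have "\<dots> \<le> (q n)\<^sup>2" using tail_bound[of s "t (Suc n)"] by (simp add: q_def tSuc)
    also have "\<dots> \<le> 1 / 4 * q n" using mult_right_mono[OF qs, of "q n"] by (simp add: power2_eq_square q_def)
    finally show ?case using Suc by simp
  qed (use q0 in simp)
  have tle: "(t (Suc n))\<^sup>2 \<le> 2 * (s + d)\<^sup>2 * 2 ^ n" for n
  proof -
    define c where "c = (s + d) * sqrt 2 ^ Suc n"
    have "1 \<le> sqrt 2 ^ Suc n" using s2 by (intro one_le_power) simp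
    then have "(s + d) * 1 \<le> c" unfolding c_def using s d by (intro mult_left_mono) auto
    then have "0 \<le> t (Suc n) \<and> t (Suc n) \<le> c"
      using s d unfolding t_def c_def[symmetric] by auto
    then have "(t (Suc n))\<^sup>2 \<le> c\<^sup>2" by (intro power_mono) auto
    then have "(t (Suc n))\<^sup>2 \<le> ((s + d) * sqrt 2 ^ Suc n)\<^sup>2" by (simp only: c_def)
    also have "\<dots> = (s + d)\<^sup>2 * ((sqrt 2)\<^sup>2) ^ Suc n" by (simp only: power_mult_distrib power_mult[symmetric] mult.commute)
    also have "\<dots> = 2 * (s + d)\<^sup>2 * 2 ^ n" by simp
    finally show ?thesis .
  qed
  have summable: "summable (\<lambda>n. (t (Suc n))\<^sup>2 * q n)"
  proof (rule summable_comparison_test')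
    show "summable (\<lambda>n. (1 / 2 * (s + d)\<^sup>2) * (2 / 3) ^ n)" by (intro summable_mult summable_geometric) simp
    fix n :: nat
    have "(t (Suc n))\<^sup>2 * q n \<le> (2 * (s + d)\<^sup>2 * 2 ^ n) * (1 / 4 * (1 / 3) ^ n)"
      by (intro mult_mono tle qn) (auto simp: q_def)
    also have "\<dots> = (1 / 2 * (s + d)\<^sup>2) * (2 / 3) ^ n" by (simp add: power_divide)
    finally show "norm ((t (Suc n))\<^sup>2 * q n) \<le> (1 / 2 * (s + d)\<^sup>2) * (2 / 3) ^ n" by (simp add: q_def)
  qed
  \<comment> \<open>A point of norm above s is charged to the layer between t n and t (n + 1), where
    t (n + 1) is the first level that reaches its norm.\<close>
  have pw: "ennreal ((norm x)\<^sup>2) \<le> ennreal (s\<^sup>2) + (\<Sum>n. ennreal ((t (Suc n))\<^sup>2) * indicator {x. t n < norm x} x)" for x :: 'a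
  proof (cases "norm x \<le> s")
    case True
    then have "ennreal ((norm x)\<^sup>2) \<le> ennreal (s\<^sup>2)" by (intro ennreal_leI power_mono) auto
    then show ?thesis by (rule order_trans) simp
  next
    case False
    obtain m where m: "(norm x + d) / (s + d) < sqrt 2 ^ m" using real_arch_pow[OF s2] by blast
    have ex: "\<exists>m. norm x \<le> t m" using m s d by (intro exI[of _ m]) (simp add: t_def field_simps)
    define m where "m = (LEAST m. norm x \<le> t m)"
    have m1: "norm x \<le> t m" unfolding m_def by (rule LeastI_ex[OF ex])
    obtain n where n: "m = Suc n" using False m1 t0 by (cases m) auto
    have m2: "t n < norm x" using not_less_Least[of n "\<lambda>m. norm x \<le> t m"] n m_def by simp
    have "ennreal ((norm x)\<^sup>2) \<le> ennreal ((t (Suc n))\<^sup>2) * indicator {x. t n < norm x} x"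
      using m1 m2 n by (auto intro!: ennreal_leI power_mono)
    also have "\<dots> \<le> (\<Sum>n. ennreal ((t (Suc n))\<^sup>2) * indicator {x. t n < norm x} x)"
    proof -
      have "g n \<le> (\<Sum>n. g n)" for g :: "nat \<Rightarrow> ennreal"
        using sum_le_suminf[OF summableI, of "{n}" g] by simp
      then show ?thesis .
    qed
    finally show ?thesis by (rule order_trans) simp
  qed
  have "(\<integral>\<^sup>+x. ennreal (norm ((norm x)\<^sup>2)) \<partial>\<eta>) \<le> (\<integral>\<^sup>+x. ennreal (s\<^sup>2) + (\<Sum>n. ennreal ((t (Suc n))\<^sup>2) * indicator {x. t n < norm x} x) \<partial>\<eta>)"
    by (rule nn_integral_mono) (use pw in simp)
  also have "\<dots> = ennreal (s\<^sup>2) + (\<Sum>n. ennreal ((t (Suc n))\<^sup>2) * emeasure \<eta> {x. t n < norm x})"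
    by (subst nn_integral_add, simp, simp, subst nn_integral_suminf, simp)
       (simp add: nn_integral_cmult_indicator emeasure_space_1 del: space_eq)
  also have "\<dots> = ennreal (s\<^sup>2) + (\<Sum>n. ennreal ((t (Suc n))\<^sup>2 * q n))"
    by (simp add: emeasure_eq_measure q_def ennreal_mult)
  also have "\<dots> < \<infinity>"
  proof -
    have "(\<Sum>n. ennreal ((t (Suc n))\<^sup>2 * q n)) \<noteq> top"
      by (rule ennreal_suminf_neq_top[OF summable]) (simp add: q_def)
    then show ?thesis by (simp add: less_top[symmetric])
  qed
  finally show ?thesis by (intro integrableI_bounded) auto
qed

end

section \<open>The spaces $L^2$ and $H$\<close>

text \<open>Tuples of functionals need a pointwise vector space structure, for \<open>convex\<close>
  as well as for \<open>pre_hilbert\<close>.\<close>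

instantiation "fun" :: (type, real_vector) real_vector
begin
definition scaleR_fun :: "real \<Rightarrow> ('a \<Rightarrow> 'b) \<Rightarrow> 'a \<Rightarrow> 'b" where "scaleR_fun r f = (\<lambda>x. r *\<^sub>R f x)"
instance
  by standard (auto simp: scaleR_fun_def fun_eq_iff scaleR_add_left scaleR_add_right)
end

lemma scaleR_fun_apply [simp]: "(r *\<^sub>R f) x = r *\<^sub>R f x"
  by (simp add: scaleR_fun_def)

lemma L2_functionsD:
  "f \<in> L2_functions M \<Longrightarrow> f \<in> borel_measurable M" "f \<in> L2_functions M \<Longrightarrow> integrable M (\<lambda>x. (f x)\<^sup>2)"
  by (auto simp: L2_functions_def)

lemma L2_mult:
  assumes "f \<in> L2_functions M" "g \<in> L2_functions M"
  shows "integrable M (\<lambda>x. f x * g x)"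
proof (rule Bochner_Integration.integrable_bound)
  note [measurable] = L2_functionsD(1)[OF assms(1)] L2_functionsD(1)[OF assms(2)]
  show "integrable M (\<lambda>x. (f x)\<^sup>2 + (g x)\<^sup>2)" using assms by (intro Bochner_Integration.integrable_add L2_functionsD)
  show "(\<lambda>x. f x * g x) \<in> borel_measurable M" by measurable
  have "\<bar>a * b\<bar> \<le> a\<^sup>2 + b\<^sup>2" for a b :: real
  proof -
    have "0 \<le> a\<^sup>2 + b\<^sup>2 - 2 * (\<bar>a\<bar> * \<bar>b\<bar>)"
      using zero_le_power2[of "\<bar>a\<bar> - \<bar>b\<bar>"] by (simp add: power2_diff)
    moreover have "0 \<le> \<bar>a\<bar> * \<bar>b\<bar>" by simp
    ultimately show ?thesis unfolding abs_mult by linarith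
  qed
  then show "AE x in M. norm (f x * g x) \<le> norm ((f x)\<^sup>2 + (g x)\<^sup>2)" by simp
qed

lemma L2_add_scaled:
  assumes f: "f \<in> L2_functions M" and g: "g \<in> L2_functions M"
  shows "(\<lambda>x. f x + r * g x) \<in> L2_functions M"
proof -
  note [measurable] = L2_functionsD(1)[OF f] L2_functionsD(1)[OF g]
  have "integrable M (\<lambda>x. (f x)\<^sup>2 + (2 * r) * (f x * g x) + r\<^sup>2 * (g x)\<^sup>2)"
    by (intro Bochner_Integration.integrable_add integrable_mult_right L2_mult L2_functionsD f g)
  then show ?thesis by (simp add: L2_functions_def power2_sum power_mult_distrib algebra_simps)
qed

lemma L2_diff: "f \<in> L2_functions M \<Longrightarrow> g \<in> L2_functions M \<Longrightarrow> (\<lambda>x. f x - g x) \<in> L2_functions M"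
  using L2_add_scaled[of f M g "-1"] by simp

lemma L2_zero: "(\<lambda>_. 0) \<in> L2_functions M" by (simp add: L2_functions_def)

lemma L2_scale: "f \<in> L2_functions M \<Longrightarrow> (\<lambda>x. r * f x) \<in> L2_functions M"
  using L2_add_scaled[OF L2_zero, of f M r] by simp

lemma L2_minus: "f \<in> L2_functions M \<Longrightarrow> (\<lambda>x. - f x) \<in> L2_functions M"
  using L2_scale[of f M "-1"] by simp

definition L2N :: "'a measure \<Rightarrow> ('n \<Rightarrow> 'a \<Rightarrow> real) set" where
  "L2N M = {u. \<forall>j. u j \<in> L2_functions M}"

lemma L2N_D: "u \<in> L2N M \<Longrightarrow> u j \<in> L2_functions M" by (simp add: L2N_def)

lemma L2N_diff: "u \<in> L2N M \<Longrightarrow> v \<in> L2N M \<Longrightarrow> (\<lambda>j x. u j x - v j x) \<in> L2N M"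
  by (simp add: L2N_def L2_diff)

lemma L2N_minus: "u \<in> L2N M \<Longrightarrow> (\<lambda>j x. - u j x) \<in> L2N M"
  by (simp add: L2N_def L2_minus)

lemma HN_inner_nonneg: "0 \<le> HN_inner M u u"
  by (auto simp: HN_inner_def H_inner_def intro!: sum_nonneg Bochner_Integration.integral_nonneg)

lemma HN_norm_sq: "(HN_norm M u)\<^sup>2 = HN_inner M u u"
  by (simp add: HN_norm_def HN_inner_nonneg)

lemma HN_norm_nonneg [simp]: "0 \<le> HN_norm M u"
  by (simp add: HN_norm_def HN_inner_nonneg)

lemma HN_inner_expand:
  assumes u: "u \<in> L2N M" and v: "v \<in> L2N M"
  shows "HN_inner M (\<lambda>j x. u j x + r * v j x) (\<lambda>j x. u j x + r * v j x)
    = HN_inner M u u + 2 * r * HN_inner M u v + r\<^sup>2 * HN_inner M v v"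
proof -
  have "H_inner M (\<lambda>x. u j x + r * v j x) (\<lambda>x. u j x + r * v j x)
    = H_inner M (u j) (u j) + 2 * r * H_inner M (u j) (v j) + r\<^sup>2 * H_inner M (v j) (v j)" for j
  proof -
    note i = L2_mult[OF L2N_D[OF u, of j] L2N_D[OF u, of j]] L2_mult[OF L2N_D[OF u, of j] L2N_D[OF v, of j]]
      L2_mult[OF L2N_D[OF v, of j] L2N_D[OF v, of j]]
    have "has_bochner_integral M (\<lambda>x. u j x * u j x + (2 * r) * (u j x * v j x) + r\<^sup>2 * (v j x * v j x))
      (H_inner M (u j) (u j) + (2 * r) * H_inner M (u j) (v j) + r\<^sup>2 * H_inner M (v j) (v j))"
      unfolding H_inner_def
      by (intro has_bochner_integral_add has_bochner_integral_mult_right has_bochner_integral_integrable i)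
    moreover have "(\<lambda>x. u j x * u j x + (2 * r) * (u j x * v j x) + r\<^sup>2 * (v j x * v j x))
       = (\<lambda>x. (u j x + r * v j x) * (u j x + r * v j x))"
      by (rule ext) (simp add: algebra_simps power2_eq_square)
    ultimately show ?thesis by (simp add: has_bochner_integral_iff H_inner_def)
  qed
  then show ?thesis by (simp add: HN_inner_def sum.distrib sum_distrib_left)
qed

lemma HN_cauchy_schwarz:
  assumes u: "u \<in> L2N M" and v: "v \<in> L2N M"
  shows "\<bar>HN_inner M u v\<bar> \<le> HN_norm M u * HN_norm M v"
proof -
  let ?a = "HN_inner M u u" and ?b = "HN_inner M u v" and ?c = "HN_inner M v v"
  have q: "0 \<le> ?a + 2 * r * ?b + r\<^sup>2 * ?c" for r
    using HN_inner_nonneg[of M "\<lambda>j x. u j x + r * v j x"] unfolding HN_inner_expand[OF u v] .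
  have c0: "0 \<le> ?c" "0 \<le> ?a" by (rule HN_inner_nonneg)+
  have "?b\<^sup>2 \<le> ?a * ?c"
  proof (cases "?c = 0")
    case True
    have "?b = 0"
    proof (rule ccontr)
      assume b: "?b \<noteq> 0"
      \<comment> \<open>With c = 0 the quadratic in r is affine with slope 2 b; this r brings its
        value to -1.\<close>
      have "0 \<le> ?a + 2 * (- (?a + 1) / (2 * ?b)) * ?b" using q[of "- (?a + 1) / (2 * ?b)"] True by simp
      also have "\<dots> = -1" using b by (simp add: field_simps)
      finally show False by simp
    qed
    then show ?thesis using True by simp
  next
    case False
    then have c: "0 < ?c" using c0 by simp
    have "0 \<le> ?a + 2 * (- ?b / ?c) * ?b + (- ?b / ?c)\<^sup>2 * ?c" by (rule q)
    also have "\<dots> = ?a - ?b\<^sup>2 / ?c" using c by (simp add: field_simps power2_eq_square)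
    finally show ?thesis using c by (simp add: field_simps)
  qed
  then have "sqrt (?b\<^sup>2) \<le> sqrt (?a * ?c)" by (rule real_sqrt_le_mono)
  then show ?thesis by (simp add: HN_norm_def real_sqrt_mult)
qed

lemma HN_norm_triangle:
  assumes u: "u \<in> L2N M" and v: "v \<in> L2N M"
  shows "HN_norm M (\<lambda>j x. u j x + v j x) \<le> HN_norm M u + HN_norm M v"
proof (rule power2_le_imp_le)
  have "(HN_norm M (\<lambda>j x. u j x + v j x))\<^sup>2 = HN_inner M u u + 2 * HN_inner M u v + HN_inner M v v"
    using HN_inner_expand[OF u v, of 1] by (simp add: HN_norm_sq)
  then show "(HN_norm M (\<lambda>j x. u j x + v j x))\<^sup>2 \<le> (HN_norm M u + HN_norm M v)\<^sup>2"
    using HN_cauchy_schwarz[OF u v] by (simp add: power2_sum HN_norm_sq)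
qed simp

lemma HN_norm_minus: "HN_norm M (\<lambda>j x. - u j x) = HN_norm M u"
  by (simp add: HN_norm_def HN_inner_def H_inner_def)

lemma HN_dist_triangle:
  assumes "u \<in> L2N M" "v \<in> L2N M" "w \<in> L2N M"
  shows "HN_dist M u w \<le> HN_dist M u v + HN_dist M v w"
  using HN_norm_triangle[OF L2N_diff[OF assms(1,2)] L2N_diff[OF assms(2,3)]] by (simp add: HN_dist_def)

lemma HN_dist_commute: "HN_dist M u v = HN_dist M v u"
  using HN_norm_minus[of M "\<lambda>j x. u j x - v j x"] by (simp add: HN_dist_def)

text \<open>A function is a tuple over \<open>unit\<close>; the inequalities for tuples thereby
  specialise to single functions.\<close>

lemma H_norm_eq_HN: "H_norm M f = HN_norm M (\<lambda>_::unit. f)"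
  by (simp add: H_norm_def HN_norm_def HN_inner_def)

lemma H_norm_component_le: "H_norm M (u j) \<le> HN_norm M u"
proof -
  have "H_inner M (u j) (u j) \<le> HN_inner M u u"
    unfolding HN_inner_def
    by (rule member_le_sum) (auto simp: H_inner_def intro!: Bochner_Integration.integral_nonneg)
  then show ?thesis by (simp add: H_norm_def HN_norm_def)
qed

lemma HN_norm_le_sum: "HN_norm M u \<le> (\<Sum>j\<in>UNIV. H_norm M (u j))"
proof -
  have nn: "0 \<le> H_inner M (u j) (u j)" for j by (auto simp: H_inner_def intro!: Bochner_Integration.integral_nonneg)
  have "HN_norm M u = L2_set (\<lambda>j. H_norm M (u j)) UNIV"
    by (simp add: HN_norm_def HN_inner_def L2_set_def H_norm_def nn)
  also have "\<dots> \<le> (\<Sum>j\<in>UNIV. H_norm M (u j))" by (rule L2_set_le_sum) (simp add: H_norm_def nn)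
  finally show ?thesis .
qed

lemma H_cauchy_schwarz:
  assumes "f \<in> L2_functions M" "g \<in> L2_functions M"
  shows "\<bar>H_inner M f g\<bar> \<le> H_norm M f * H_norm M g"
  using HN_cauchy_schwarz[of "\<lambda>_::unit. f" M "\<lambda>_. g"] assms by (simp add: L2N_def H_norm_eq_HN HN_inner_def)

lemma H_norm_triangle:
  assumes "f \<in> L2_functions M" "g \<in> L2_functions M"
  shows "H_norm M (\<lambda>x. f x + g x) \<le> H_norm M f + H_norm M g"
  using HN_norm_triangle[of "\<lambda>_::unit. f" M "\<lambda>_. g"] assms by (simp add: L2N_def H_norm_eq_HN)

lemma H_norm_nonneg [simp]: "0 \<le> H_norm M f" by (simp add: H_norm_eq_HN)

lemma H_norm_sq: "(H_norm M f)\<^sup>2 = H_inner M f f"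
  using HN_norm_sq[of M "\<lambda>_::unit. f"] by (simp add: H_norm_eq_HN HN_inner_def)

lemma H_norm_diff_triangle:
  assumes "f \<in> L2_functions M" "g \<in> L2_functions M" "h \<in> L2_functions M"
  shows "H_norm M (\<lambda>x. f x - h x) \<le> H_norm M (\<lambda>x. f x - g x) + H_norm M (\<lambda>x. g x - h x)"
  using H_norm_triangle[OF L2_diff[OF assms(1,2)] L2_diff[OF assms(2,3)]] by simp

lemma H_norm_minus_commute: "H_norm M (\<lambda>x. f x - g x) = H_norm M (\<lambda>x. g x - f x)"
  by (simp add: H_norm_def H_inner_def algebra_simps)

context prob_space
begin

lemma L1_le_H_norm:
  assumes f: "f \<in> L2_functions M"
  shows "integrable M f" "(\<integral>x. \<bar>f x\<bar> \<partial>M) \<le> H_norm M f"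
proof -
  note [measurable] = L2_functionsD(1)[OF f]
  have one: "(\<lambda>_. 1) \<in> L2_functions M" by (simp add: L2_functions_def)
  show i: "integrable M f" using L2_mult[OF f one] by simp
  have "(\<lambda>x. \<bar>f x\<bar>) \<in> L2_functions M" using f by (simp add: L2_functions_def)
  from H_cauchy_schwarz[OF this one] show "(\<integral>x. \<bar>f x\<bar> \<partial>M) \<le> H_norm M f"
    by (simp add: H_inner_def H_norm_def prob_space)
qed

text \<open>Riesz--Fischer: a rapidly convergent subsequence converges almost everywhere, and
  Fatou's lemma identifies the limit.\<close>

theorem L2_complete:
  fixes f :: "nat \<Rightarrow> 'a \<Rightarrow> real"
  assumes f: "\<And>n. f n \<in> L2_functions M"
    and cauchy: "\<And>e. 0 < e \<Longrightarrow> \<exists>N. \<forall>m\<ge>N. \<forall>n\<ge>N. H_norm M (\<lambda>x. f m x - f n x) < e"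
  obtains g where "g \<in> L2_functions M" "(\<lambda>n. H_norm M (\<lambda>x. f n x - g x)) \<longlonglongrightarrow> 0"
proof -
  note [measurable] = L2_functionsD(1)[OF f]
  have "\<exists>N. \<forall>m\<ge>N. \<forall>n\<ge>N. H_norm M (\<lambda>x. f m x - f n x) < (1/2) ^ k" for k by (rule cauchy) simp
  then obtain N where N: "\<And>k m n. N k \<le> m \<Longrightarrow> N k \<le> n \<Longrightarrow> H_norm M (\<lambda>x. f m x - f n x) < (1/2) ^ k" by metis
  \<comment> \<open>\<open>r\<close> is increasing, exceeds or meets every threshold N i with i
    \<le> k, and is at least k: it indexes a rapidly Cauchy subsequence.\<close>
  define r where "r k = (\<Sum>i\<le>k. N i) + k" for k
  have rN: "N k \<le> r k" for k unfolding r_def by (rule trans_le_add1) (rule member_le_sum; simp)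
  have rS: "r k \<le> r (Suc k)" for k by (simp add: r_def)
  have kr: "k \<le> r k" for k by (simp add: r_def)
  define d where "d k x = \<bar>f (r (Suc k)) x - f (r k) x\<bar>" for k x
  have dM[measurable]: "d k \<in> borel_measurable M" for k unfolding d_def by measurable
  have dint: "(\<integral>\<^sup>+x. ennreal (d k x) \<partial>M) \<le> ennreal ((1/2) ^ k)" for k
  proof -
    have L: "(\<lambda>x. f (r (Suc k)) x - f (r k) x) \<in> L2_functions M" by (intro L2_diff f)
    have "(\<integral>\<^sup>+x. ennreal (d k x) \<partial>M) = ennreal (\<integral>x. d k x \<partial>M)"
      using L1_le_H_norm(1)[OF L] by (intro nn_integral_eq_integral) (auto simp: d_def)
    also have "\<dots> \<le> ennreal ((1/2) ^ k)"
      using L1_le_H_norm(2)[OF L] N[of k "r (Suc k)" "r k"] rN[of k] rS[of k] by (intro ennreal_leI) (simp add: d_def)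
    finally show ?thesis .
  qed
  have "(\<integral>\<^sup>+x. (\<Sum>k. ennreal (d k x)) \<partial>M) = (\<Sum>k. \<integral>\<^sup>+x. ennreal (d k x) \<partial>M)"
    by (rule nn_integral_suminf) simp
  also have "\<dots> \<le> (\<Sum>k. ennreal ((1/2) ^ k))" by (intro suminf_le dint) auto
  also have "(\<Sum>k. ennreal ((1/2) ^ k)) < top"
    by (subst less_top[symmetric], rule ennreal_suminf_neq_top) (auto intro: summable_geometric)
  finally have "(\<integral>\<^sup>+x. (\<Sum>k. ennreal (d k x)) \<partial>M) \<noteq> \<infinity>" by simp
  then have "AE x in M. (\<Sum>k. ennreal (d k x)) \<noteq> \<infinity>"
    by (intro nn_integral_PInf_AE) simp
  then have conv: "AE x in M. convergent (\<lambda>k. f (r k) x)"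
  proof eventually_elim
    case (elim x)
    have "summable (\<lambda>k. d k x)" using elim by (intro summable_suminf_not_top) (auto simp: d_def)
    then have "summable (\<lambda>k. f (r (Suc k)) x - f (r k) x)"
      unfolding d_def real_norm_def[symmetric] by (rule summable_norm_cancel)
    then have "convergent (\<lambda>n. \<Sum>k<n. f (r (Suc k)) x - f (r k) x)" by (simp add: summable_iff_convergent)
    then have "convergent (\<lambda>n. f (r n) x - f (r 0) x)" by (simp add: sum_lessThan_telescope[of "\<lambda>k. f (r k) x"])
    from convergent_add[OF this convergent_const[of "f (r 0) x"]] show ?case by simp
  qed
  define g where "g x = lim (\<lambda>k. f (r k) x)" for x
  have gM[measurable]: "g \<in> borel_measurable M" unfolding g_def by measurable
  have lim: "AE x in M. (\<lambda>k. f (r k) x) \<longlonglongrightarrow> g x" using conv by eventually_elim (simp add: g_def convergent_LIMSEQ_iff)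
  have nn_eq: "(\<integral>\<^sup>+x. ennreal ((h x)\<^sup>2) \<partial>M) = ennreal ((H_norm M h)\<^sup>2)" if "h \<in> L2_functions M" for h
    using nn_integral_eq_integral[OF L2_functionsD(2)[OF that]]
    by (simp add: H_norm_sq H_inner_def flip: power2_eq_square)
  have fatou: "(\<integral>\<^sup>+x. ennreal ((f m x - g x)\<^sup>2) \<partial>M) \<le> ennreal (((1/2) ^ k)\<^sup>2)" if m: "N k \<le> m" for k m
  proof -
    have "(\<integral>\<^sup>+x. ennreal ((f m x - g x)\<^sup>2) \<partial>M) = (\<integral>\<^sup>+x. liminf (\<lambda>n. ennreal ((f m x - f (r n) x)\<^sup>2)) \<partial>M)"
    proof (rule nn_integral_cong_AE)
      show "AE x in M. ennreal ((f m x - g x)\<^sup>2) = liminf (\<lambda>n. ennreal ((f m x - f (r n) x)\<^sup>2))"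
        using lim
      proof eventually_elim
        case (elim x)
        have "(\<lambda>n. ennreal ((f m x - f (r n) x)\<^sup>2)) \<longlonglongrightarrow> ennreal ((f m x - g x)\<^sup>2)"
          by (intro tendsto_intros elim)
        from lim_imp_Liminf[OF _ this] show ?case by simp
      qed
    qed
    also have "\<dots> \<le> liminf (\<lambda>n. \<integral>\<^sup>+x. ennreal ((f m x - f (r n) x)\<^sup>2) \<partial>M)"
      by (rule nn_integral_liminf) simp
    also have "\<dots> \<le> ennreal (((1/2) ^ k)\<^sup>2)"
    proof (rule Liminf_le)
      show "\<forall>\<^sub>F n in sequentially. (\<integral>\<^sup>+x. ennreal ((f m x - f (r n) x)\<^sup>2) \<partial>M) \<le> ennreal (((1/2) ^ k)\<^sup>2)"
      proof (intro eventually_sequentiallyI[of "N k"])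
        fix n assume "N k \<le> n"
        then have "H_norm M (\<lambda>x. f m x - f (r n) x) < (1/2) ^ k" using kr[of n] by (intro N m) simp
        then have "(H_norm M (\<lambda>x. f m x - f (r n) x))\<^sup>2 \<le> ((1/2) ^ k)\<^sup>2" by (intro power_mono) auto
        then show "(\<integral>\<^sup>+x. ennreal ((f m x - f (r n) x)\<^sup>2) \<partial>M) \<le> ennreal (((1/2) ^ k)\<^sup>2)"
          by (subst nn_eq) (auto intro!: L2_diff f ennreal_leI)
      qed
    qed simp
    finally show ?thesis .
  qed
  have diff: "(\<lambda>x. f m x - g x) \<in> L2_functions M" if "N k \<le> m" for k m
  proof -
    have "(\<integral>\<^sup>+x. ennreal ((f m x - g x)\<^sup>2) \<partial>M) < \<infinity>" using fatou[OF that] by (simp add: le_less_trans)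
    then have "integrable M (\<lambda>x. (f m x - g x)\<^sup>2)" by (intro integrableI_bounded) auto
    then show ?thesis by (simp add: L2_functions_def)
  qed
  have gL: "g \<in> L2_functions M" using L2_diff[OF f diff[of 0 "N 0"], of "N 0"] by simp
  have "(\<lambda>n. H_norm M (\<lambda>x. f n x - g x)) \<longlonglongrightarrow> 0"
  proof (rule LIMSEQ_I)
    fix e :: real assume e: "0 < e"
    obtain k where k: "(1/2) ^ k < e" using real_arch_pow_inv[OF e, of "1/2"] by auto
    show "\<exists>N. \<forall>n\<ge>N. norm (H_norm M (\<lambda>x. f n x - g x) - 0) < e"
    proof (intro exI allI impI)
      fix n assume n: "N k \<le> n"
      have "ennreal ((H_norm M (\<lambda>x. f n x - g x))\<^sup>2) \<le> ennreal (((1/2) ^ k)\<^sup>2)"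
        using fatou[OF n] nn_eq[OF diff[OF n]] by simp
      then have "(H_norm M (\<lambda>x. f n x - g x))\<^sup>2 \<le> ((1/2) ^ k)\<^sup>2" by (simp add: ennreal_le_iff)
      then have "H_norm M (\<lambda>x. f n x - g x) \<le> (1/2) ^ k" by (rule power2_le_imp_le) simp
      then show "norm (H_norm M (\<lambda>x. f n x - g x) - 0) < e" using k by simp
    qed
  qed
  with gL that show thesis by blast
qed

end

text \<open>Uniform boundedness. Evaluations are weak* continuous, so \<open>K\<close> is pointwise
  bounded; by Baire one of the closed sets \<open>A n\<close> contains a ball, and by linearity a
  bound on a ball is a bound on the norms.\<close>

lemma weak_star_bounded:
  fixes K :: "('a::banach \<Rightarrow>\<^sub>L real) set"
  assumes "compactin weak_star K"
  obtains C where "0 \<le> C" "\<And>\<mu>. \<mu> \<in> K \<Longrightarrow> norm \<mu> \<le> C"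
proof -
  have pw: "\<exists>B. \<forall>\<mu>\<in>K. \<bar>blinfun_apply \<mu> x\<bar> \<le> B" for x
  proof -
    have "compact ((\<lambda>\<mu>. blinfun_apply \<mu> x) ` K)"
      using image_compactin[OF assms strong_operator_topology_continuous_evaluation[of x]] by simp
    then have "bounded ((\<lambda>\<mu>. blinfun_apply \<mu> x) ` K)" by (rule compact_imp_bounded)
    then show ?thesis by (auto simp: bounded_iff)
  qed
  define A where "A n = {x. \<forall>\<mu>\<in>K. \<bar>blinfun_apply \<mu> x\<bar> \<le> real n}" for n :: nat
  have closed: "closed (A n)" for n
  proof -
    have "A n = (\<Inter>\<mu>\<in>K. {x. \<bar>blinfun_apply \<mu> x\<bar> \<le> real n})" by (auto simp: A_def)
    then show ?thesis by (auto intro!: closed_INT closed_Collect_le continuous_intros)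
  qed
  have "x \<in> \<Union> (range A)" for x
  proof -
    obtain B where "\<forall>\<mu>\<in>K. \<bar>blinfun_apply \<mu> x\<bar> \<le> B" using pw by blast
    moreover obtain n where "B \<le> real n" using real_arch_simple by blast
    ultimately have "x \<in> A n" unfolding A_def by fastforce
    then show ?thesis by blast
  qed
  then have U: "\<Union> (range A) = UNIV" by blast
  have "\<exists>n. interior (A n) \<noteq> {}"
  proof (rule ccontr)
    assume "\<not> ?thesis"
    then have "(euclidean :: 'a topology) interior_of \<Union> (range A) = {}"
      by (intro Baire_category_alt) (auto simp: completely_metrizable_space_euclidean closed)
    then show False unfolding U by simp
  qed
  then obtain n x0 where "x0 \<in> interior (A n)" by blast
  then obtain e where e: "0 < e" "cball x0 e \<subseteq> A n" by (auto simp: mem_interior_cball)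
  show thesis
  proof (rule that)
    show "0 \<le> 2 * real n / e" using e by simp
    fix \<mu> assume \<mu>: "\<mu> \<in> K"
    show "norm \<mu> \<le> 2 * real n / e"
    proof (rule norm_blinfun_bound)
      fix y :: 'a
      show "norm (blinfun_apply \<mu> y) \<le> 2 * real n / e * norm y"
      proof (cases "y = 0")
        case False
        \<comment> \<open>Scaled to norm e, so that x0 + y' stays in the ball; subtracting the value
          at x0 doubles the bound.\<close>
        define y' where "y' = (e / norm y) *\<^sub>R y"
        have "norm y' = e" using False e by (simp add: y'_def)
        then have "x0 + y' \<in> A n" "x0 \<in> A n" using e by (auto simp: dist_norm subset_iff)
        then have "\<bar>blinfun_apply \<mu> (x0 + y')\<bar> \<le> real n" "\<bar>blinfun_apply \<mu> x0\<bar> \<le> real n" using \<mu> by (auto simp: A_def)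
        then have "\<bar>blinfun_apply \<mu> y'\<bar> \<le> 2 * real n" by (simp add: blinfun.add_right)
        then have "(e / norm y) * \<bar>blinfun_apply \<mu> y\<bar> \<le> 2 * real n" using e by (simp add: y'_def blinfun.scaleR_right abs_mult)
        then show ?thesis using e False by (simp add: field_simps)
      qed simp
    qed (use e in simp)
  qed
qed

lemma sum_fun_apply: "(\<Sum>i\<in>A. f i) x = (\<Sum>i\<in>A. f i x)" for f :: "'i \<Rightarrow> 'j \<Rightarrow> 'b::comm_monoid_add"
  by (induction A rule: infinite_finite_induct) auto

lemma limitin_weak_star:
  assumes "\<And>x. ((\<lambda>k. blinfun_apply (g k) x) \<longlongrightarrow> blinfun_apply l x) F"
  shows "limitin weak_star g l F"
  unfolding limitin_def strong_operator_topology_topspace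
proof (intro conjI allI impI)
  fix U assume "openin weak_star U \<and> l \<in> U"
  then obtain V where V: "open V" "U = blinfun_apply -` V" "blinfun_apply l \<in> V"
    unfolding strong_operator_topology_def openin_pullback_topology by auto
  have "((\<lambda>k. blinfun_apply (g k)) \<longlongrightarrow> blinfun_apply l) F"
    unfolding tendsto_coordinatewise using assms by blast
  from topological_tendstoD[OF this V(1,3)] show "\<forall>\<^sub>F k in F. g k \<in> U" by (simp add: V(2))
qed simp

context gaussian_measure
begin

lemma functional_L2: "blinfun_apply f \<in> L2_functions \<eta>"
  by (simp add: L2_functions_def functional_integrable_sq)

lemma H_space_L2: "h \<in> H_space \<eta> \<Longrightarrow> h \<in> L2_functions \<eta>"
  by (simp add: H_space_def)

lemma functional_in_H: "blinfun_apply f \<in> H_space \<eta>"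
  unfolding H_space_def
  by (auto simp: functional_L2 intro!: exI[of _ f]) (simp add: H_norm_def H_inner_def)

lemma H_space_closed:
  assumes f: "f \<in> L2_functions \<eta>" and approx: "\<And>e. 0 < e \<Longrightarrow> \<exists>h\<in>H_space \<eta>. H_norm \<eta> (\<lambda>x. f x - h x) < e"
  shows "f \<in> H_space \<eta>"
proof -
  have "\<exists>\<mu> :: 'a \<Rightarrow>\<^sub>L real. H_norm \<eta> (\<lambda>x. f x - \<mu> x) < e" if "0 < e" for e
  proof -
    have e: "0 < e / 2" using that by simp
    from approx[OF e] obtain h where h: "h \<in> H_space \<eta>" "H_norm \<eta> (\<lambda>x. f x - h x) < e / 2" by blast
    then obtain \<mu> :: "'a \<Rightarrow>\<^sub>L real" where "H_norm \<eta> (\<lambda>x. h x - \<mu> x) < e / 2"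
      unfolding H_space_def using e by blast
    then show ?thesis
      using H_norm_diff_triangle[OF f H_space_L2[OF h(1)] functional_L2[of \<mu>]] h(2) by (intro exI[of _ \<mu>]) linarith
  qed
  with f show ?thesis by (simp add: H_space_def)
qed

lemma H_space_minus: "h \<in> H_space \<eta> \<Longrightarrow> (\<lambda>x. - h x) \<in> H_space \<eta>"
proof (rule H_space_closed)
  assume h: "h \<in> H_space \<eta>"
  then show "(\<lambda>x. - h x) \<in> L2_functions \<eta>" by (intro L2_minus H_space_L2)
  fix e :: real assume "0 < e"
  then obtain \<mu> :: "'a \<Rightarrow>\<^sub>L real" where "H_norm \<eta> (\<lambda>x. h x - \<mu> x) < e" using h by (auto simp: H_space_def)
  then have "H_norm \<eta> (\<lambda>x. - h x - blinfun_apply (- \<mu>) x) < e"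
    using H_norm_minus_commute[of \<eta> h "blinfun_apply \<mu>"] by (simp add: blinfun.minus_left)
  then show "\<exists>k\<in>H_space \<eta>. H_norm \<eta> (\<lambda>x. - h x - k x) < e" using functional_in_H by blast
qed

lemma norm_L2: "norm \<in> L2_functions \<eta>"
  using integrable_norm_sq by (simp add: L2_functions_def)

lemma J_integrable:
  assumes f: "f \<in> L2_functions \<eta>" shows "integrable \<eta> (\<lambda>x. f x *\<^sub>R x)"
proof (rule Bochner_Integration.integrable_bound)
  note [measurable] = L2_functionsD(1)[OF f]
  have "(\<lambda>x. \<bar>f x\<bar>) \<in> L2_functions \<eta>" using f by (simp add: L2_functions_def)
  from L2_mult[OF this norm_L2] show "integrable \<eta> (\<lambda>x. \<bar>f x\<bar> * norm x)" .
  have "(\<lambda>x. x) \<in> borel_measurable \<eta>" by simp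
  then show "(\<lambda>x. f x *\<^sub>R x) \<in> borel_measurable \<eta>"
    using L2_functionsD(1)[OF f] by (intro borel_measurable_scaleR)
qed simp

lemma J_apply:
  fixes \<mu> :: "'a \<Rightarrow>\<^sub>L real"
  assumes f: "f \<in> L2_functions \<eta>"
  shows "\<mu> (J_map \<eta> f) = H_inner \<eta> \<mu> f"
  using integral_bounded_linear[OF blinfun.bounded_linear_right J_integrable[OF f], of \<mu>]
  by (simp add: J_map_def H_inner_def blinfun.scaleR_right mult.commute)

lemma J_diff:
  assumes "f \<in> L2_functions \<eta>" "g \<in> L2_functions \<eta>"
  shows "J_map \<eta> (\<lambda>x. f x - g x) = J_map \<eta> f - J_map \<eta> g"
  using J_integrable assms by (simp add: J_map_def scaleR_diff_left)

lemma J_minus: "J_map \<eta> (\<lambda>x. - f x) = - J_map \<eta> f"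
  by (simp add: J_map_def)

text \<open>\<open>J_map\<close> sees only the L2 class. This matters for derivatives, which are
  determined only up to null sets.\<close>

lemma J_cong_H_norm:
  assumes f: "f \<in> L2_functions \<eta>" and g: "g \<in> L2_functions \<eta>" and 0: "H_norm \<eta> (\<lambda>x. f x - g x) = 0"
  shows "J_map \<eta> f = J_map \<eta> g"
proof -
  have "(\<integral>x. (f x - g x)\<^sup>2 \<partial>\<eta>) = 0" using H_norm_sq[of \<eta> "\<lambda>x. f x - g x"] 0 by (simp add: H_inner_def power2_eq_square)
  then have "AE x in \<eta>. (f x - g x)\<^sup>2 = 0"
    using integral_nonneg_eq_0_iff_AE[OF L2_functionsD(2)[OF L2_diff[OF f g]]] by simp
  then have "AE x in \<eta>. f x *\<^sub>R x = g x *\<^sub>R x" by eventually_elim simp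
  moreover note [measurable] = L2_functionsD(1)[OF f] L2_functionsD(1)[OF g]
  have "(\<lambda>x. f x *\<^sub>R x) \<in> borel_measurable \<eta>" "(\<lambda>x. g x *\<^sub>R x) \<in> borel_measurable \<eta>"
    using borel_measurable_integrable J_integrable f g by blast+
  ultimately show ?thesis unfolding J_map_def by (intro integral_cong_AE)
qed

lemma tendsto_H_inner:
  assumes L2: "\<And>k. f k \<in> L2_functions \<eta>" "a \<in> L2_functions \<eta>" "\<And>k. g k \<in> L2_functions \<eta>" "b \<in> L2_functions \<eta>"
    and lim: "((\<lambda>k. H_norm \<eta> (\<lambda>x. f k x - a x)) \<longlongrightarrow> 0) F" "((\<lambda>k. H_norm \<eta> (\<lambda>x. g k x - b x)) \<longlongrightarrow> 0) F"
  shows "((\<lambda>k. H_inner \<eta> (f k) (g k)) \<longlongrightarrow> H_inner \<eta> a b) F"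
proof -
  let ?f = "\<lambda>k x. f k x - a x" and ?g = "\<lambda>k x. g k x - b x"
  have "((\<lambda>k. H_norm \<eta> (?f k) * H_norm \<eta> (?g k) + H_norm \<eta> (?f k) * H_norm \<eta> b + H_norm \<eta> a * H_norm \<eta> (?g k)) \<longlongrightarrow> 0 * 0 + 0 * H_norm \<eta> b + H_norm \<eta> a * 0) F"
    by (intro tendsto_intros lim)
  then have l: "((\<lambda>k. H_norm \<eta> (?f k) * H_norm \<eta> (?g k) + H_norm \<eta> (?f k) * H_norm \<eta> b + H_norm \<eta> a * H_norm \<eta> (?g k)) \<longlongrightarrow> 0) F" by simp
  have "((\<lambda>k. H_inner \<eta> (f k) (g k) - H_inner \<eta> a b) \<longlongrightarrow> 0) F"
  proof (rule tendsto_0_bound[OF l])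
    fix k
    have d: "?f k \<in> L2_functions \<eta>" "?g k \<in> L2_functions \<eta>" by (intro L2_diff L2)+
    have "has_bochner_integral \<eta> (\<lambda>x. ?f k x * ?g k x + ?f k x * b x + a x * ?g k x + a x * b x)
      (H_inner \<eta> (?f k) (?g k) + H_inner \<eta> (?f k) b + H_inner \<eta> a (?g k) + H_inner \<eta> a b)"
      unfolding H_inner_def by (intro has_bochner_integral_add has_bochner_integral_integrable L2_mult d L2)
    moreover have "(\<lambda>x. ?f k x * ?g k x + ?f k x * b x + a x * ?g k x + a x * b x) = (\<lambda>x. f k x * g k x)"
      by (rule ext) (simp add: algebra_simps)
    ultimately have "H_inner \<eta> (f k) (g k) = H_inner \<eta> (?f k) (?g k) + H_inner \<eta> (?f k) b + H_inner \<eta> a (?g k) + H_inner \<eta> a b"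
      by (simp add: has_bochner_integral_iff H_inner_def)
    then show "\<bar>H_inner \<eta> (f k) (g k) - H_inner \<eta> a b\<bar> \<le> H_norm \<eta> (?f k) * H_norm \<eta> (?g k) + H_norm \<eta> (?f k) * H_norm \<eta> b + H_norm \<eta> a * H_norm \<eta> (?g k)"
      using H_cauchy_schwarz[OF d] H_cauchy_schwarz[OF d(1) L2(4)] H_cauchy_schwarz[OF L2(2) d(2)] by linarith
  qed
  then show ?thesis by (simp add: LIM_zero_iff)
qed

text \<open>The source of norm compactness. For a bounded set of functionals, closeness at finitely
  many points d i of a dense sequence controls \<nu> - \<mu> on the union of small balls around
  them. The remaining set A m shrinks to the empty set as m grows, so the integral of |x|^2 over it
  tends to 0, and there the norm bound is enough.\<close>

lemma weak_star_L2_neighbourhood: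
  fixes e C :: real and K0 :: "('a \<Rightarrow>\<^sub>L real) set"
  assumes bound: "\<And>\<mu>. \<mu> \<in> K0 \<Longrightarrow> norm \<mu> \<le> C" and \<mu>: "\<mu> \<in> K0" and e: "0 < e"
  obtains D \<delta> where "finite D" "0 < \<delta>"
    "\<And>\<nu>. \<nu> \<in> K0 \<Longrightarrow> (\<forall>d\<in>D. \<bar>blinfun_apply \<nu> d - blinfun_apply \<mu> d\<bar> < \<delta>) \<Longrightarrow> (\<integral>x. (blinfun_apply (\<nu> - \<mu>) x)\<^sup>2 \<partial>\<eta>) < e"
proof -
  have C: "0 \<le> C" using bound[OF \<mu>] norm_ge_zero order_trans by blast
  \<comment> \<open>Near d i the difference is at most \<delta> at d i plus 2 C \<delta> for the
    displacement; this \<delta> makes the square of the sum e/3.\<close>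
  define \<delta> where "\<delta> = sqrt (e / 3) / (1 + 2 * C)"
  have \<delta>: "0 < \<delta>" using e C by (simp add: \<delta>_def)
  have \<delta>e: "((1 + 2 * C) * \<delta>)\<^sup>2 = e / 3" using e C by (simp add: \<delta>_def)
  obtain D0 :: "'a set" where D0: "countable D0" "\<And>X. open X \<Longrightarrow> X \<noteq> {} \<Longrightarrow> \<exists>d\<in>D0. d \<in> X"
    using countable_dense_exists by blast
  then have ne: "D0 \<noteq> {}" using D0(2)[of UNIV] by auto
  define d where "d = from_nat_into D0"
  have d: "range d = D0" unfolding d_def by (rule range_from_nat_into[OF ne D0(1)])
  define A where "A m = {x. \<forall>i\<le>m. \<delta> \<le> norm (x - d i)}" for m :: nat
  have Am[measurable]: "A m \<in> sets borel" for m
  proof -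
    have "closed {x. \<delta> \<le> norm (x - d i)}" for i by (intro closed_Collect_le continuous_intros)
    moreover have "A m = (\<Inter>i\<in>{..m}. {x. \<delta> \<le> norm (x - d i)})" by (auto simp: A_def)
    ultimately show ?thesis by (auto intro!: borel_closed)
  qed
  have "(\<lambda>m. \<integral>x. indicat_real (A m) x * (norm x)\<^sup>2 \<partial>\<eta>) \<longlonglongrightarrow> (\<integral>x. 0 \<partial>\<eta>)"
  proof (rule integral_dominated_convergence[where w = "\<lambda>x. (norm x)\<^sup>2"])
    show "AE x in \<eta>. (\<lambda>m. indicat_real (A m) x * (norm x)\<^sup>2) \<longlonglongrightarrow> 0"
    proof (rule AE_I2)
      fix x :: 'a
      have "ball x \<delta> \<noteq> {}" using \<delta> by simp
      then obtain i where i: "d i \<in> ball x \<delta>" using D0(2)[OF open_ball] d by blast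
      have "indicat_real (A m) x * (norm x)\<^sup>2 = 0" if "i \<le> m" for m
        using i that by (auto simp: A_def dist_norm indicator_def)
      then have "\<forall>\<^sub>F m in sequentially. indicat_real (A m) x * (norm x)\<^sup>2 = 0"
        by (intro eventually_sequentiallyI)
      then show "(\<lambda>m. indicat_real (A m) x * (norm x)\<^sup>2) \<longlonglongrightarrow> 0" by (rule tendsto_eventually)
    qed
    show "integrable \<eta> (\<lambda>x. (norm x)\<^sup>2)" by (rule integrable_norm_sq)
  qed (auto simp: indicator_def)
  then have lim: "(\<lambda>m. \<integral>x. indicat_real (A m) x * (norm x)\<^sup>2 \<partial>\<eta>) \<longlonglongrightarrow> 0" by simp
  \<comment> \<open>On A m the square is at most 4 C^2 |x|^2; this threshold keeps its integral
    below e/3, and the summand 1 covers C = 0.\<close>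
  have "0 < e / (3 * (4 * C\<^sup>2 + 1))" using e by (simp add: add_nonneg_pos)
  from order_tendstoD(2)[OF lim this] obtain m where m: "(\<integral>x. indicat_real (A m) x * (norm x)\<^sup>2 \<partial>\<eta>) < e / (3 * (4 * C\<^sup>2 + 1))"
    by (auto simp: eventually_sequentially)
  have Aint: "integrable \<eta> (\<lambda>x. indicat_real (A m) x * (norm x)\<^sup>2)"
    by (rule Bochner_Integration.integrable_bound[OF integrable_norm_sq]) (auto simp: indicator_def)
  show thesis
  proof (rule that)
    show "finite (d ` {..m})" by simp
    show "0 < \<delta>" by (rule \<delta>)
    fix \<nu> assume \<nu>: "\<nu> \<in> K0" "\<forall>x\<in>d ` {..m}. \<bar>blinfun_apply \<nu> x - blinfun_apply \<mu> x\<bar> < \<delta>"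
    let ?h = "\<nu> - \<mu>"
    have nh: "norm ?h \<le> 2 * C" using norm_triangle_ineq4[of \<nu> \<mu>] bound[OF \<nu>(1)] bound[OF \<mu>] by simp
    have hx: "\<bar>blinfun_apply ?h x\<bar> \<le> 2 * C * norm x" for x
      using norm_blinfun[of ?h x] mult_right_mono[OF nh, of "norm x"] by simp
    have "(blinfun_apply ?h x)\<^sup>2 \<le> e / 3 + 4 * C\<^sup>2 * (indicat_real (A m) x * (norm x)\<^sup>2)" for x
    proof (cases "x \<in> A m")
      case True
      have "\<bar>blinfun_apply ?h x\<bar>\<^sup>2 \<le> (2 * C * norm x)\<^sup>2" by (rule power_mono[OF hx]) simp
      then show ?thesis using True e by (simp add: power_mult_distrib)
    next
      case False
      then obtain i where i: "i \<le> m" "norm (x - d i) < \<delta>" by (auto simp: A_def not_le)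
      have "blinfun_apply ?h x = blinfun_apply ?h (d i) + blinfun_apply ?h (x - d i)" by (simp add: blinfun.diff_right)
      moreover have "\<bar>blinfun_apply ?h (d i)\<bar> \<le> \<delta>" using \<nu>(2) i by (auto simp: blinfun.diff_left intro: less_imp_le)
      moreover have "2 * C * norm (x - d i) \<le> 2 * C * \<delta>" using i C by (intro mult_left_mono) auto
      ultimately have "\<bar>blinfun_apply ?h x\<bar> \<le> (1 + 2 * C) * \<delta>" using hx[of "x - d i"] by (simp add: algebra_simps)
      then have "\<bar>blinfun_apply ?h x\<bar>\<^sup>2 \<le> ((1 + 2 * C) * \<delta>)\<^sup>2" by (rule power_mono) simp
      then show ?thesis using False \<delta>e by simp
    qed
    then have "(\<integral>x. (blinfun_apply ?h x)\<^sup>2 \<partial>\<eta>) \<le> (\<integral>x. e / 3 + 4 * C\<^sup>2 * (indicat_real (A m) x * (norm x)\<^sup>2) \<partial>\<eta>)"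
      by (intro integral_mono functional_integrable_sq Bochner_Integration.integrable_add integrable_mult_right Aint) auto
    also have "\<dots> = e / 3 + 4 * C\<^sup>2 * (\<integral>x. indicat_real (A m) x * (norm x)\<^sup>2 \<partial>\<eta>)"
      using Aint by (subst Bochner_Integration.integral_add) auto
    also have "4 * C\<^sup>2 * (\<integral>x. indicat_real (A m) x * (norm x)\<^sup>2 \<partial>\<eta>) \<le> 4 * C\<^sup>2 * (e / (3 * (4 * C\<^sup>2 + 1)))"
      using m by (intro mult_left_mono) auto
    also have "\<dots> \<le> e / 3"
    proof -
      have "4 * C\<^sup>2 / (4 * C\<^sup>2 + 1) \<le> 1" by (simp add: divide_le_eq_1 add_nonneg_pos)
      then have "4 * C\<^sup>2 / (4 * C\<^sup>2 + 1) * (e / 3) \<le> 1 * (e / 3)" using e by (intro mult_right_mono) auto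
      then show ?thesis by (simp add: mult.commute)
    qed
    finally show "(\<integral>x. (blinfun_apply ?h x)\<^sup>2 \<partial>\<eta>) < e" using e by simp
  qed
qed

end

section \<open>Monotone games\<close>

locale gaussian_game = gaussian_measure \<eta>
  for \<eta> :: "'a::{banach, second_countable_topology} measure" +
  fixes K :: "'n::finite \<Rightarrow> ('a \<Rightarrow>\<^sub>L real) set"
    and F :: "'n \<Rightarrow> ('n \<Rightarrow> 'a \<Rightarrow>\<^sub>L real) \<Rightarrow> real"
  assumes K_nonempty: "\<And>j. K j \<noteq> {}"
    and K_convex: "\<And>j. convex (K j)"
    and K_compact: "\<And>j. compactin weak_star (K j)"
    and F_continuous:
      "\<And>j. continuous_map (subtopology weak_star_tuples (Pi UNIV K)) euclideanreal (F j)"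
    and F_convex: "\<And>\<mu> j. \<mu> \<in> Pi UNIV K \<Longrightarrow> convex_on (K j) (\<lambda>\<nu>. F j (\<mu>(j := \<nu>)))"
    and F_monotone: "monotone_payoffs K F"
begin

abbreviation strategies :: "('n \<Rightarrow> 'a \<Rightarrow>\<^sub>L real) set" where "strategies \<equiv> Pi UNIV K"

abbreviation strategy_topology :: "('n \<Rightarrow> 'a \<Rightarrow>\<^sub>L real) topology" where
  "strategy_topology \<equiv> subtopology weak_star_tuples strategies"

definition ip :: "('n \<Rightarrow> 'a \<Rightarrow>\<^sub>L real) \<Rightarrow> ('n \<Rightarrow> 'a \<Rightarrow>\<^sub>L real) \<Rightarrow> real" where
  "ip u v = HN_inner \<eta> (HN_of u) (HN_of v)"

lemma ip_sum: "ip u v = (\<Sum>j\<in>UNIV. H_inner \<eta> (u j) (v j))"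
  by (simp add: ip_def HN_inner_def HN_of_def)

lemma ip_J: "ip u v = (\<Sum>j\<in>UNIV. u j (J_map \<eta> (v j)))"
  by (simp add: ip_sum J_apply functional_L2)

lemma H_inner_integrable: "integrable \<eta> (\<lambda>x. blinfun_apply (f :: 'a \<Rightarrow>\<^sub>L real) x * blinfun_apply (g :: 'a \<Rightarrow>\<^sub>L real) x)"
  by (intro L2_mult functional_L2)

sublocale pre_hilbert ip
proof
  fix x y z :: "'n \<Rightarrow> 'a \<Rightarrow>\<^sub>L real" and r :: real
  show "ip x y = ip y x" by (simp add: ip_sum H_inner_def mult.commute)
  show "ip (x + y) z = ip x z + ip y z"
    by (simp add: ip_sum H_inner_def blinfun.add_left distrib_right sum.distrib H_inner_integrable)
  show "ip (r *\<^sub>R x) y = r * ip x y"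
    by (simp add: ip_sum H_inner_def blinfun.scaleR_left sum_distrib_left mult.assoc)
  show "0 \<le> ip x x" by (simp add: ip_def HN_inner_nonneg)
  \<comment> \<open>Nondegeneracy of the measure enters here: a functional with vanishing second
    moment is 0.\<close>
  show "x = 0" if "ip x x = 0"
  proof
    fix j
    have sq: "H_inner \<eta> (x i) (x i) = (\<integral>t. (x i t)\<^sup>2 \<partial>\<eta>)" for i by (simp add: H_inner_def power2_eq_square)
    have nn: "0 \<le> H_inner \<eta> (x i) (x i)" for i unfolding sq by (intro Bochner_Integration.integral_nonneg) simp
    have "H_inner \<eta> (x j) (x j) = 0"
      using that unfolding ip_sum by (subst (asm) sum_nonneg_eq_0_iff) (auto simp: nn)
    then show "x j = 0 j" using functional_second_moment_pos[of "x j"] by (auto simp: sq)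
  qed
qed

lemma HN_of_L2N: "HN_of u \<in> L2N \<eta>"
  by (simp add: L2N_def HN_of_def functional_L2)

lemma nrm_HN: "nrm u = HN_norm \<eta> (HN_of u)"
  by (simp add: nrm_def ip_def HN_norm_def)

lemma HN_of_diff: "HN_of (u - v) = (\<lambda>j x. HN_of u j x - HN_of v j x)"
  by (simp add: HN_of_def fun_eq_iff blinfun.diff_left)

lemma HN_dist_HN_of: "HN_dist \<eta> (HN_of u) (HN_of v) = nrm (u - v)"
  by (simp only: nrm_HN HN_dist_def HN_of_diff)

lemma HN_of_quotient:
  "(\<lambda>j x. (HN_of p j x - HN_of q j x) / r) = HN_of ((1 / r) *\<^sub>R (p - q))"
  by (simp add: HN_of_def fun_eq_iff blinfun.diff_left blinfun.scaleR_left)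

lemma nrm_component_le: "H_norm \<eta> (blinfun_apply (u j)) \<le> nrm u"
  unfolding nrm_HN using H_norm_component_le[of \<eta> "HN_of u" j] by (simp add: HN_of_def)

lemma strategies_convex: "convex strategies"
proof (rule convexI)
  fix x y :: "'n \<Rightarrow> 'a \<Rightarrow>\<^sub>L real" and u v :: real
  assume "x \<in> strategies" "y \<in> strategies" "0 \<le> u" "0 \<le> v" "u + v = 1"
  then show "u *\<^sub>R x + v *\<^sub>R y \<in> strategies" by (simp add: Pi_iff convexD[OF K_convex])
qed

lemma strategies_nonempty: "strategies \<noteq> {}"
  using K_nonempty by (simp add: Pi_eq_empty)

lemma strategies_update: "p \<in> strategies \<Longrightarrow> \<nu> \<in> K j \<Longrightarrow> p(j := \<nu>) \<in> strategies"
  by auto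

lemma strategies_compact: "compactin weak_star_tuples strategies"
proof -
  have "strategies = PiE UNIV K" by (auto simp: PiE_def)
  then show ?thesis using K_compact by (simp add: compactin_PiE)
qed

lemma topspace_weak_star_tuples: "topspace weak_star_tuples = UNIV"
  by (simp add: strong_operator_topology_topspace)

lemma topspace_strategies: "topspace strategy_topology = strategies"
  by (simp add: topspace_weak_star_tuples del: topspace_product_topology)

lemma strategies_compact': "compactin strategy_topology strategies"
  using strategies_compact by (simp add: compactin_subtopology)

lemma bound_exists: "\<exists>C. \<forall>j. \<forall>\<mu>\<in>K j. norm \<mu> \<le> C"
proof -
  have "\<forall>j. \<exists>C. \<forall>\<mu>\<in>K j. norm \<mu> \<le> C" using weak_star_bounded[OF K_compact] by metis
  then obtain C where C: "\<And>j \<mu>. \<mu> \<in> K j \<Longrightarrow> norm \<mu> \<le> C j" by metis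
  have "norm \<mu> \<le> Max (range C)" if "\<mu> \<in> K j" for j \<mu> using C[OF that] by (rule order_trans) simp
  then show ?thesis by blast
qed

lemma component_continuous: "continuous_map weak_star_tuples euclideanreal (\<lambda>q. blinfun_apply (q j) x)"
proof -
  have "continuous_map weak_star_tuples weak_star (\<lambda>q. q j)"
    by (rule continuous_map_product_projection) simp
  from continuous_map_compose[OF this strong_operator_topology_continuous_evaluation[of x]]
  show ?thesis by (simp add: o_def)
qed

text \<open>\<open>weak_star_L2_neighbourhood\<close> is applied to each component, with e^2 shared
  equally among the players; the finitely many evaluations that it returns define a weak*
  neighbourhood.\<close>

lemma nrm_neighbourhood:
  assumes p: "p \<in> strategies" and e: "0 < e"
  shows "\<exists>U. openin strategy_topology U \<and> p \<in> U \<and> (\<forall>q\<in>U. nrm (q - p) < e)"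
proof -
  obtain C where C: "\<And>j \<mu>. \<mu> \<in> K j \<Longrightarrow> norm \<mu> \<le> C" using bound_exists by blast
  define e' where "e' = e\<^sup>2 / real CARD('n)"
  have e': "0 < e'" using e by (simp add: e'_def)
  have "\<exists>D \<delta>. finite D \<and> 0 < \<delta> \<and> (\<forall>\<nu>\<in>K j. (\<forall>d\<in>D. \<bar>blinfun_apply \<nu> d - blinfun_apply (p j) d\<bar> < \<delta>) \<longrightarrow> (\<integral>x. (blinfun_apply (\<nu> - p j) x)\<^sup>2 \<partial>\<eta>) < e')" for j
    using weak_star_L2_neighbourhood[of "K j" C "p j" e'] C p e' by (metis PiE UNIV_I)
  then obtain D \<delta> where D: "\<And>j. finite (D j)" "\<And>j. 0 < \<delta> j"
    "\<And>j \<nu>. \<nu> \<in> K j \<Longrightarrow> (\<forall>d\<in>D j. \<bar>blinfun_apply \<nu> d - blinfun_apply (p j) d\<bar> < \<delta> j) \<Longrightarrow> (\<integral>x. (blinfun_apply (\<nu> - p j) x)\<^sup>2 \<partial>\<eta>) < e'"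
    by metis
  define V where "V j d = {q \<in> topspace weak_star_tuples. blinfun_apply (q j) d \<in> {blinfun_apply (p j) d - \<delta> j<..<blinfun_apply (p j) d + \<delta> j}}" for j d
  have V: "openin weak_star_tuples (V j d)" for j d
    unfolding V_def by (rule openin_continuous_map_preimage[OF component_continuous]) simp
  define W where "W = (\<Inter>j\<in>UNIV. (\<Inter>d\<in>D j. V j d) \<inter> topspace weak_star_tuples) \<inter> topspace weak_star_tuples"
  have "openin weak_star_tuples W"
    unfolding W_def using D(1) V by (intro openin_INT) auto
  then have "openin strategy_topology (strategies \<inter> W)" by (rule openin_subtopology_Int2)
  moreover have "p \<in> strategies \<inter> W" using p D(2) by (auto simp: W_def V_def topspace_weak_star_tuples simp del: topspace_product_topology)
  moreover have "nrm (q - p) < e" if q: "q \<in> strategies \<inter> W" for q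
  proof -
    have "H_inner \<eta> (q j - p j) (q j - p j) < e'" for j
    proof -
      have "\<forall>d\<in>D j. \<bar>blinfun_apply (q j) d - blinfun_apply (p j) d\<bar> < \<delta> j"
        using q by (fastforce simp: W_def V_def)
      moreover have "q j \<in> K j" using q by auto
      ultimately show ?thesis using D(3)[of "q j" j] by (simp add: H_inner_def power2_eq_square)
    qed
    then have "ip (q - p) (q - p) < (\<Sum>j\<in>(UNIV :: 'n set). e')"
      unfolding ip_sum by (intro sum_strict_mono) auto
    also have "\<dots> = e\<^sup>2" by (simp add: e'_def)
    finally have "(nrm (q - p))\<^sup>2 < e\<^sup>2" by (simp add: nrm_sq)
    then show ?thesis by (rule power2_less_imp_less) (use e in simp)
  qed
  ultimately show ?thesis by blast
qed

lemma continuous_map_of_nrm: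
  assumes "\<And>p e. p \<in> strategies \<Longrightarrow> 0 < e \<Longrightarrow> \<exists>d>0. \<forall>q\<in>strategies. nrm (q - p) < d \<longrightarrow> \<bar>f q - f p\<bar> < (e::real)"
  shows "continuous_map strategy_topology euclideanreal f"
proof -
  have "continuous_map strategy_topology Met_TC.mtopology f"
    unfolding Met_TC.continuous_map_to_metric topspace_strategies
  proof (intro ballI allI impI)
    fix p e :: real assume "0 < e"
    fix p assume p: "p \<in> strategies"
    obtain d where d: "0 < d" "\<And>q. q \<in> strategies \<Longrightarrow> nrm (q - p) < d \<Longrightarrow> \<bar>f q - f p\<bar> < e"
      using assms[OF p \<open>0 < e\<close>] by blast
    obtain U where U: "openin strategy_topology U" "p \<in> U" "\<And>q. q \<in> U \<Longrightarrow> nrm (q - p) < d"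
      using nrm_neighbourhood[OF p d(1)] by blast
    have "U \<subseteq> strategies" using openin_subset[OF U(1)] unfolding topspace_strategies .
    then show "\<exists>U. openin strategy_topology U \<and> p \<in> U \<and> (\<forall>y\<in>U. f y \<in> Met_TC.mball (f p) e)"
      using U d(2) by (intro exI[of _ U]) (auto simp: dist_real_def abs_minus_commute)
  qed
  then show ?thesis by simp
qed

text \<open>On the compact set of strategies the weak* topology and the topology of $H^N$ coincide.\<close>

lemma tendsto_of_nrm:
  assumes f: "continuous_map strategy_topology euclideanreal f"
    and mem: "\<forall>\<^sub>F k in G. q k \<in> strategies" and p: "p \<in> strategies"
    and lim: "((\<lambda>k. nrm (q k - p)) \<longlongrightarrow> 0) G"
  shows "((\<lambda>k. f (q k)) \<longlongrightarrow> f p) G"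
proof (rule topological_tendstoI)
  fix S :: "real set" assume S: "open S" "f p \<in> S"
  \<comment> \<open>The bad points form a compact set that omits p. The distance to p is weak*
    continuous, so it attains its minimum there, and this is positive because the norm is
    definite.\<close>
  define C where "C = {q \<in> topspace strategy_topology. f q \<in> - S}"
  have "closedin strategy_topology C"
    unfolding C_def by (rule closedin_continuous_map_preimage[OF f]) (use S in \<open>simp add: closed_Compl\<close>)
  then have Cc: "compactin strategy_topology C"
    by (rule closed_compactin[OF strategies_compact', rotated]) (auto simp: C_def topspace_strategies)
  have nc: "continuous_map strategy_topology euclideanreal (\<lambda>q. nrm (q - p))"
  proof (rule continuous_map_of_nrm)
    fix r e assume "0 < (e::real)"
    then show "\<exists>d>0. \<forall>q\<in>strategies. nrm (q - r) < d \<longrightarrow> \<bar>nrm (q - p) - nrm (r - p)\<bar> < e"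
      using abs_nrm_diff[of "_ - p" "r - p"] by (intro exI[of _ e]) (auto intro: le_less_trans)
  qed
  have "compact ((\<lambda>q. nrm (q - p)) ` C)" using image_compactin[OF Cc nc] by simp
  have "\<exists>d>0. \<forall>q\<in>C. d \<le> nrm (q - p)"
  proof (cases "C = {}")
    case True then show ?thesis by (intro exI[of _ 1]) simp
  next
    case False
    then obtain m where m: "m \<in> (\<lambda>q. nrm (q - p)) ` C" "\<And>x. x \<in> (\<lambda>q. nrm (q - p)) ` C \<Longrightarrow> m \<le> x"
      using compact_attains_inf[OF \<open>compact ((\<lambda>q. nrm (q - p)) ` C)\<close>] by blast
    then obtain c where c: "c \<in> C" "m = nrm (c - p)" by blast
    have "c \<noteq> p" using c S by (auto simp: C_def)
    then have "c - p \<noteq> 0" by (metis eq_iff_diff_eq_0)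
    then have "nrm (c - p) \<noteq> 0" unfolding nrm_eq_0 .
    then have "0 < m" using c nrm_nonneg[of "c - p"] by linarith
    then show ?thesis using m(2) by blast
  qed
  then obtain d where d: "0 < d" "\<And>q. q \<in> C \<Longrightarrow> d \<le> nrm (q - p)" by blast
  from order_tendstoD(2)[OF lim d(1)] mem show "\<forall>\<^sub>F k in G. f (q k) \<in> S"
  proof eventually_elim
    case (elim k)
    then have "q k \<notin> C" using d(2)[of "q k"] by auto
    then show ?case using elim unfolding C_def topspace_strategies by simp
  qed
qed

text \<open>On strategies the topology of the norm metric is contained in the weak* topology, so
  compactness carries over to it, and in a metric space compactness is sequential.\<close>

lemma strategies_seq_compact:
  assumes "range \<sigma> \<subseteq> strategies"
  shows "\<exists>l\<in>strategies. \<exists>r::nat\<Rightarrow>nat. strict_mono r \<and> (\<lambda>n. nrm (\<sigma> (r n) - l)) \<longlonglongrightarrow> 0"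
proof -
  interpret E: Metric_space UNIV "\<lambda>u v. nrm (u - v)"
  proof
    fix x y z :: "'n \<Rightarrow> 'a \<Rightarrow>\<^sub>L real"
    show "nrm (x - y) = nrm (y - x)" by (rule nrm_minus_commute)
    show "nrm (x - y) = 0 \<longleftrightarrow> x = y" unfolding nrm_eq_0 by simp
    show "nrm (x - z) \<le> nrm (x - y) + nrm (y - z)" by (rule nrm_diff_triangle)
  qed simp
  have "continuous_map strategy_topology E.mtopology (\<lambda>q. q)"
    unfolding E.continuous_map_to_metric topspace_strategies
  proof (intro ballI allI impI)
    fix p :: "'n \<Rightarrow> 'a \<Rightarrow>\<^sub>L real" and e :: real assume "p \<in> strategies" "0 < e"
    from nrm_neighbourhood[OF this]
    show "\<exists>U. openin strategy_topology U \<and> p \<in> U \<and> (\<forall>y\<in>U. y \<in> E.mball p e)"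
      by (auto simp: E.in_mball nrm_minus_commute)
  qed
  from image_compactin[OF strategies_compact' this] have "compactin E.mtopology strategies" by simp
  then obtain l r where "l \<in> strategies" "strict_mono (r :: nat \<Rightarrow> nat)" "limitin E.mtopology (\<sigma> \<circ> r) l sequentially"
    using assms unfolding E.compactin_sequentially by blast
  moreover from this(3) have "(\<lambda>n. nrm (\<sigma> (r n) - l)) \<longlonglongrightarrow> 0"
    unfolding E.limitin_metric_dist_null by (simp add: o_def)
  ultimately show ?thesis by blast
qed

lemma combination_continuous:
  "continuous_map euclidean weak_star_tuples (\<lambda>\<alpha>::nat \<Rightarrow> real. \<Sum>i<m. \<alpha> i *\<^sub>R \<nu> i)"
  unfolding continuous_map_componentwise_UNIV continuous_on_strong_operator_topo_iff_coordinatewise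
proof (intro allI)
  fix j x
  have "continuous_on UNIV (\<lambda>\<alpha>::nat \<Rightarrow> real. \<Sum>i<m. \<alpha> i * blinfun_apply (\<nu> i j) x)"
    by (intro continuous_intros continuous_on_product_then_coordinatewise[OF continuous_on_id])
  then show "continuous_map euclidean euclidean (\<lambda>\<alpha>::nat \<Rightarrow> real. blinfun_apply ((\<Sum>i<m. \<alpha> i *\<^sub>R \<nu> i) j) x)"
    by (simp add: sum_fun_apply blinfun.sum_left blinfun.scaleR_left)
qed

lemma F_update_continuous:
  assumes \<nu>: "\<nu> \<in> K j"
  shows "continuous_map strategy_topology euclideanreal (\<lambda>p. F j (p(j := \<nu>)))"
proof -
  have "continuous_map strategy_topology strategy_topology (\<lambda>p. p(j := \<nu>))"
    unfolding continuous_map_in_subtopology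
  proof
    have "continuous_map strategy_topology weak_star (\<lambda>p. (p(j := \<nu>)) i)" for i
      by (cases "i = j") (auto intro!: continuous_map_from_subtopology continuous_map_product_projection simp: strong_operator_topology_topspace)
    then show "continuous_map strategy_topology weak_star_tuples (\<lambda>p. p(j := \<nu>))"
      unfolding continuous_map_componentwise_UNIV by blast
    show "(\<lambda>p. p(j := \<nu>)) \<in> topspace strategy_topology \<rightarrow> strategies"
      unfolding topspace_strategies using \<nu> by (simp add: Pi_iff)
  qed
  from continuous_map_compose[OF this F_continuous[of j]] show ?thesis by (simp add: o_def)
qed

text \<open>The resolvent: a Nash equilibrium of the game with the payoffs
  $F_j + \frac{1}{2\tau}\|\cdot - z_j\|^2$.\<close>

lemma resolvent_exists:
  assumes \<tau>: "0 < \<tau>" and z: "z \<in> strategies"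
  shows "\<exists>p\<in>strategies. \<forall>j. J_map \<eta> (((1/\<tau>) *\<^sub>R (z - p)) j) \<in> partial_subdiff K F j p"
proof -
  \<comment> \<open>A Nikaido-Isoda function in which the quadratic penalty enters through its
    derivative at p. It is convex in \<nu>, and its nonnegativity, tested with deviations of a
    single player, is the subgradient inclusion.\<close>
  define \<Phi> where "\<Phi> p \<nu> = (\<Sum>j\<in>UNIV. F j (p(j := \<nu> j)) - F j p) - (1/\<tau>) * ip (\<nu> - p) (z - p)" for p \<nu>
  have "\<exists>p\<in>strategies. \<forall>\<nu>\<in>strategies. 0 \<le> \<Phi> p \<nu>"
  proof (rule ky_fan)
    show "compactin weak_star_tuples strategies" by (rule strategies_compact)
    show "convex strategies" by (rule strategies_convex)
    show "strategies \<noteq> {}" by (rule strategies_nonempty)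
    show "continuous_map euclidean weak_star_tuples (\<lambda>\<alpha>::nat \<Rightarrow> real. \<Sum>i<m. \<alpha> i *\<^sub>R \<nu> i)" for m \<nu>
      by (rule combination_continuous)
    show "0 \<le> \<Phi> p p" for p by (simp add: \<Phi>_def)
  next
    fix \<nu> assume \<nu>: "\<nu> \<in> strategies"
    have Fc: "continuous_map strategy_topology euclideanreal (\<lambda>p. F j (p(j := \<nu> j)))" for j
      by (rule F_update_continuous) (use \<nu> in \<open>simp add: Pi_iff\<close>)
    have ipc: "continuous_map strategy_topology euclideanreal (\<lambda>p. ip (\<nu> - p) (z - p))"
    proof (rule continuous_map_of_nrm)
      fix p and e :: real assume e: "0 < e"
      let ?a = "nrm (\<nu> - p)" and ?b = "nrm (z - p)"
      define d where "d = min 1 (e / (?a + ?b + 2))"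
      have ab: "0 < ?a + ?b + 2" using nrm_nonneg[of "\<nu> - p"] nrm_nonneg[of "z - p"] by linarith
      have d: "0 < d" "d \<le> 1" using e ab by (auto simp: d_def)
      have "d \<le> e / (?a + ?b + 2)" by (simp add: d_def)
      then have d3: "d * (?a + ?b + 2) \<le> e" using ab by (simp add: pos_le_divide_eq)
      show "\<exists>d>0. \<forall>q\<in>strategies. nrm (q - p) < d \<longrightarrow> \<bar>ip (\<nu> - q) (z - q) - ip (\<nu> - p) (z - p)\<bar> < e"
      proof (intro exI[of _ d] conjI ballI impI)
        fix q assume q: "nrm (q - p) < d"
        let ?e = "q - p"
        have "ip (\<nu> - q) (z - q) - ip (\<nu> - p) (z - p) = - ip ?e (z - p) - ip (\<nu> - p) ?e + ip ?e ?e"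
          by (simp add: ip_simps)
        then have "\<bar>ip (\<nu> - q) (z - q) - ip (\<nu> - p) (z - p)\<bar> \<le> nrm ?e * ?b + ?a * nrm ?e + nrm ?e * nrm ?e"
          using abs_ip_le[of ?e "z - p"] abs_ip_le[of "\<nu> - p" ?e] abs_ip_le[of ?e ?e] by linarith
        also have "\<dots> = nrm ?e * (?a + ?b + nrm ?e)" by (simp add: algebra_simps)
        also have "\<dots> \<le> d * (?a + ?b + nrm ?e)" using q by (intro mult_right_mono) auto
        also have "\<dots> < d * (?a + ?b + 2)" using q d by (intro mult_strict_left_mono) auto
        finally show "\<bar>ip (\<nu> - q) (z - q) - ip (\<nu> - p) (z - p)\<bar> < e" using d3 by simp
      qed (rule d)
    qed
    show "continuous_map strategy_topology euclideanreal (\<lambda>p. \<Phi> p \<nu>)"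
      unfolding \<Phi>_def by (intro continuous_intros Fc F_continuous ipc) auto
  next
    fix p assume p: "p \<in> strategies"
    show "convex_on strategies (\<Phi> p)"
    proof (rule convex_onI)
      fix t :: real and x y assume t: "0 < t" "t < 1" and xy: "x \<in> strategies" "y \<in> strategies"
      have "F j (p(j := ((1 - t) *\<^sub>R x + t *\<^sub>R y) j)) - F j p
        \<le> (1 - t) * (F j (p(j := x j)) - F j p) + t * (F j (p(j := y j)) - F j p)" for j
      proof -
        have "F j (p(j := (1 - t) *\<^sub>R x j + t *\<^sub>R y j)) \<le> (1 - t) * F j (p(j := x j)) + t * F j (p(j := y j))"
          using convex_onD[OF F_convex[OF p, of j], of t "x j" "y j"] t xy by auto
        then show ?thesis by (simp add: algebra_simps)
      qed
      then have "(\<Sum>j\<in>UNIV. F j (p(j := ((1 - t) *\<^sub>R x + t *\<^sub>R y) j)) - F j p)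
        \<le> (\<Sum>j\<in>UNIV. (1 - t) * (F j (p(j := x j)) - F j p) + t * (F j (p(j := y j)) - F j p))"
        by (intro sum_mono)
      then have s: "(\<Sum>j\<in>UNIV. F j (p(j := ((1 - t) *\<^sub>R x + t *\<^sub>R y) j)) - F j p)
        \<le> (1 - t) * (\<Sum>j\<in>UNIV. F j (p(j := x j)) - F j p) + t * (\<Sum>j\<in>UNIV. F j (p(j := y j)) - F j p)"
        by (simp only: sum.distrib sum_distrib_left)
      have i: "ip ((1 - t) *\<^sub>R x + t *\<^sub>R y - p) (z - p) = (1 - t) * ip (x - p) (z - p) + t * ip (y - p) (z - p)"
        unfolding ip_diff_left ip_add_left ip_scaleR_left by (simp add: algebra_simps)
      show "\<Phi> p ((1 - t) *\<^sub>R x + t *\<^sub>R y) \<le> (1 - t) * \<Phi> p x + t * \<Phi> p y"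
      proof -
        have "(1/\<tau>) * ((1 - t) * a + t * b) = (1 - t) * ((1/\<tau>) * a) + t * ((1/\<tau>) * b)" for a b
          by (simp add: distrib_left mult.left_commute)
        then show ?thesis using s unfolding \<Phi>_def i right_diff_distrib[of "1 - t"] right_diff_distrib[of t] by simp
      qed
    qed (rule strategies_convex)
  qed
  then obtain p where p: "p \<in> strategies" and ge: "\<And>\<nu>. \<nu> \<in> strategies \<Longrightarrow> 0 \<le> \<Phi> p \<nu>" by blast
  have "J_map \<eta> (((1/\<tau>) *\<^sub>R (z - p)) j) \<in> partial_subdiff K F j p" for j
    unfolding partial_subdiff_def
  proof (intro CollectI ballI)
    fix \<nu> assume \<nu>: "\<nu> \<in> K j"
    let ?\<nu> = "p(j := \<nu>)"
    have "(\<Sum>i\<in>UNIV. F i (p(i := ?\<nu> i)) - F i p) = (\<Sum>i\<in>UNIV. if i = j then F j ?\<nu> - F j p else 0)"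
      by (rule sum.cong) auto
    then have s: "(\<Sum>i\<in>UNIV. F i (p(i := ?\<nu> i)) - F i p) = F j ?\<nu> - F j p" by simp
    have "ip (?\<nu> - p) ((1/\<tau>) *\<^sub>R (z - p)) = (\<Sum>i\<in>UNIV. if i = j then blinfun_apply (\<nu> - p j) (J_map \<eta> (((1/\<tau>) *\<^sub>R (z - p)) j)) else 0)"
      unfolding ip_J by (rule sum.cong) auto
    then have i: "(1/\<tau>) * ip (?\<nu> - p) (z - p) = blinfun_apply (\<nu> - p j) (J_map \<eta> (((1/\<tau>) *\<^sub>R (z - p)) j))"
      by (simp add: ip_scaleR_right)
    have "0 \<le> \<Phi> p ?\<nu>" by (rule ge[OF strategies_update[OF p \<nu>]])
    then show "F j p + blinfun_apply (\<nu> - p j) (J_map \<eta> (((1/\<tau>) *\<^sub>R (z - p)) j)) \<le> F j ?\<nu>"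
      unfolding \<Phi>_def s i by simp
  qed
  with p show ?thesis by blast
qed

definition R :: "real \<Rightarrow> ('n \<Rightarrow> 'a \<Rightarrow>\<^sub>L real) \<Rightarrow> 'n \<Rightarrow> 'a \<Rightarrow>\<^sub>L real" where
  "R \<tau> z = (SOME p. p \<in> strategies \<and> (\<forall>j. J_map \<eta> (((1/\<tau>) *\<^sub>R (z - p)) j) \<in> partial_subdiff K F j p))"

lemma R_in: "0 < \<tau> \<Longrightarrow> z \<in> strategies \<Longrightarrow> R \<tau> z \<in> strategies"
  and R_subdiff: "0 < \<tau> \<Longrightarrow> z \<in> strategies \<Longrightarrow> J_map \<eta> (((1/\<tau>) *\<^sub>R (z - R \<tau> z)) j) \<in> partial_subdiff K F j (R \<tau> z)"
proof -
  assume "0 < \<tau>" "z \<in> strategies"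
  then have "\<exists>p. p \<in> strategies \<and> (\<forall>j. J_map \<eta> (((1/\<tau>) *\<^sub>R (z - p)) j) \<in> partial_subdiff K F j p)"
    using resolvent_exists by blast
  from someI_ex[OF this] show "R \<tau> z \<in> strategies" "J_map \<eta> (((1/\<tau>) *\<^sub>R (z - R \<tau> z)) j) \<in> partial_subdiff K F j (R \<tau> z)"
    unfolding R_def by blast+
qed

lemma monotone_L2:
  assumes "p \<in> strategies" "q \<in> strategies" "v \<in> L2N \<eta>" "w \<in> L2N \<eta>"
    "\<And>j. J_map \<eta> (v j) \<in> partial_subdiff K F j p" "\<And>j. J_map \<eta> (w j) \<in> partial_subdiff K F j q"
  shows "0 \<le> HN_inner \<eta> (HN_of (p - q)) (\<lambda>j x. v j x - w j x)"
proof -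
  have "0 \<le> (\<Sum>j\<in>UNIV. blinfun_apply (p j - q j) (J_map \<eta> (v j) - J_map \<eta> (w j)))"
    using F_monotone[unfolded monotone_payoffs_def, rule_format, OF assms(1,2), of "\<lambda>j. J_map \<eta> (v j)" "\<lambda>j. J_map \<eta> (w j)"] assms(5,6)
    by blast
  also have "\<dots> = HN_inner \<eta> (HN_of (p - q)) (\<lambda>j x. v j x - w j x)"
    unfolding HN_inner_def
  proof (rule sum.cong)
    fix j
    have L: "v j \<in> L2_functions \<eta>" "w j \<in> L2_functions \<eta>" using assms(3,4) by (auto simp: L2N_def)
    then show "blinfun_apply (p j - q j) (J_map \<eta> (v j) - J_map \<eta> (w j)) = H_inner \<eta> (HN_of (p - q) j) (\<lambda>x. v j x - w j x)"
      unfolding J_diff[OF L, symmetric] J_apply[OF L2_diff[OF L]] by (simp add: HN_of_def)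
  qed simp
  finally show ?thesis .
qed

lemma R_monotone:
  assumes "0 < \<tau>" "0 < \<mu>" "z \<in> strategies" "y \<in> strategies"
  shows "0 \<le> ip ((1/\<tau>) *\<^sub>R (z - R \<tau> z) - (1/\<mu>) *\<^sub>R (y - R \<mu> y)) (R \<tau> z - R \<mu> y)"
proof -
  let ?a = "(1/\<tau>) *\<^sub>R (z - R \<tau> z)" and ?b = "(1/\<mu>) *\<^sub>R (y - R \<mu> y)"
  have "0 \<le> HN_inner \<eta> (HN_of (R \<tau> z - R \<mu> y)) (\<lambda>j x. HN_of ?a j x - HN_of ?b j x)"
    by (rule monotone_L2[OF R_in R_in HN_of_L2N HN_of_L2N])
       (use assms R_subdiff in \<open>auto simp: HN_of_def simp del: scaleR_fun_apply minus_apply\<close>)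
  also have "(\<lambda>j x. HN_of ?a j x - HN_of ?b j x) = HN_of (?a - ?b)"
    by (rule HN_of_diff[symmetric])
  finally have "0 \<le> ip (R \<tau> z - R \<mu> y) (?a - ?b)" unfolding ip_def .
  then show ?thesis by (subst ip_commute)
qed

end

section \<open>The flow\<close>

lemma HN_absolutely_continuous_of_lipschitz:
  assumes L: "0 \<le> L" and lip: "\<And>s t. s \<in> S \<Longrightarrow> t \<in> S \<Longrightarrow> HN_dist \<eta> (f s) (f t) \<le> L * \<bar>s - t\<bar>"
  shows "HN_absolutely_continuous_on \<eta> S f"
  unfolding HN_absolutely_continuous_on_def
proof (intro allI impI)
  fix \<epsilon> :: real assume e: "0 < \<epsilon>"
  show "\<exists>\<delta>>0. \<forall>\<I>. finite \<I> \<and> (\<forall>(a, b)\<in>\<I>. a \<le> b \<and> {a..b} \<subseteq> S) \<and>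
        disjoint_family_on (\<lambda>(a, b). {a<..<b}) \<I> \<and> (\<Sum>(a, b)\<in>\<I>. b - a) < \<delta> \<longrightarrow>
        (\<Sum>(a, b)\<in>\<I>. HN_dist \<eta> (f a) (f b)) < \<epsilon>"
  proof (intro exI[of _ "\<epsilon> / (L + 1)"] conjI allI impI)
    show "0 < \<epsilon> / (L + 1)" using e L by simp
    fix \<I> assume I: "finite \<I> \<and> (\<forall>(a, b)\<in>\<I>. a \<le> b \<and> {a..b} \<subseteq> S) \<and>
        disjoint_family_on (\<lambda>(a, b). {a<..<b}) \<I> \<and> (\<Sum>(a, b)\<in>\<I>. b - a) < \<epsilon> / (L + 1)"
    have "(\<Sum>(a, b)\<in>\<I>. HN_dist \<eta> (f a) (f b)) \<le> (\<Sum>(a, b)\<in>\<I>. L * (b - a))"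
    proof (rule sum_mono)
      fix z assume z: "z \<in> \<I>"
      obtain a b where ab: "z = (a, b)" by (cases z)
      then have "a \<le> b" "{a..b} \<subseteq> S" using I z by auto
      then have "HN_dist \<eta> (f a) (f b) \<le> L * \<bar>a - b\<bar>" by (intro lip) auto
      then show "(case z of (a, b) \<Rightarrow> HN_dist \<eta> (f a) (f b)) \<le> (case z of (a, b) \<Rightarrow> L * (b - a))"
        using ab \<open>a \<le> b\<close> by simp
    qed
    also have "\<dots> = L * (\<Sum>(a, b)\<in>\<I>. b - a)" by (simp add: sum_distrib_left case_prod_unfold)
    also have "\<dots> \<le> L * (\<epsilon> / (L + 1))" using I L by (intro mult_left_mono) auto
    also have "\<dots> < \<epsilon>" using e L by (simp add: field_simps)
    finally show "(\<Sum>(a, b)\<in>\<I>. HN_dist \<eta> (f a) (f b)) < \<epsilon>" .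
  qed
qed

lemma tendsto_HN_dist_components:
  assumes "\<And>j. ((\<lambda>k. H_norm \<eta> (\<lambda>x. f k j x - g j x)) \<longlongrightarrow> 0) G"
  shows "((\<lambda>k. HN_dist \<eta> (f k) g) \<longlongrightarrow> 0) G"
proof -
  have "((\<lambda>k. \<Sum>j\<in>UNIV. H_norm \<eta> (\<lambda>x. f k j x - g j x)) \<longlongrightarrow> (\<Sum>j\<in>(UNIV :: 'a set). 0)) G"
    by (intro tendsto_sum assms)
  then have l: "((\<lambda>k. \<Sum>j\<in>UNIV. H_norm \<eta> (\<lambda>x. f k j x - g j x)) \<longlongrightarrow> 0) G" by simp
  show ?thesis
    by (rule tendsto_0_bound[OF l]) (use HN_norm_le_sum in \<open>simp add: HN_dist_def\<close>)
qed

lemma tendsto_components_of_HN_dist: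
  assumes "((\<lambda>k. HN_dist \<eta> (f k) g) \<longlongrightarrow> 0) G"
  shows "((\<lambda>k. H_norm \<eta> (\<lambda>x. f k j x - g j x)) \<longlongrightarrow> 0) G"
  by (rule tendsto_0_bound[OF assms])
     (use H_norm_component_le[of \<eta> "\<lambda>j x. f _ j x - g j x" j] in \<open>simp add: HN_dist_def\<close>)

lemma (in gaussian_measure) tendsto_HN_inner:
  assumes L2: "\<And>k. f k \<in> L2N \<eta>" "a \<in> L2N \<eta>" "\<And>k. g k \<in> L2N \<eta>" "b \<in> L2N \<eta>"
    and lim: "((\<lambda>k. HN_dist \<eta> (f k) a) \<longlongrightarrow> 0) G" "((\<lambda>k. HN_dist \<eta> (g k) b) \<longlongrightarrow> 0) G"
  shows "((\<lambda>k. HN_inner \<eta> (f k) (g k)) \<longlongrightarrow> HN_inner \<eta> a b) G"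
  unfolding HN_inner_def
  by (intro tendsto_sum tendsto_H_inner L2N_D L2 tendsto_components_of_HN_dist lim)

text \<open>\<open>h\<close> witnesses that \<open>\<mu>0\<close> lies in the domain; its norm
  becomes the constant \<open>M\<close> of the evolution and thereby the Lipschitz constant of the
  flow.\<close>

locale gaussian_flow = gaussian_game \<eta> K F
  for \<eta> :: "'a::{banach, second_countable_topology} measure"
    and K :: "'n::finite \<Rightarrow> ('a \<Rightarrow>\<^sub>L real) set" and F +
  fixes \<mu>0 :: "'n \<Rightarrow> 'a \<Rightarrow>\<^sub>L real" and h :: "'n \<Rightarrow> 'a \<Rightarrow> real"
  assumes \<mu>0_in: "\<mu>0 \<in> strategies"
    and h: "\<And>j. h j \<in> H_space \<eta>" "\<And>j. J_map \<eta> (h j) \<in> partial_subdiff K F j \<mu>0"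
begin

lemma h_L2N: "h \<in> L2N \<eta>" using h(1) by (simp add: L2N_def H_space_L2)

sublocale evolution ip strategies R \<mu>0 "HN_norm \<eta> h"
proof
  show "nrm (\<mu>0 - R \<tau> \<mu>0) \<le> \<tau> * HN_norm \<eta> h" if \<tau>: "0 < \<tau>" for \<tau>
  proof -
    let ?w = "(1/\<tau>) *\<^sub>R (\<mu>0 - R \<tau> \<mu>0)"
    \<comment> \<open>Monotonicity between the graph points (R \<tau> \<mu>0, w) and (\<mu>0, h). As
      R \<tau> \<mu>0 - \<mu>0 = -\<tau> w, it says |w|^2 \<le> (w, h), so |w| is at most the norm
      of \<open>h\<close>.\<close>
    have "0 \<le> HN_inner \<eta> (HN_of (R \<tau> \<mu>0 - \<mu>0)) (\<lambda>j x. HN_of ?w j x - h j x)"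
      by (rule monotone_L2[OF R_in[OF \<tau> \<mu>0_in] \<mu>0_in HN_of_L2N h_L2N])
         (use R_subdiff[OF \<tau> \<mu>0_in] h in \<open>auto simp: HN_of_def simp del: scaleR_fun_apply minus_apply\<close>)
    moreover have "HN_of (R \<tau> \<mu>0 - \<mu>0) = (\<lambda>j x. - \<tau> * HN_of ?w j x)"
      using \<tau> by (simp add: HN_of_def fun_eq_iff blinfun.diff_left blinfun.scaleR_left)
    moreover have "HN_inner \<eta> (\<lambda>j x. - \<tau> * HN_of ?w j x) v = - \<tau> * HN_inner \<eta> (HN_of ?w) v" for v
      unfolding HN_inner_def H_inner_def sum_distrib_left by (intro sum.cong refl) (simp only: mult.assoc integral_mult_right_zero)
    ultimately have "HN_inner \<eta> (HN_of ?w) (\<lambda>j x. HN_of ?w j x - h j x) \<le> 0"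
      using \<tau> by (simp add: mult_le_0_iff)
    moreover have "HN_inner \<eta> (HN_of ?w) (\<lambda>j x. HN_of ?w j x - h j x) = HN_inner \<eta> (HN_of ?w) (HN_of ?w) - HN_inner \<eta> (HN_of ?w) h"
    proof -
      have "H_inner \<eta> (HN_of ?w j) (\<lambda>x. HN_of ?w j x - h j x) = H_inner \<eta> (HN_of ?w j) (HN_of ?w j) - H_inner \<eta> (HN_of ?w j) (h j)" for j
        unfolding H_inner_def right_diff_distrib
        by (intro Bochner_Integration.integral_diff L2_mult L2N_D[OF HN_of_L2N] L2N_D[OF h_L2N])
      then show ?thesis by (simp add: HN_inner_def sum_subtractf)
    qed
    ultimately have "(nrm ?w)\<^sup>2 \<le> HN_inner \<eta> (HN_of ?w) h" by (simp only: nrm_sq ip_def)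
    also have "\<dots> \<le> nrm ?w * HN_norm \<eta> h"
      using HN_cauchy_schwarz[OF HN_of_L2N h_L2N, of ?w] unfolding nrm_HN by linarith
    finally have "nrm ?w * nrm ?w \<le> nrm ?w * HN_norm \<eta> h" by (simp only: power2_eq_square)
    then have "nrm ?w \<le> HN_norm \<eta> h"
      using nrm_nonneg[of ?w] HN_norm_nonneg[of \<eta> h] by (metis less_eq_real_def mult_left_le_imp_le)
    then have "\<bar>1/\<tau>\<bar> * nrm (\<mu>0 - R \<tau> \<mu>0) \<le> HN_norm \<eta> h" by (simp only: nrm_scaleR)
    then show ?thesis using \<tau> by (simp add: field_simps)
  qed
qed (fact strategies_seq_compact strategies_convex R_in R_monotone \<mu>0_in)+

definition step :: "nat \<Rightarrow> real" where "step n = inverse (real (Suc n))"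

lemma step_pos: "0 < step n" by (simp add: step_def)

lemma step_lim: "step \<longlonglongrightarrow> 0" unfolding step_def by (rule LIMSEQ_inverse_real_of_nat)

text \<open>By \<open>A_xi_cauchy\<close> the Yosida approximations have a limit in L2, which need
  not be a functional. Each of them gives subgradients at \<open>R (step n) (xi s)\<close>, not at
  \<open>xi s\<close>; these points tend to \<open>xi s\<close>, and continuity of the payoffs lets
  the subgradient inequality pass to the limit.\<close>

lemma A_limit:
  assumes s: "0 \<le> s"
  obtains g where "\<And>j. g j \<in> H_space \<eta>" "(\<lambda>n. HN_dist \<eta> (HN_of (A (step n) (xi s))) g) \<longlonglongrightarrow> 0"
    "\<And>j. J_map \<eta> (g j) \<in> partial_subdiff K F j (xi s)"
proof -
  define a where "a n = A (step n) (xi s)" for n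
  have xs: "xi s \<in> strategies" by (rule xi_in[OF s])
  have cauchy: "\<exists>N. \<forall>m\<ge>N. \<forall>n\<ge>N. H_norm \<eta> (\<lambda>x. blinfun_apply (a m j) x - blinfun_apply (a n j) x) < e" if e: "0 < e" for j e
  proof -
    obtain \<tau>0 where t0: "0 < \<tau>0" "\<And>\<tau> \<mu>. 0 < \<tau> \<Longrightarrow> \<tau> < \<tau>0 \<Longrightarrow> 0 < \<mu> \<Longrightarrow> \<mu> < \<tau>0 \<Longrightarrow> nrm (A \<tau> (xi s) - A \<mu> (xi s)) < e"
      using A_xi_cauchy[OF s e] by blast
    obtain N where N: "\<And>n. N \<le> n \<Longrightarrow> step n < \<tau>0"
      using order_tendstoD(2)[OF step_lim t0(1)] by (auto simp: eventually_sequentially)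
    show ?thesis
    proof (intro exI[of _ N] allI impI)
      fix m n assume "N \<le> m" "N \<le> n"
      then have "nrm (a m - a n) < e" unfolding a_def by (intro t0(2) step_pos N)
      moreover have "H_norm \<eta> (\<lambda>x. blinfun_apply (a m j) x - blinfun_apply (a n j) x) = H_norm \<eta> (blinfun_apply ((a m - a n) j))"
        by (rule arg_cong[where f = "H_norm \<eta>"]) (simp add: fun_eq_iff blinfun.diff_left)
      ultimately show "H_norm \<eta> (\<lambda>x. blinfun_apply (a m j) x - blinfun_apply (a n j) x) < e"
        using nrm_component_le[of "a m - a n" j] by linarith
    qed
  qed
  have ex: "\<exists>f. f \<in> L2_functions \<eta> \<and> (\<lambda>n. H_norm \<eta> (\<lambda>x. blinfun_apply (a n j) x - f x)) \<longlonglongrightarrow> 0" for j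
  proof (rule L2_complete[of "\<lambda>n. blinfun_apply (a n j)"])
    show "\<exists>N. \<forall>m\<ge>N. \<forall>n\<ge>N. H_norm \<eta> (\<lambda>x. blinfun_apply (a m j) x - blinfun_apply (a n j) x) < e" if "0 < e" for e
      by (rule cauchy[OF that])
  qed (use functional_L2 in auto)
  from choice[OF allI[OF ex]] obtain g
    where gg: "\<forall>j. g j \<in> L2_functions \<eta> \<and> (\<lambda>n. H_norm \<eta> (\<lambda>x. blinfun_apply (a n j) x - g j x)) \<longlonglongrightarrow> 0" ..
  have g: "g j \<in> L2_functions \<eta>" "(\<lambda>n. H_norm \<eta> (\<lambda>x. blinfun_apply (a n j) x - g j x)) \<longlonglongrightarrow> 0" for j
    by (rule conjunct1[OF spec[OF gg]], rule conjunct2[OF spec[OF gg]])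
  have H: "g j \<in> H_space \<eta>" for j
  proof (rule H_space_closed[OF g(1)])
    fix e :: real assume "0 < e"
    from order_tendstoD(2)[OF g(2)[of j] this] obtain n where "H_norm \<eta> (\<lambda>x. blinfun_apply (a n j) x - g j x) < e"
      by (auto simp: eventually_sequentially)
    then have "H_norm \<eta> (\<lambda>x. g j x - blinfun_apply (a n j) x) < e" by (subst H_norm_minus_commute)
    then show "\<exists>k\<in>H_space \<eta>. H_norm \<eta> (\<lambda>x. g j x - k x) < e" using functional_in_H by blast
  qed
  define r where "r n = R (step n) (xi s)" for n
  have r_in: "r n \<in> strategies" for n unfolding r_def by (rule R_in[OF step_pos xs])
  have "(\<lambda>n. step n * HN_norm \<eta> h) \<longlonglongrightarrow> 0" using tendsto_mult_left_zero[OF step_lim] .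
  then have r_lim: "(\<lambda>n. nrm (r n - xi s)) \<longlonglongrightarrow> 0"
  proof (rule tendsto_0_bound)
    fix n
    have "r n - xi s = - (step n *\<^sub>R a n)" unfolding r_def a_def R_eq[OF step_pos] by simp
    then have "nrm (r n - xi s) = step n * nrm (a n)" using step_pos[of n] by (simp add: nrm_scaleR)
    also have "\<dots> \<le> step n * HN_norm \<eta> h" unfolding a_def using step_pos[of n] by (intro mult_left_mono A_xi_le_M s) auto
    finally show "\<bar>nrm (r n - xi s)\<bar> \<le> step n * HN_norm \<eta> h" by simp
  qed
  have sub: "J_map \<eta> (g j) \<in> partial_subdiff K F j (xi s)" for j
    unfolding partial_subdiff_def
  proof (intro CollectI ballI)
    fix \<nu> assume \<nu>: "\<nu> \<in> K j"
    have 1: "(\<lambda>n. F j ((r n)(j := \<nu>))) \<longlonglongrightarrow> F j ((xi s)(j := \<nu>))"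
      by (rule tendsto_of_nrm[OF F_update_continuous[OF \<nu>] _ xs r_lim]) (simp add: r_in)
    have 2: "(\<lambda>n. F j (r n)) \<longlonglongrightarrow> F j (xi s)"
      by (rule tendsto_of_nrm[OF F_continuous _ xs r_lim]) (simp add: r_in)
    have "(\<lambda>n. H_norm \<eta> (\<lambda>x. blinfun_apply (\<nu> - r n j) x - blinfun_apply (\<nu> - xi s j) x)) \<longlonglongrightarrow> 0"
    proof (rule tendsto_0_bound[OF r_lim])
      fix n
      have "H_norm \<eta> (\<lambda>x. blinfun_apply (\<nu> - r n j) x - blinfun_apply (\<nu> - xi s j) x) = H_norm \<eta> (blinfun_apply ((xi s - r n) j))"
        by (rule arg_cong[where f = "H_norm \<eta>"]) (simp add: fun_eq_iff blinfun.diff_left)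
      then show "\<bar>H_norm \<eta> (\<lambda>x. blinfun_apply (\<nu> - r n j) x - blinfun_apply (\<nu> - xi s j) x)\<bar> \<le> nrm (r n - xi s)"
        using nrm_component_le[of "xi s - r n" j] nrm_minus_commute[of "r n" "xi s"] by simp
    qed
    then have 3: "(\<lambda>n. H_inner \<eta> (blinfun_apply (\<nu> - r n j)) (blinfun_apply (a n j))) \<longlonglongrightarrow> H_inner \<eta> (blinfun_apply (\<nu> - xi s j)) (g j)"
      by (intro tendsto_H_inner functional_L2 g)
    have le: "F j (r n) + H_inner \<eta> (blinfun_apply (\<nu> - r n j)) (blinfun_apply (a n j)) \<le> F j ((r n)(j := \<nu>))" for n
      using R_subdiff[OF step_pos xs, of n j] \<nu>
      unfolding partial_subdiff_def r_def[symmetric] a_def A_def J_apply[OF functional_L2, symmetric] by blast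
    have "F j (xi s) + H_inner \<eta> (blinfun_apply (\<nu> - xi s j)) (g j) \<le> F j ((xi s)(j := \<nu>))"
      by (rule LIMSEQ_le[OF tendsto_add[OF 2 3] 1]) (use le in blast)
    then show "F j (xi s) + blinfun_apply (\<nu> - xi s j) (J_map \<eta> (g j)) \<le> F j ((xi s)(j := \<nu>))"
      by (simp only: J_apply[OF g(1)])
  qed
  have "(\<lambda>n. HN_dist \<eta> (HN_of (a n)) g) \<longlonglongrightarrow> 0"
    by (rule tendsto_HN_dist_components) (simp add: HN_of_def g)
  then show thesis using that[of g] H sub unfolding a_def by blast
qed

lemma xi_in_flow_domain: "0 \<le> t \<Longrightarrow> xi t \<in> flow_domain \<eta> K F"
proof -
  assume t: "0 \<le> t"
  obtain g where "\<And>j. g j \<in> H_space \<eta>" "(\<lambda>n. HN_dist \<eta> (HN_of (A (step n) (xi t))) g) \<longlonglongrightarrow> 0"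
    "\<And>j. J_map \<eta> (g j) \<in> partial_subdiff K F j (xi t)"
    using A_limit[OF t] by blast
  then show ?thesis unfolding flow_domain_def using xi_in[OF t] by blast
qed

lemma xi_HN_derivative:
  assumes s: "0 < s" and cont: "isCont speed s"
  shows "\<exists>v. HN_has_derivative_at \<eta> (\<lambda>t. HN_of (xi t)) v s \<and>
     (\<forall>j. - J_map \<eta> (v j) \<in> partial_subdiff K F j (xi s))"
proof -
  have s0: "0 \<le> s" using s by simp
  obtain g where g: "\<And>j. g j \<in> H_space \<eta>" "(\<lambda>n. HN_dist \<eta> (HN_of (A (step n) (xi s))) g) \<longlonglongrightarrow> 0"
    "\<And>j. J_map \<eta> (g j) \<in> partial_subdiff K F j (xi s)"
    using A_limit[OF s0] by blast
  define v where "v = (\<lambda>j x. - g j x)"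
  have gL: "g \<in> L2N \<eta>" using g(1) by (simp add: L2N_def H_space_L2)
  have vL: "v \<in> L2N \<eta>" unfolding v_def by (rule L2N_minus[OF gL])
  let ?D = "\<lambda>t. (1 / (t - s)) *\<^sub>R (xi t - xi s)"
  have "((\<lambda>t. HN_dist \<eta> (HN_of (?D t)) v) \<longlongrightarrow> 0) (at s within {0..})"
  proof (rule tendstoI)
    fix e :: real assume e: "0 < e"
    then have e2: "0 < e / 2" by simp
    obtain \<tau>0 where t0: "0 < \<tau>0" "\<And>\<tau>. 0 < \<tau> \<Longrightarrow> \<tau> < \<tau>0 \<Longrightarrow> \<forall>\<^sub>F t in at s within {0..}. nrm (?D t + A \<tau> (xi s)) < e / 2"
      using xi_derivative[OF s cont e2] by blast
    from order_tendstoD(2)[OF step_lim t0(1)] order_tendstoD(2)[OF g(2) e2]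
    have "\<forall>\<^sub>F n in sequentially. step n < \<tau>0 \<and> HN_dist \<eta> (HN_of (A (step n) (xi s))) g < e / 2"
      by (rule eventually_conj)
    then obtain n where n: "step n < \<tau>0" "HN_dist \<eta> (HN_of (A (step n) (xi s))) g < e / 2"
      by (auto simp: eventually_sequentially)
    let ?a = "A (step n) (xi s)"
    have "HN_dist \<eta> (HN_of (- ?a)) v = HN_norm \<eta> (\<lambda>j x. - (HN_of ?a j x - g j x))"
      unfolding HN_dist_def by (rule arg_cong[where f = "HN_norm \<eta>"]) (simp add: fun_eq_iff HN_of_def v_def blinfun.minus_left)
    then have av: "HN_dist \<eta> (HN_of (- ?a)) v < e / 2" using n(2) by (simp only: HN_norm_minus HN_dist_def)
    from t0(2)[OF step_pos n(1)]
    show "\<forall>\<^sub>F t in at s within {0..}. dist (HN_dist \<eta> (HN_of (?D t)) v) 0 < e"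
    proof eventually_elim
      case (elim t)
      have "HN_dist \<eta> (HN_of (?D t)) v \<le> HN_dist \<eta> (HN_of (?D t)) (HN_of (- ?a)) + HN_dist \<eta> (HN_of (- ?a)) v"
        by (intro HN_dist_triangle HN_of_L2N vL)
      also have "HN_dist \<eta> (HN_of (?D t)) (HN_of (- ?a)) = nrm (?D t + ?a)"
        unfolding HN_dist_HN_of by simp
      finally have "HN_dist \<eta> (HN_of (?D t)) v < e" using elim av by linarith
      then show ?case by (simp only: HN_dist_def dist_real_def diff_0_right abs_of_nonneg HN_norm_nonneg)
    qed
  qed
  moreover have "v j \<in> H_space \<eta>" for j unfolding v_def by (intro H_space_minus g)
  moreover have "- J_map \<eta> (v j) \<in> partial_subdiff K F j (xi s)" for j
    using g(3)[of j] by (simp add: v_def J_minus)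
  ultimately show ?thesis unfolding HN_has_derivative_at_def HN_of_quotient by blast
qed

lemma xi_flow_solution: "flow_solution \<eta> K F \<mu>0 xi"
  unfolding flow_solution_def
proof (intro conjI allI impI)
  show "xi t \<in> flow_domain \<eta> K F" if "0 \<le> t" for t by (rule xi_in_flow_domain[OF that])
  show "xi 0 j = \<mu>0 j" for j by (simp add: xi_0)
  show "HN_absolutely_continuous_on \<eta> {0..T} (\<lambda>t. HN_of (xi t))" for T
    by (rule HN_absolutely_continuous_of_lipschitz[of "HN_norm \<eta> h"])
       (auto simp: HN_dist_HN_of intro: xi_lipschitz)
  fix j
  \<comment> \<open>Time 0 is discarded together with the discontinuities, since differentiability
    is shown for s > 0.\<close>
  have "countable ({0} \<union> {s. 0 < s \<and> \<not> isCont speed s})" using speed_discontinuities by simp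
  then have N: "{0} \<union> {s. 0 < s \<and> \<not> isCont speed s} \<in> null_sets lborel" by (rule countable_imp_null_set_lborel)
  show "AE t in lborel. 0 \<le> t \<longrightarrow> (\<exists>v. HN_has_derivative_at \<eta> (\<lambda>t. HN_of (xi t)) v t \<and> - J_map \<eta> (v j) \<in> partial_subdiff K F j (xi t))"
  proof (rule AE_I'[OF N], safe)
    fix t assume "0 \<le> (t::real)" "t \<notin> {}" "t \<noteq> 0" "isCont speed t"
      "\<nexists>v. HN_has_derivative_at \<eta> (\<lambda>t. HN_of (xi t)) v t \<and> - J_map \<eta> (v j) \<in> partial_subdiff K F j (xi t)"
    then show False using xi_HN_derivative[of t] by auto
  qed (use less_eq_real_def in auto)
qed

text \<open>The mean is known only through pairings, but these may be taken with the error e of the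
  Riemann sum itself. Replacing the curve by its value at the tag changes the pairing by at most M
  |e| \<delta>, so |e|^2 \<le> M |e| \<delta> t. This upgrades the weak integral to a norm integral,
  with a constant gauge.\<close>

lemma HN_has_integral_xi:
  assumes t: "0 < t"
  shows "HN_has_integral \<eta> (\<lambda>s. HN_of (xi s)) (HN_of (t *\<^sub>R mean t)) 0 t"
  unfolding HN_has_integral_def
proof
  let ?M = "HN_norm \<eta> h" and ?I = "t *\<^sub>R mean t"
  show "\<forall>j. HN_of ?I j \<in> H_space \<eta>" by (simp add: HN_of_def functional_in_H)
  let ?S = "\<lambda>p. \<Sum>(s, k)\<in>p. measure lborel k *\<^sub>R xi s"
  have S: "(\<lambda>j x. \<Sum>(s, k)\<in>p. measure lborel k * HN_of (xi s) j x) = HN_of (?S p)" for p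
    by (simp add: HN_of_def fun_eq_iff case_prod_unfold sum_fun_apply blinfun.sum_left blinfun.scaleR_left)
  show "((\<lambda>p. HN_dist \<eta> (\<lambda>j x. \<Sum>(s, k)\<in>p. measure lborel k * HN_of (xi s) j x) (HN_of ?I)) \<longlongrightarrow> 0) (division_filter {0..t})"
    unfolding S HN_dist_HN_of
  proof (rule tendstoI)
    fix e :: real assume e: "0 < e"
    define \<delta> where "\<delta> = e / (?M * t + 1)"
    have c: "0 < ?M * t + 1" using t by (intro add_nonneg_pos mult_nonneg_nonneg) auto
    have \<delta>: "0 < \<delta>" "?M * \<delta> * t < e" using e c by (auto simp: \<delta>_def field_simps)
    have "nrm (?S p - ?I) < e" if p: "p tagged_division_of {0..t}" "(\<lambda>x. ball x \<delta>) fine p" for p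
    proof -
      let ?e = "?S p - ?I"
      let ?g = "\<lambda>r. ip (xi r) ?e"
      have gI: "(?g has_integral t * ip (mean t) ?e) (cbox 0 t)" using mean_has_integral[OF t] by simp
      have fin: "finite p" using p(1) by (rule tagged_division_of_finite)
      have "ip ?I ?e = integral (cbox 0 t) ?g" using integral_unique[OF gI] by (simp add: ip_scaleR_left)
      also have "\<dots> = (\<Sum>(s, k)\<in>p. integral k ?g)"
        by (rule integral_combine_tagged_division_topdown) (use gI p in auto)
      finally have "ip ?e ?e = (\<Sum>(s, k)\<in>p. measure lborel k * ?g s) - (\<Sum>(s, k)\<in>p. integral k ?g)"
        by (simp only: ip_diff_left ip_sum_left case_prod_unfold ip_scaleR_left)
      also have "\<dots> = (\<Sum>(s, k)\<in>p. measure lborel k * ?g s - integral k ?g)"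
        by (simp add: case_prod_unfold sum_subtractf)
      also have "\<dots> \<le> (\<Sum>(s, k)\<in>p. (?M * nrm ?e * \<delta>) * measure lborel k)"
      proof (rule sum_mono)
        fix z assume z: "z \<in> p"
        obtain s k where sk: "z = (s, k)" by (cases z)
        obtain a b where k: "k = cbox a b" using tagged_division_ofD(4)[OF p(1)] z sk by blast
        have sub: "s \<in> k" "k \<subseteq> {0..t}" "k \<subseteq> ball s \<delta>"
          using tagged_division_ofD(2,3)[OF p(1)] fineD[OF p(2)] z sk by blast+
        have "?g integrable_on cbox a b"
          using has_integral_integrable[OF gI] sub(2) k by (intro integrable_on_subcbox) auto
        then have "((\<lambda>r. ?g s - ?g r) has_integral measure lborel (cbox a b) * ?g s - integral (cbox a b) ?g) (cbox a b)"
          using has_integral_const[of "?g s" a b] by (intro has_integral_diff integrable_integral) auto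
        then have "norm (measure lborel (cbox a b) * ?g s - integral (cbox a b) ?g) \<le> (?M * nrm ?e * \<delta>) * measure lborel (cbox a b)"
        proof (rule has_integral_bound[rotated])
          fix r assume r: "r \<in> cbox a b"
          then have "r \<in> {0..t}" "s \<in> {0..t}" "r \<in> ball s \<delta>" using sub k by blast+
          then have "\<bar>?g s - ?g r\<bar> \<le> ?M * nrm ?e * \<bar>s - r\<bar>" by (intro xi_ip_lipschitz) auto
          also have "\<dots> \<le> ?M * nrm ?e * \<delta>" using \<open>r \<in> ball s \<delta>\<close> by (intro mult_left_mono) (auto simp: dist_real_def)
          finally show "norm (?g s - ?g r) \<le> ?M * nrm ?e * \<delta>" by simp
        qed (use \<delta> in simp)
        then show "(case z of (s, k) \<Rightarrow> measure lborel k * ?g s - integral k ?g) \<le> (case z of (s, k) \<Rightarrow> (?M * nrm ?e * \<delta>) * measure lborel k)"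
          using sk k by simp
      qed
      also have "\<dots> = (?M * nrm ?e * \<delta>) * (\<Sum>(s, k)\<in>p. measure lborel k)"
        by (simp add: sum_distrib_left case_prod_unfold)
      also have "(\<Sum>(s, k)\<in>p. measure lborel k) = t"
        using additive_content_tagged_division[of p 0 t] p(1) t by simp
      finally have "ip ?e ?e \<le> (?M * nrm ?e * \<delta>) * t" .
      then have "nrm ?e * nrm ?e \<le> nrm ?e * (?M * \<delta> * t)"
        unfolding nrm_sq[symmetric] power2_eq_square by (simp only: mult_ac)
      then have "nrm ?e \<le> ?M * \<delta> * t"
        using \<delta>(1) t nrm_nonneg[of ?e] HN_norm_nonneg[of \<eta> h] by (metis less_eq_real_def mult_left_le_imp_le mult_nonneg_nonneg)
      then show ?thesis using \<delta>(2) by simp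
    qed
    then have "\<exists>\<gamma>. gauge \<gamma> \<and> (\<forall>p. p tagged_division_of {0..t} \<and> \<gamma> fine p \<longrightarrow> dist (nrm (?S p - ?I)) 0 < e)"
      using \<delta>(1) by (intro exI[of _ "\<lambda>x. ball x \<delta>"]) (auto simp: gauge_ball)
    then show "\<forall>\<^sub>F p in division_filter {0..t}. dist (nrm (?S p - ?I)) 0 < e"
      unfolding eventually_division_filter .
  qed
qed

text \<open>For stationary \<sigma> the resolvent inclusion with \<tau> = 1 puts J 0 = 0 into the
  subdifferential of every player, which is the Nash property. Norm convergence of the means inside
  K becomes weak* convergence by \<open>tendsto_of_nrm\<close>.\<close>

lemma mean_limit_nash:
  "\<exists>\<sigma>. nash_equilibrium K F \<sigma> \<and> limitin weak_star_tuples (\<lambda>t j. (1 / t) *\<^sub>R (t *\<^sub>R mean t) j) \<sigma> at_top"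
proof -
  obtain \<sigma> where \<sigma>: "\<sigma> \<in> stationary" "((\<lambda>t. nrm (mean t - \<sigma>)) \<longlongrightarrow> 0) at_top" using mean_converges by blast
  then have in_K: "\<sigma> \<in> strategies" and fixed: "R 1 \<sigma> = \<sigma>" by (auto simp: stationary_def)
  have "J_map \<eta> (blinfun_apply (((1/1) *\<^sub>R (\<sigma> - R 1 \<sigma>)) j)) = 0" for j unfolding fixed by (simp add: J_map_def)
  then have "0 \<in> partial_subdiff K F j \<sigma>" for j
    using R_subdiff[of 1 \<sigma> j] in_K by (simp add: fixed)
  then have nash: "nash_equilibrium K F \<sigma>" using in_K by (auto simp: nash_equilibrium_def partial_subdiff_def)
  have ev: "\<forall>\<^sub>F t in at_top. mean t \<in> strategies"
    using eventually_gt_at_top[of "0::real"] by eventually_elim (rule mean_in)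
  have l1: "((\<lambda>t. blinfun_apply (mean t j) x) \<longlongrightarrow> blinfun_apply (\<sigma> j) x) at_top" for j x
    by (rule tendsto_of_nrm[OF _ ev in_K \<sigma>(2)]) (intro continuous_map_from_subtopology component_continuous)
  have l2: "\<forall>\<^sub>F t in at_top. blinfun_apply (mean t j) x = blinfun_apply ((1 / t) *\<^sub>R (t *\<^sub>R mean t) j) x" for j x
    using eventually_gt_at_top[of "0::real"] by eventually_elim simp
  have "((\<lambda>t. blinfun_apply ((1 / t) *\<^sub>R (t *\<^sub>R mean t) j) x) \<longlongrightarrow> blinfun_apply (\<sigma> j) x) at_top" for j x
    by (rule Lim_transform_eventually[OF l1 l2])
  then have "limitin weak_star_tuples (\<lambda>t j. (1 / t) *\<^sub>R (t *\<^sub>R mean t) j) \<sigma> at_top"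
    unfolding limitin_componentwise
    by (intro conjI ballI limitin_weak_star) (simp_all add: strong_operator_topology_topspace PiE_UNIV_domain)
  with nash show ?thesis by blast
qed

end

section \<open>Uniqueness of the flow\<close>

context gaussian_game
begin

lemma HN_derivative_L2N: "HN_has_derivative_at \<eta> f v t \<Longrightarrow> v \<in> L2N \<eta>"
  by (simp add: HN_has_derivative_at_def L2N_def H_space_L2)

lemma HN_derivative_tendsto:
  "HN_has_derivative_at \<eta> (\<lambda>t. HN_of (\<xi> t)) v t \<Longrightarrow>
    ((\<lambda>s. HN_dist \<eta> (HN_of ((1 / (s - t)) *\<^sub>R (\<xi> s - \<xi> t))) v) \<longlongrightarrow> 0) (at t within {0..})"
  by (simp only: HN_has_derivative_at_def HN_of_quotient)

lemma at_within_atLeast_0: "0 < t \<Longrightarrow> at t within {0..} = at (t::real)"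
  by (rule at_within_interior) simp

text \<open>Difference quotients have at most one limit up to null sets, and \<open>J_map\<close>
  does not see null sets.\<close>

lemma HN_derivative_unique:
  assumes t: "0 < t" and v: "HN_has_derivative_at \<eta> (\<lambda>t. HN_of (\<xi> t)) v t"
    and w: "HN_has_derivative_at \<eta> (\<lambda>t. HN_of (\<xi> t)) w t"
  shows "J_map \<eta> (v j) = J_map \<eta> (w j)"
proof -
  let ?D = "\<lambda>s. HN_of ((1 / (s - t)) *\<^sub>R (\<xi> s - \<xi> t))"
  have "((\<lambda>s. HN_dist \<eta> (?D s) v + HN_dist \<eta> (?D s) w) \<longlongrightarrow> 0 + 0) (at t)"
    using HN_derivative_tendsto[OF v] HN_derivative_tendsto[OF w] unfolding at_within_atLeast_0[OF t]
    by (rule tendsto_add)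
  then have "((\<lambda>s. HN_dist \<eta> (?D s) v + HN_dist \<eta> (?D s) w) \<longlongrightarrow> 0) (at t)" by simp
  then have "((\<lambda>s. HN_dist \<eta> v w) \<longlongrightarrow> 0) (at t)"
  proof (rule tendsto_0_bound)
    fix s
    have "HN_dist \<eta> v w \<le> HN_dist \<eta> v (?D s) + HN_dist \<eta> (?D s) w"
      by (intro HN_dist_triangle HN_of_L2N HN_derivative_L2N[OF v] HN_derivative_L2N[OF w])
    then show "\<bar>HN_dist \<eta> v w\<bar> \<le> HN_dist \<eta> (?D s) v + HN_dist \<eta> (?D s) w"
      unfolding HN_dist_commute[of \<eta> v "?D s"] by (simp add: HN_dist_def)
  qed
  then have "HN_dist \<eta> v w = 0" by (simp add: tendsto_const_iff)
  then have "H_norm \<eta> (\<lambda>x. v j x - w j x) \<le> 0"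
    using H_norm_component_le[of \<eta> "\<lambda>j x. v j x - w j x" j] by (simp add: HN_dist_def)
  then have "H_norm \<eta> (\<lambda>x. v j x - w j x) = 0" using H_norm_nonneg order_antisym by blast
  then show ?thesis
    by (intro J_cong_H_norm L2N_D HN_derivative_L2N[OF v] HN_derivative_L2N[OF w])
qed

text \<open>The definition of a solution allows each player an exceptional set and a derivative of
  their own. Finitely many null sets are joined, and uniqueness of \<open>J_map\<close> of the
  derivative lets one derivative serve all players.\<close>

lemma flow_solution_AE:
  assumes "flow_solution \<eta> K F \<mu>0 \<xi>"
  shows "AE t in lborel. 0 < t \<longrightarrow> (\<exists>v. HN_has_derivative_at \<eta> (\<lambda>t. HN_of (\<xi> t)) v t \<and>
    (\<forall>j. - J_map \<eta> (v j) \<in> partial_subdiff K F j (\<xi> t)))"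
proof -
  have "AE t in lborel. \<forall>j\<in>UNIV. 0 \<le> t \<longrightarrow>
      (\<exists>v. HN_has_derivative_at \<eta> (\<lambda>t. HN_of (\<xi> t)) v t \<and> - J_map \<eta> (v j) \<in> partial_subdiff K F j (\<xi> t))"
    using assms unfolding flow_solution_def by (intro AE_finite_allI) auto
  then show ?thesis
  proof eventually_elim
    case (elim t)
    show ?case
    proof
      assume t: "0 < t"
      have ex: "\<exists>v. HN_has_derivative_at \<eta> (\<lambda>t. HN_of (\<xi> t)) v t \<and> - J_map \<eta> (v j) \<in> partial_subdiff K F j (\<xi> t)" for j
        using elim t by simp
      obtain v where v: "HN_has_derivative_at \<eta> (\<lambda>t. HN_of (\<xi> t)) v t" using ex by blast
      have "- J_map \<eta> (v j) \<in> partial_subdiff K F j (\<xi> t)" for j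
      proof -
        obtain w where w: "HN_has_derivative_at \<eta> (\<lambda>t. HN_of (\<xi> t)) w t" "- J_map \<eta> (w j) \<in> partial_subdiff K F j (\<xi> t)"
          using ex by blast
        show ?thesis using w(2) unfolding HN_derivative_unique[OF t v w(1)] .
      qed
      with v show "\<exists>v. HN_has_derivative_at \<eta> (\<lambda>t. HN_of (\<xi> t)) v t \<and> (\<forall>j. - J_map \<eta> (v j) \<in> partial_subdiff K F j (\<xi> t))"
        by blast
    qed
  qed
qed

lemma strategies_bounded: "\<exists>B>0. \<forall>p\<in>strategies. nrm p \<le> B"
proof -
  have "continuous_map strategy_topology euclideanreal nrm"
  proof (rule continuous_map_of_nrm)
    fix p :: "'n \<Rightarrow> 'a \<Rightarrow>\<^sub>L real" and e :: real assume "0 < e"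
    then show "\<exists>d>0. \<forall>q\<in>strategies. nrm (q - p) < d \<longrightarrow> \<bar>nrm q - nrm p\<bar> < e"
      using abs_nrm_diff[of _ p] by (intro exI[of _ e]) (auto intro: le_less_trans)
  qed
  from image_compactin[OF strategies_compact' this] have "compact (nrm ` strategies)" by simp
  then have "bounded (nrm ` strategies)" by (rule compact_imp_bounded)
  then obtain B where "0 < B" "\<forall>x\<in>nrm ` strategies. norm x \<le> B" by (auto simp: bounded_pos)
  then show ?thesis by (intro exI[of _ B]) auto
qed

lemma distance_derivative:
  assumes t: "0 < t" and v: "HN_has_derivative_at \<eta> (\<lambda>t. HN_of (\<xi> t)) v t"
    and w: "HN_has_derivative_at \<eta> (\<lambda>t. HN_of (\<zeta> t)) w t"
  shows "((\<lambda>s. (nrm (\<xi> s - \<zeta> s))\<^sup>2) has_real_derivative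
    2 * HN_inner \<eta> (HN_of (\<xi> t - \<zeta> t)) (\<lambda>j x. v j x - w j x)) (at t)"
proof -
  define e where "e s = \<xi> s - \<zeta> s" for s
  define z where "z = (\<lambda>j x. v j x - w j x)"
  have L: "v \<in> L2N \<eta>" "w \<in> L2N \<eta>" "z \<in> L2N \<eta>"
    unfolding z_def using HN_derivative_L2N[OF v] HN_derivative_L2N[OF w] by (auto intro: L2N_diff)
  let ?q = "\<lambda>f s. (1 / (s - t)) *\<^sub>R (f s - f t)"
  have "((\<lambda>s. HN_dist \<eta> (HN_of (?q \<xi> s)) v + HN_dist \<eta> (HN_of (?q \<zeta> s)) w) \<longlongrightarrow> 0 + 0) (at t)"
    using HN_derivative_tendsto[OF v] HN_derivative_tendsto[OF w] unfolding at_within_atLeast_0[OF t]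
    by (rule tendsto_add)
  then have sum: "((\<lambda>s. HN_dist \<eta> (HN_of (?q \<xi> s)) v + HN_dist \<eta> (HN_of (?q \<zeta> s)) w) \<longlongrightarrow> 0) (at t)" by simp
  have D: "((\<lambda>s. HN_dist \<eta> (HN_of (?q e s)) z) \<longlongrightarrow> 0) (at t)"
  proof (rule tendsto_0_bound[OF sum])
    fix s
    have eq: "?q e s = ?q \<xi> s - ?q \<zeta> s" by (simp only: e_def scaleR_diff_right[symmetric]) simp
    have "HN_dist \<eta> (HN_of (?q e s)) z
      = HN_norm \<eta> (\<lambda>j x. (HN_of (?q \<xi> s) j x - v j x) + - (HN_of (?q \<zeta> s) j x - w j x))"
      unfolding HN_dist_def z_def eq HN_of_diff by (intro arg_cong[where f = "HN_norm \<eta>"] ext) simp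
    also have "\<dots> \<le> HN_norm \<eta> (\<lambda>j x. HN_of (?q \<xi> s) j x - v j x) + HN_norm \<eta> (\<lambda>j x. - (HN_of (?q \<zeta> s) j x - w j x))"
      by (intro HN_norm_triangle L2N_diff L2N_minus HN_of_L2N L)
    finally have "HN_dist \<eta> (HN_of (?q e s)) z \<le> HN_dist \<eta> (HN_of (?q \<xi> s)) v + HN_dist \<eta> (HN_of (?q \<zeta> s)) w"
      by (simp only: HN_norm_minus HN_dist_def)
    then show "\<bar>HN_dist \<eta> (HN_of (?q e s)) z\<bar> \<le> HN_dist \<eta> (HN_of (?q \<xi> s)) v + HN_dist \<eta> (HN_of (?q \<zeta> s)) w"
      by (simp only: HN_dist_def abs_of_nonneg HN_norm_nonneg)
  qed
  have diff0: "((\<lambda>s. nrm (e s - e t)) \<longlongrightarrow> 0) (at t)"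
  proof (rule tendsto_0_bound)
    have "((\<lambda>s. \<bar>s - t\<bar> * (HN_dist \<eta> (HN_of (?q e s)) z + HN_norm \<eta> z)) \<longlongrightarrow> \<bar>t - t\<bar> * (0 + HN_norm \<eta> z)) (at t)"
      by (intro tendsto_intros D)
    then show "((\<lambda>s. \<bar>s - t\<bar> * (HN_dist \<eta> (HN_of (?q e s)) z + HN_norm \<eta> z)) \<longlongrightarrow> 0) (at t)" by simp
    fix s
    show "\<bar>nrm (e s - e t)\<bar> \<le> \<bar>s - t\<bar> * (HN_dist \<eta> (HN_of (?q e s)) z + HN_norm \<eta> z)"
    proof (cases "s = t")
      case False
      have "HN_norm \<eta> (\<lambda>j x. (HN_of (?q e s) j x - z j x) + z j x) \<le> HN_dist \<eta> (HN_of (?q e s)) z + HN_norm \<eta> z"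
        unfolding HN_dist_def by (intro HN_norm_triangle L2N_diff HN_of_L2N L)
      then have "nrm (?q e s) \<le> HN_dist \<eta> (HN_of (?q e s)) z + HN_norm \<eta> z" by (simp only: nrm_HN diff_add_cancel)
      then have "\<bar>s - t\<bar> * nrm (?q e s) \<le> \<bar>s - t\<bar> * (HN_dist \<eta> (HN_of (?q e s)) z + HN_norm \<eta> z)"
        by (intro mult_left_mono) auto
      moreover have "\<bar>s - t\<bar> * nrm (?q e s) = nrm (e s - e t)" using False by (simp add: nrm_scaleR)
      ultimately show ?thesis by simp
    qed simp
  qed
  have E: "((\<lambda>s. HN_dist \<eta> (HN_of (e s + e t)) (HN_of (e t + e t))) \<longlongrightarrow> 0) (at t)"
    unfolding HN_dist_HN_of using diff0 by (simp add: algebra_simps)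
  \<comment> \<open>The difference of the squared norms is the pairing of e s + e t with e s - e t;
    the sum converges by continuity, and the quotient of the difference by hypothesis.\<close>
  have "((\<lambda>s. HN_inner \<eta> (HN_of (e s + e t)) (HN_of (?q e s))) \<longlongrightarrow> HN_inner \<eta> (HN_of (e t + e t)) z) (at t)"
    by (intro tendsto_HN_inner HN_of_L2N L E D)
  moreover have "HN_inner \<eta> (HN_of (e s + e t)) (HN_of (?q e s)) = ((nrm (e s))\<^sup>2 - (nrm (e t))\<^sup>2) / (s - t)" for s
    unfolding ip_def[symmetric] ip_scaleR_right nrm_sq
    by (simp add: ip_add_left ip_diff_right ip_commute[of "e t" "e s"])
  moreover have "HN_inner \<eta> (HN_of (e t + e t)) z = 2 * HN_inner \<eta> (HN_of (e t)) z"
  proof -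
    have "H_inner \<eta> (HN_of (e t + e t) j) (z j) = 2 * H_inner \<eta> (HN_of (e t) j) (z j)" for j
    proof -
      have "(\<lambda>x. HN_of (e t + e t) j x * z j x) = (\<lambda>x. 2 * (HN_of (e t) j x * z j x))"
        by (rule ext) (simp add: HN_of_def blinfun.add_left)
      then show ?thesis by (simp only: H_inner_def integral_mult_right_zero)
    qed
    then show ?thesis by (simp add: HN_inner_def sum_distrib_left)
  qed
  ultimately show ?thesis
    unfolding has_field_derivative_iff z_def[symmetric] e_def[symmetric] by simp
qed

text \<open>The squared distance of two solutions is absolutely continuous, since strategies are
  bounded in norm, and by monotonicity its derivative is nonpositive almost everywhere. Starting
  from 0, it stays 0.\<close>

theorem flow_solution_unique:
  assumes \<xi>: "flow_solution \<eta> K F \<mu>0 \<xi>" and \<zeta>: "flow_solution \<eta> K F \<mu>0 \<zeta>" and T: "0 \<le> T"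
  shows "\<xi> T = \<zeta> T"
proof -
  define \<phi> where "\<phi> s = nrm (\<xi> s - \<zeta> s)" for s
  obtain B where B: "0 < B" "\<And>p. p \<in> strategies \<Longrightarrow> nrm p \<le> B" using strategies_bounded by blast
  have in_K: "\<xi> t \<in> strategies" "\<zeta> t \<in> strategies" if "0 \<le> t" for t
    using \<xi> \<zeta> that by (auto simp: flow_solution_def flow_domain_def)
  have \<phi>B: "\<phi> t \<le> 2 * B" if "0 \<le> t" for t
    using nrm_triangle[of "\<xi> t" "- \<zeta> t"] B(2)[OF in_K(1)[OF that]] B(2)[OF in_K(2)[OF that]] by (simp add: \<phi>_def)
  have \<phi>0: "0 \<le> \<phi> t" for t by (simp add: \<phi>_def)
  have "(\<phi> T)\<^sup>2 \<le> (\<phi> 0)\<^sup>2"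
  proof (rule absolutely_continuous_nonincreasing[OF T, of "\<lambda>t. (\<phi> t)\<^sup>2"])
    fix \<epsilon> :: real assume e: "0 < \<epsilon>"
    \<comment> \<open>Distances are at most 2 B, so their squares vary by at most 4 B times the
      variation of the distance, to which both solutions contribute; hence 8 B.\<close>
    let ?\<epsilon> = "\<epsilon> / (8 * B)"
    have e8: "0 < ?\<epsilon>" using e B by simp
    let ?ac = "\<lambda>f \<delta> \<I>. finite \<I> \<and> (\<forall>(a, b)\<in>\<I>. a \<le> b \<and> {a..b} \<subseteq> {0..T}) \<and>
        disjoint_family_on (\<lambda>(a, b). {a<..<b}) \<I> \<and> (\<Sum>(a, b)\<in>\<I>. b - a) < \<delta> \<longrightarrow>
        (\<Sum>(a, b)\<in>\<I>. HN_dist \<eta> (HN_of (f a)) (HN_of (f b))) < ?\<epsilon>"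
    have "HN_absolutely_continuous_on \<eta> {0..T} (\<lambda>t. HN_of (\<xi> t))" "HN_absolutely_continuous_on \<eta> {0..T} (\<lambda>t. HN_of (\<zeta> t))"
      using \<xi> \<zeta> T unfolding flow_solution_def by blast+
    then have "\<exists>\<delta>>0. \<forall>\<I>. ?ac \<xi> \<delta> \<I>" "\<exists>\<delta>>0. \<forall>\<I>. ?ac \<zeta> \<delta> \<I>"
      unfolding HN_absolutely_continuous_on_def using e8 by blast+
    then obtain \<delta>1 \<delta>2 where d1: "0 < \<delta>1" "\<forall>\<I>. ?ac \<xi> \<delta>1 \<I>" and d2: "0 < \<delta>2" "\<forall>\<I>. ?ac \<zeta> \<delta>2 \<I>"
      by (elim exE conjE) (rule that)
    show "\<exists>\<delta>>0. \<forall>\<I>. finite \<I> \<and> (\<forall>(l, r)\<in>\<I>. l \<le> r \<and> {l..r} \<subseteq> {0..T}) \<and>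
        disjoint_family_on (\<lambda>(l, r). {l<..<r}) \<I> \<and> (\<Sum>(l, r)\<in>\<I>. r - l) < \<delta> \<longrightarrow>
        (\<Sum>(l, r)\<in>\<I>. (\<phi> r)\<^sup>2 - (\<phi> l)\<^sup>2) < \<epsilon>"
    proof (intro exI[of _ "min \<delta>1 \<delta>2"] conjI allI impI)
      show "0 < min \<delta>1 \<delta>2" using d1 d2 by simp
      fix \<I> assume I: "finite \<I> \<and> (\<forall>(l, r)\<in>\<I>. l \<le> r \<and> {l..r} \<subseteq> {0..T}) \<and>
        disjoint_family_on (\<lambda>(l, r). {l<..<r}) \<I> \<and> (\<Sum>(l, r)\<in>\<I>. r - l) < min \<delta>1 \<delta>2"
      have "(\<Sum>(l, r)\<in>\<I>. HN_dist \<eta> (HN_of (\<xi> l)) (HN_of (\<xi> r))) < ?\<epsilon>"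
        by (rule d1(2)[THEN spec, THEN mp]) (use I in simp)
      moreover have "(\<Sum>(l, r)\<in>\<I>. HN_dist \<eta> (HN_of (\<zeta> l)) (HN_of (\<zeta> r))) < ?\<epsilon>"
        by (rule d2(2)[THEN spec, THEN mp]) (use I in simp)
      ultimately have small: "(\<Sum>(l, r)\<in>\<I>. nrm (\<xi> l - \<xi> r)) + (\<Sum>(l, r)\<in>\<I>. nrm (\<zeta> l - \<zeta> r)) < \<epsilon> / (4 * B)"
        using B by (simp add: HN_dist_HN_of field_simps)
      have "(\<Sum>(l, r)\<in>\<I>. (\<phi> r)\<^sup>2 - (\<phi> l)\<^sup>2) \<le> (\<Sum>(l, r)\<in>\<I>. 4 * B * (nrm (\<xi> l - \<xi> r) + nrm (\<zeta> l - \<zeta> r)))"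
      proof (rule sum_mono)
        fix z assume z: "z \<in> \<I>"
        obtain l r where lr: "z = (l, r)" by (cases z)
        then have "l \<le> r" "{l..r} \<subseteq> {0..T}" using I z by auto
        then have pos: "0 \<le> l" "0 \<le> r" by auto
        have "\<bar>\<phi> r - \<phi> l\<bar> \<le> nrm ((\<xi> r - \<zeta> r) - (\<xi> l - \<zeta> l))" unfolding \<phi>_def by (rule abs_nrm_diff)
        also have "(\<xi> r - \<zeta> r) - (\<xi> l - \<zeta> l) = (\<zeta> l - \<zeta> r) + - (\<xi> l - \<xi> r)" by (simp only: algebra_simps) simp
        also have "nrm \<dots> \<le> nrm (\<zeta> l - \<zeta> r) + nrm (- (\<xi> l - \<xi> r))" by (rule nrm_triangle)
        finally have d: "\<bar>\<phi> r - \<phi> l\<bar> \<le> nrm (\<xi> l - \<xi> r) + nrm (\<zeta> l - \<zeta> r)" by (simp only: nrm_minus add.commute)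
        have "(\<phi> r)\<^sup>2 - (\<phi> l)\<^sup>2 = (\<phi> r + \<phi> l) * (\<phi> r - \<phi> l)" by (simp add: power2_eq_square algebra_simps)
        also have "\<dots> \<le> (\<phi> r + \<phi> l) * \<bar>\<phi> r - \<phi> l\<bar>" using \<phi>0[of r] \<phi>0[of l] by (intro mult_left_mono) auto
        also have "\<dots> \<le> (4 * B) * \<bar>\<phi> r - \<phi> l\<bar>" using \<phi>B[OF pos(1)] \<phi>B[OF pos(2)] by (intro mult_right_mono) auto
        also have "\<dots> \<le> (4 * B) * (nrm (\<xi> l - \<xi> r) + nrm (\<zeta> l - \<zeta> r))" using d B by (intro mult_left_mono) auto
        finally show "(case z of (l, r) \<Rightarrow> (\<phi> r)\<^sup>2 - (\<phi> l)\<^sup>2) \<le> (case z of (l, r) \<Rightarrow> 4 * B * (nrm (\<xi> l - \<xi> r) + nrm (\<zeta> l - \<zeta> r)))"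
          by (simp only: lr prod.case)
      qed
      also have "\<dots> = 4 * B * ((\<Sum>(l, r)\<in>\<I>. nrm (\<xi> l - \<xi> r)) + (\<Sum>(l, r)\<in>\<I>. nrm (\<zeta> l - \<zeta> r)))"
        by (simp only: case_prod_unfold sum_distrib_left distrib_left sum.distrib)
      also have "\<dots> < 4 * B * (\<epsilon> / (4 * B))" using small B by (intro mult_strict_left_mono) auto
      also have "\<dots> = \<epsilon>" using B by simp
      finally show "(\<Sum>(l, r)\<in>\<I>. (\<phi> r)\<^sup>2 - (\<phi> l)\<^sup>2) < \<epsilon>" .
    qed
  next
    show "AE t in lborel. 0 < t \<and> t < T \<longrightarrow> (\<exists>d\<le>0. ((\<lambda>t. (\<phi> t)\<^sup>2) has_real_derivative d) (at t))"
      using flow_solution_AE[OF \<xi>] flow_solution_AE[OF \<zeta>]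
    proof eventually_elim
      case (elim t)
      show ?case
      proof
        assume "0 < t \<and> t < T"
        then have t: "0 < t" by simp
        obtain v where v: "HN_has_derivative_at \<eta> (\<lambda>t. HN_of (\<xi> t)) v t" "\<And>j. - J_map \<eta> (v j) \<in> partial_subdiff K F j (\<xi> t)"
          using elim(1) t by blast
        obtain w where w: "HN_has_derivative_at \<eta> (\<lambda>t. HN_of (\<zeta> t)) w t" "\<And>j. - J_map \<eta> (w j) \<in> partial_subdiff K F j (\<zeta> t)"
          using elim(2) t by blast
        let ?d = "HN_inner \<eta> (HN_of (\<xi> t - \<zeta> t)) (\<lambda>j x. v j x - w j x)"
        have "0 \<le> HN_inner \<eta> (HN_of (\<xi> t - \<zeta> t)) (\<lambda>j x. - v j x - - w j x)"
          by (rule monotone_L2) (use in_K t v w in \<open>auto simp: J_minus intro: L2N_minus HN_derivative_L2N\<close>)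
        also have "\<dots> = - ?d"
        proof -
          have "(\<lambda>x. a x * (- b x - - c x)) = (\<lambda>x. - (a x * (b x - c x)))" for a b c :: "'a \<Rightarrow> real"
            by (rule ext) (simp add: algebra_simps)
          then show ?thesis by (simp only: HN_inner_def H_inner_def Bochner_Integration.integral_minus sum_negf)
        qed
        finally have "2 * ?d \<le> 0" by simp
        then show "\<exists>d\<le>0. ((\<lambda>t. (\<phi> t)\<^sup>2) has_real_derivative d) (at t)"
          using distance_derivative[OF t v(1) w(1)] unfolding \<phi>_def by blast
      qed
    qed
  qed
  also have "\<phi> 0 = 0"
  proof -
    have "\<xi> 0 = \<zeta> 0" using \<xi> \<zeta> unfolding flow_solution_def by (intro ext) metis
    then show ?thesis by (simp only: \<phi>_def diff_self nrm_zero)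
  qed
  finally have "nrm (\<xi> T - \<zeta> T) = 0" by (simp add: \<phi>_def)
  then show ?thesis unfolding nrm_eq_0 by simp
qed

end

theorem theorem1p1:
  fixes \<eta> :: "'a::{banach, second_countable_topology} measure"
    and K :: "'n::finite \<Rightarrow> ('a \<Rightarrow>\<^sub>L real) set"
    and F :: "'n \<Rightarrow> ('n \<Rightarrow> 'a \<Rightarrow>\<^sub>L real) \<Rightarrow> real"
    and \<mu>0 :: "'n \<Rightarrow> 'a \<Rightarrow>\<^sub>L real"
  assumes gaussian: "centered_nondegenerate_gaussian \<eta>"
    and K_nonempty: "\<And>j. K j \<noteq> {}"
    and K_convex: "\<And>j. convex (K j)"
    and K_compact: "\<And>j. compactin weak_star (K j)"
    and F_continuous:
      "\<And>j. continuous_map (subtopology weak_star_tuples (Pi UNIV K)) euclideanreal (F j)"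
    and F_convex: "\<And>\<mu> j. \<mu> \<in> Pi UNIV K \<Longrightarrow> convex_on (K j) (\<lambda>\<nu>. F j (\<mu>(j := \<nu>)))"
    and F_monotone: "monotone_payoffs K F"
    and initial: "\<mu>0 \<in> flow_domain \<eta> K F"
  shows "\<exists>\<xi>. flow_solution \<eta> K F \<mu>0 \<xi> \<and>
           (\<forall>\<zeta>. flow_solution \<eta> K F \<mu>0 \<zeta> \<longrightarrow> (\<forall>t\<ge>0. \<zeta> t = \<xi> t)) \<and>
           HN_lipschitz_on \<eta> {0..} (\<lambda>t. HN_of (\<xi> t)) \<and>
           (\<exists>I \<mu>. (\<forall>t>0. HN_has_integral \<eta> (\<lambda>s. HN_of (\<xi> s)) (HN_of (I t)) 0 t) \<and>
                  nash_equilibrium K F \<mu> \<and>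
                  limitin weak_star_tuples (\<lambda>t j. (1 / t) *\<^sub>R I t j) \<mu> at_top)"
proof -
  have "\<forall>j. \<exists>f. f \<in> H_space \<eta> \<and> J_map \<eta> f \<in> partial_subdiff K F j \<mu>0"
    using initial by (auto simp: flow_domain_def)
  from choice[OF this] obtain h
    where h: "\<forall>j. h j \<in> H_space \<eta> \<and> J_map \<eta> (h j) \<in> partial_subdiff K F j \<mu>0" ..
  interpret gaussian_flow \<eta> K F \<mu>0 h
    by unfold_locales (use assms h in \<open>auto simp: flow_domain_def\<close>)
  have lip: "HN_lipschitz_on \<eta> {0..} (\<lambda>t. HN_of (xi t))"
    unfolding HN_lipschitz_on_def HN_dist_HN_of
    by (intro exI[of _ "HN_norm \<eta> h"]) (auto intro: xi_lipschitz)
  obtain \<sigma> where "nash_equilibrium K F \<sigma>"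
    "limitin weak_star_tuples (\<lambda>t j. (1 / t) *\<^sub>R (t *\<^sub>R mean t) j) \<sigma> at_top"
    using mean_limit_nash by blast
  then have "\<exists>I \<mu>. (\<forall>t>0. HN_has_integral \<eta> (\<lambda>s. HN_of (xi s)) (HN_of (I t)) 0 t) \<and>
      nash_equilibrium K F \<mu> \<and> limitin weak_star_tuples (\<lambda>t j. (1 / t) *\<^sub>R I t j) \<mu> at_top"
    using HN_has_integral_xi by (intro exI[of _ "\<lambda>t. t *\<^sub>R mean t"] exI[of _ \<sigma>]) blast
  moreover have "\<forall>\<zeta>. flow_solution \<eta> K F \<mu>0 \<zeta> \<longrightarrow> (\<forall>t\<ge>0. \<zeta> t = xi t)"
    using flow_solution_unique[OF _ xi_flow_solution] by blast
  ultimately show ?thesis using xi_flow_solution lip by blast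
qed

end
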